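(* Let $p$ be a prime and $\mathcal{F}$ a saturated fusion system on a finite $p$-group $S$. If either $p$ is odd, or $Z(S) \leq O_p(\mathcal{F})$, then $Z(\mathcal{F})$ is a direct factor of $Z(S)$.
   Context: For a saturated fusion system $\mathcal{F}$ on $S$: for $P \leq S$, the normalizer $N_\mathcal{F}(P)$ is the fusion subsystem on $N_S(P)$ consisting of those morphisms $\phi\colon Q \to R$ of $\mathcal{F}$ that extend to a morphism $\tilde\phi\colon PQ \to S$ of $\mathcal{F}$ with $\tilde\phi(P) = P$. A subgroup $P \trianglelefteq S$ is normal in $\mathcal{F}$ if $N_\mathcal{F}(P) = \mathcal{F}$, and $O_p(\mathcal{F})$ is the unique largest subgroup of $S$ normal in $\mathcal{F}$. The center $Z(\mathcal{F})$ is the subgroup of $Z(S)$ consisting of those elements $z$ such that every morphism $\phi\colon P \to Q$ of $\mathcal{F}$ extends to a morphism of $\mathcal{F}$ defined on $P\langle z\rangle$ that fixes $z$. *)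

theory Defs
  imports "HOL-Algebra.Algebra" "HOL-Computational_Algebra.Primes"
begin

text \<open>A morphism of a fusion system on S is represented by a pair (P, phi), where
P is a subgroup of S (the domain) and phi is an injective homomorphism from P into S,
extensional on P.  phi is a morphism P -> Q of the fusion system iff (P, phi) is in F
and phi ` P is contained in Q.\<close>

definition conjm :: "('a, 'b) monoid_scheme \<Rightarrow> 'a \<Rightarrow> 'a \<Rightarrow> 'a" where
  "conjm S g = (\<lambda>x. g \<otimes>\<^bsub>S\<^esub> x \<otimes>\<^bsub>S\<^esub> inv\<^bsub>S\<^esub> g)"

definition grp_center :: "('a, 'b) monoid_scheme \<Rightarrow> 'a set" where
  "grp_center S = {z \<in> carrier S. \<forall>y\<in>carrier S. z \<otimes>\<^bsub>S\<^esub> y = y \<otimes>\<^bsub>S\<^esub> z}"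

definition normalizer_in :: "('a, 'b) monoid_scheme \<Rightarrow> 'a set \<Rightarrow> 'a set" where
  "normalizer_in S P = {g \<in> carrier S. g <#\<^bsub>S\<^esub> P #>\<^bsub>S\<^esub> inv\<^bsub>S\<^esub> g = P}"

definition centralizer_in :: "('a, 'b) monoid_scheme \<Rightarrow> 'a set \<Rightarrow> 'a set" where
  "centralizer_in S P = {g \<in> carrier S. \<forall>x\<in>P. g \<otimes>\<^bsub>S\<^esub> x = x \<otimes>\<^bsub>S\<^esub> g}"

definition finite_p_group :: "nat \<Rightarrow> ('a, 'b) monoid_scheme \<Rightarrow> bool" where
  "finite_p_group p S \<longleftrightarrow> group S \<and> finite (carrier S) \<and> (\<exists>n. card (carrier S) = p ^ n)"

definition fusion_system :: "('a, 'b) monoid_scheme \<Rightarrow> ('a set \<times> ('a \<Rightarrow> 'a)) set \<Rightarrow> bool" where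
  "fusion_system S F \<longleftrightarrow>
     (\<forall>(P, \<phi>) \<in> F. subgroup P S \<and> \<phi> \<in> hom (S\<lparr>carrier := P\<rparr>) S \<and> inj_on \<phi> P
                      \<and> \<phi> \<in> extensional P)
   \<and> (\<forall>P g. subgroup P S \<and> g \<in> carrier S \<longrightarrow> (P, restrict (conjm S g) P) \<in> F)
   \<and> (\<forall>(P, \<phi>) \<in> F. \<forall>(Q, \<psi>) \<in> F. \<phi> ` P \<subseteq> Q \<longrightarrow> (P, restrict (\<psi> \<circ> \<phi>) P) \<in> F)
   \<and> (\<forall>(P, \<phi>) \<in> F. (\<phi> ` P, restrict (inv_into P \<phi>) (\<phi> ` P)) \<in> F)"

definition fully_normalized ::
  "('a, 'b) monoid_scheme \<Rightarrow> ('a set \<times> ('a \<Rightarrow> 'a)) set \<Rightarrow> 'a set \<Rightarrow> bool" where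
  "fully_normalized S F P \<longleftrightarrow>
     (\<forall>\<phi>. (P, \<phi>) \<in> F \<longrightarrow> card (normalizer_in S (\<phi> ` P)) \<le> card (normalizer_in S P))"

definition fully_centralized ::
  "('a, 'b) monoid_scheme \<Rightarrow> ('a set \<times> ('a \<Rightarrow> 'a)) set \<Rightarrow> 'a set \<Rightarrow> bool" where
  "fully_centralized S F P \<longleftrightarrow>
     (\<forall>\<phi>. (P, \<phi>) \<in> F \<longrightarrow> card (centralizer_in S (\<phi> ` P)) \<le> card (centralizer_in S P))"

definition AutF :: "('a set \<times> ('a \<Rightarrow> 'a)) set \<Rightarrow> 'a set \<Rightarrow> ('a \<Rightarrow> 'a) set" where
  "AutF F P = {\<phi>. (P, \<phi>) \<in> F \<and> \<phi> ` P = P}"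

definition AutS :: "('a, 'b) monoid_scheme \<Rightarrow> 'a set \<Rightarrow> ('a \<Rightarrow> 'a) set" where
  "AutS S P = (\<lambda>g. restrict (conjm S g) P) ` normalizer_in S P"

definition N_phi :: "('a, 'b) monoid_scheme \<Rightarrow> 'a set \<Rightarrow> ('a \<Rightarrow> 'a) \<Rightarrow> 'a set" where
  "N_phi S P \<phi> = {g \<in> normalizer_in S P. \<exists>h \<in> normalizer_in S (\<phi> ` P).
      \<forall>y \<in> \<phi> ` P. \<phi> (conjm S g (inv_into P \<phi> y)) = conjm S h y}"

text \<open>Saturation (Broto--Levi--Oliver): axiom (I) with the Sylow condition
(Aut_S(P) is a Sylow p-subgroup of Aut_F(P), i.e. its order is the p-part of |Aut_F(P)|),
and axiom (II), the extension axiom.\<close>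
definition saturated_fusion_system ::
  "nat \<Rightarrow> ('a, 'b) monoid_scheme \<Rightarrow> ('a set \<times> ('a \<Rightarrow> 'a)) set \<Rightarrow> bool" where
  "saturated_fusion_system p S F \<longleftrightarrow> fusion_system S F
   \<and> (\<forall>P. subgroup P S \<and> fully_normalized S F P \<longrightarrow>
          fully_centralized S F P
          \<and> card (AutS S P) = p ^ multiplicity p (card (AutF F P)))
   \<and> (\<forall>(P, \<phi>) \<in> F. fully_centralized S F (\<phi> ` P) \<longrightarrow>
          (\<exists>\<psi>. (N_phi S P \<phi>, \<psi>) \<in> F \<and> (\<forall>x\<in>P. \<psi> x = \<phi> x)))"

text \<open>P is normal in F: P is normal in S and N_F(P) = F, i.e. every morphism
phi : Q -> R of F extends to a morphism of F on PQ mapping P onto P.\<close>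
definition normal_in_fusion ::
  "('a, 'b) monoid_scheme \<Rightarrow> ('a set \<times> ('a \<Rightarrow> 'a)) set \<Rightarrow> 'a set \<Rightarrow> bool" where
  "normal_in_fusion S F P \<longleftrightarrow> P \<lhd> S \<and>
     (\<forall>(Q, \<phi>) \<in> F. \<exists>\<psi>. (P <#>\<^bsub>S\<^esub> Q, \<psi>) \<in> F \<and> (\<forall>x\<in>Q. \<psi> x = \<phi> x) \<and> \<psi> ` P = P)"

definition Op_fusion :: "('a, 'b) monoid_scheme \<Rightarrow> ('a set \<times> ('a \<Rightarrow> 'a)) set \<Rightarrow> 'a set" where
  "Op_fusion S F = (THE R. normal_in_fusion S F R \<and> (\<forall>Q. normal_in_fusion S F Q \<longrightarrow> Q \<subseteq> R))"

definition center_fusion :: "('a, 'b) monoid_scheme \<Rightarrow> ('a set \<times> ('a \<Rightarrow> 'a)) set \<Rightarrow> 'a set" where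
  "center_fusion S F = {z \<in> grp_center S. \<forall>(P, \<phi>) \<in> F.
      \<exists>\<psi>. (generate S (insert z P), \<psi>) \<in> F \<and> (\<forall>x\<in>P. \<psi> x = \<phi> x) \<and> \<psi> z = z}"

text \<open>A subgroup A of an abelian group B (inside S) is a direct factor of B.\<close>
definition direct_factor :: "('a, 'b) monoid_scheme \<Rightarrow> 'a set \<Rightarrow> 'a set \<Rightarrow> bool" where
  "direct_factor S A B \<longleftrightarrow> subgroup A S \<and> A \<subseteq> B \<and>
     (\<exists>K. subgroup K S \<and> K \<subseteq> B \<and> A \<inter> K = {\<one>\<^bsub>S\<^esub>} \<and> A <#>\<^bsub>S\<^esub> K = B)"

end

theory Submission
  imports Defs
begin

text \<open>
  If \<open>Q\<close> is normal in \<open>S\<close> and contains \<open>Z(S)\<close>, then \<open>Aut\<^sub>S(Q)\<close> has index prime to \<open>p\<close> in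
  \<open>Aut\<^sub>F(Q)\<close>, and the norm over its cosets splits off from \<open>Z(S)\<close> the subgroup \<open>W\<close> of
  elements fixed by \<open>Aut\<^sub>F(Q)\<close>. So it suffices to find \<open>Q\<close> with \<open>W = Z(F)\<close>. If \<open>Z(S)\<close> lies in
  \<open>O\<^sub>p(F)\<close>, take \<open>Q = O\<^sub>p(F)\<close>. If \<open>p\<close> is odd, take \<open>Q = J(S)\<close>, the Thompson subgroup.

  For odd \<open>p\<close>, let \<open>z\<close> be in \<open>W\<close>; by induction on its order \<open>z\<^sup>p\<close> is in \<open>Z(F)\<close>. If some
  morphism moves \<open>z\<close>, choose one whose domain \<open>P\<close> maximizes first the largest order of an abelian
  subgroup and then \<open>|J(P)|\<close>. One may assume that \<open>P = J(P)\<close> is fully normalized and that the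
  morphism is an automorphism of \<open>P\<close>. Since \<open>P\<close> is not \<open>J(S)\<close>, Thompson replacement gives an
  abelian subgroup \<open>A\<close> of maximal order in \<open>N\<^sub>S(P)\<close>, not contained in \<open>P\<close>, with \<open>[Z(P), A, A] = 1\<close>.
  By maximality of \<open>P\<close> and Sylow's theorem, \<open>z\<close> is the only point of its \<open>Aut\<^sub>F(P)\<close>-orbit fixed by
  \<open>A\<close>; since \<open>p\<close> is odd, each other \<open>A\<close>-orbit contributes a power of \<open>z\<^sup>p\<close> to the product of
  that orbit. That product is invariant under \<open>Aut\<^sub>F(P)\<close>, hence so is \<open>z\<close>.
\<close>

subsection \<open>Actions of finite p-groups\<close>

text \<open>The orbit product is useful because all points of the Aut_F(P)-orbit of z have the same
  p-th power c = z^p, which is already invariant: once every nontrivial A-orbit contributes a power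
  of c, the product is z times a power of c, and z can be recovered from it. Thompson replacement
  enters because an A-orbit must be a coset v D of a group D = [v, A], which holds when A
  centralizes D; its product is then v^|D| times the product of all elements of D. For p = 2 the
  latter factor may be an involution, and the argument stops there. The measure by which the domain
  is chosen has to meet three demands: it does not change on passing from P to J(P), it grows on
  passing from P = J(P), not J(S), to N_S(P), and it grows on passing to any subgroup containing P
  and A. The order of the domain fails the first one. The order of abelian subgroups followed by the
  order of J(P) meets all three, since equality along an inclusion forces equal Thompson
  subgroups.\<close>

lemma (in group) group_actionI:
  assumes cl: "\<And>g x. \<lbrakk>g \<in> carrier G; x \<in> E\<rbrakk> \<Longrightarrow> act g x \<in> E"
    and one: "\<And>x. x \<in> E \<Longrightarrow> act \<one> x = x"
    and mult: "\<And>g h x. \<lbrakk>g \<in> carrier G; h \<in> carrier G; x \<in> E\<rbrakk> \<Longrightarrow> act (g \<otimes> h) x = act g (act h x)"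
  shows "group_action G E (\<lambda>g. restrict (act g) E)"
proof -
  have bij: "restrict (act g) E \<in> Bij E" if g: "g \<in> carrier G" for g
  proof -
    have "bij_betw (act g) E E"
    proof (rule bij_betwI[where g="act (inv g)"])
      show "act (inv g) (act g x) = x" if "x \<in> E" for x
        using mult[of "inv g" g x] g that one by simp
      show "act g (act (inv g) x) = x" if "x \<in> E" for x
        using mult[of g "inv g" x] g that one by simp
    qed (use cl g in auto)
    then show ?thesis
      unfolding Bij_def by (simp cong: bij_betw_cong)
  qed
  have "(\<lambda>g. restrict (act g) E) \<in> hom G (BijGroup E)"
  proof (rule homI)
    fix g h assume gh: "g \<in> carrier G" "h \<in> carrier G"
    show "restrict (act (g \<otimes> h)) E = restrict (act g) E \<otimes>\<^bsub>BijGroup E\<^esub> restrict (act h) E"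
      using gh bij cl by (auto simp: BijGroup_def compose_def mult intro!: ext)
  qed (simp add: BijGroup_def bij)
  then show ?thesis
    using group_BijGroup by (simp add: group_action_def group_hom_def group_hom_axioms_def is_group)
qed

text \<open>Orbit sizes divide \<open>p ^ n\<close>, so an orbit that is not a single point has size
  divisible by \<open>p\<close>, and modulo \<open>p\<close> only the fixed points count.\<close>

lemma (in group_action) p_group_fixed_points:
  assumes p: "Factorial_Ring.prime (p::nat)" and ord: "order G = p ^ n" and fin: "finite E"
  shows "card E mod p = card {x \<in> E. \<forall>g\<in>carrier G. \<phi> g x = x} mod p"
proof -
  let ?F = "{x \<in> E. \<forall>g\<in>carrier G. \<phi> g x = x}"
  \<comment> \<open>The indicator of the moved points: its sum over \<open>E\<close> is the size of
    the complement of \<open>?F\<close>, and it can be summed orbit by orbit.\<close>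
  let ?f = "\<lambda>x. if x \<in> ?F then 0 else 1::nat"
  have "p dvd (\<Sum>x\<in>U. ?f x)" if U: "U \<in> orbits G E \<phi>" for U
  proof -
    obtain x where x: "x \<in> E" "U = orbit G \<phi> x"
      using U by (auto simp: orbits_def)
    have fo: "\<phi> g y = y" if "x \<in> ?F" "y \<in> U" "g \<in> carrier G" for y g
      using that x by (auto simp: orbit_def)
    show ?thesis
    proof (cases "x \<in> ?F")
      case True
      then have "U \<subseteq> ?F" using x by (auto simp: orbit_def)
      then show ?thesis by (simp add: subset_iff)
    next
      case False
      have UE: "U \<subseteq> E" using x element_image by (auto simp: orbit_def)
      have "y \<notin> ?F" if y: "y \<in> U" for y
      proof
        assume yF: "y \<in> ?F"
        have "x \<in> orbit G \<phi> y" using orbit_sym x y UE by blast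
        then have "x = y" using yF by (auto simp: orbit_def)
        with yF False show False by simp
      qed
      then have "(\<Sum>x\<in>U. ?f x) = (\<Sum>x\<in>U. 1)" by (intro sum.cong) auto
      then have s: "(\<Sum>x\<in>U. ?f x) = card U" by simp
      have "card U * card (stabilizer G \<phi> x) = p ^ n"
        using orbit_stabilizer_theorem[OF x(1)] x ord by simp
      then have "card U dvd p ^ n" by (metis dvd_triv_left)
      then obtain k where k: "card U = p ^ k"
        using p by (auto simp: divides_primepow_nat)
      have "card U \<noteq> 1"
      proof
        assume "card U = 1"
        moreover have "x \<in> U" using orbit_refl x by blast
        ultimately have "U = {x}" by (metis card_1_singletonE singletonD)
        then have "x \<in> ?F" using x by (auto simp: orbit_def)
        with False show False by simp
      qed
      then have "p dvd card U" using k by (cases k) auto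
      then show ?thesis using s by simp
    qed
  qed
  then have "p dvd (\<Sum>U\<in>orbits G E \<phi>. \<Sum>x\<in>U. ?f x)" by (simp add: dvd_sum)
  then have "p dvd (\<Sum>x\<in>E. ?f x)" by (simp only: disjoint_sum[OF fin])
  also have "(\<Sum>x\<in>E. ?f x) = (\<Sum>x\<in>E - ?F. 1)"
    using fin by (intro sum.mono_neutral_cong_right) auto
  also have "\<dots> = card (E - ?F)" by simp
  also have "card (E - ?F) = card E - card ?F"
    using fin by (intro card_Diff_subset) auto
  finally have "p dvd card E - card ?F" .
  moreover have "card ?F \<le> card E" using fin by (intro card_mono) auto
  ultimately show ?thesis
    by (simp add: mod_eq_dvd_iff_nat)
qed

text \<open>\<open>K\<close> acts through \<open>h\<close> by left multiplication on the cosets of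
  \<open>T\<close> in \<open>L\<close>. As \<open>T\<close> is Sylow in the whole group, their
  number is prime to \<open>p\<close>, so the p-group \<open>K\<close> fixes some coset x T, and
  this says that x^-1 h(K) x lies in \<open>T\<close>. The intermediate \<open>L\<close> makes it
  possible to look for x inside a stabilizer.\<close>

lemma (in group) sylow_conjugate:
  assumes p: "Factorial_Ring.prime (p::nat)" and fin: "finite (carrier G)"
    and T: "subgroup T G" and cT: "card T = p ^ multiplicity p (order G)"
    and L: "subgroup L G" and TL: "T \<subseteq> L"
    and K: "group K" and ordK: "order K = p ^ n"
    and h: "h \<in> hom K G" and hL: "h ` carrier K \<subseteq> L"
  shows "\<exists>x\<in>L. \<forall>k\<in>carrier K. inv x \<otimes> h k \<otimes> x \<in> T"
proof -
  interpret K: group K by fact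
  interpret L: group "G\<lparr>carrier := L\<rparr>" using L by (rule subgroup_imp_group)
  have LG: "L \<subseteq> carrier G" using L subgroup.subset by blast
  have TL': "subgroup T (G\<lparr>carrier := L\<rparr>)"
    using T TL L subgroup_incl by blast
  define C0 where "C0 = (\<lambda>x. x <# T) ` L"
  have C0: "C0 = lcosets\<^bsub>G\<lparr>carrier := L\<rparr>\<^esub> T"
    by (auto simp: C0_def LCOSETS_def)
  have finL: "finite L" using LG fin finite_subset by blast
  have cC0: "card C0 * card T = card L"
    using L.l_lagrange[OF _ TL'] finL by (simp add: C0 order_def)
  have act: "group_action K C0 (\<lambda>k. restrict (\<lambda>C. h k <# C) C0)"
  proof (rule K.group_actionI)
    fix k C assume k: "k \<in> carrier K" and "C \<in> C0"
    then obtain x where x: "x \<in> L" "C = x <# T" by (auto simp: C0_def)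
    have "h k \<in> L" using hL k by auto
    then have "h k <# C = (h k \<otimes> x) <# T" "h k \<otimes> x \<in> L"
      using x lcos_m_assoc[OF subgroup.subset[OF T], of "h k" x] LG L by (auto simp: subgroup.m_closed)
    then show "h k <# C \<in> C0" by (auto simp: C0_def)
  next
    fix C assume "C \<in> C0"
    then have "C \<subseteq> carrier G" using T LG by (auto simp: C0_def l_coset_def subgroup.mem_carrier)
    then show "h \<one>\<^bsub>K\<^esub> <# C = C"
      using hom_one[OF h K is_group] lcos_mult_one by simp
  next
    fix k l C assume kl: "k \<in> carrier K" "l \<in> carrier K" and "C \<in> C0"
    then have C: "C \<subseteq> carrier G" using T LG by (auto simp: C0_def l_coset_def subgroup.mem_carrier)
    show "h (k \<otimes>\<^bsub>K\<^esub> l) <# C = h k <# (h l <# C)"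
      using kl C h lcos_m_assoc[OF C, of "h k" "h l"] by (simp add: hom_mult hom_in_carrier)
  qed
  have "finite C0" using finL by (simp add: C0_def)
  from group_action.p_group_fixed_points[OF act p ordK this]
  have cong: "card C0 mod p = card {C \<in> C0. \<forall>k\<in>carrier K. h k <# C = C} mod p" 
    by (simp cong: conj_cong)
  have "\<not> p dvd card C0"
  proof
    assume "p dvd card C0"
    then have "p * card T dvd card L" using cC0 by (metis mult_dvd_mono dvd_refl)
    also have "card L dvd order G" using lagrange[OF L] by (metis dvd_triv_right)
    finally have "p ^ Suc (multiplicity p (order G)) dvd order G" using cT by simp
    moreover have "order G \<noteq> 0" using fin order_gt_0_iff_finite by simp
    moreover have "\<not> is_unit p" using prime_gt_1_nat[OF p] by simp
    ultimately show False
      using power_dvd_iff_le_multiplicity[of "order G" p "Suc (multiplicity p (order G))"] by simp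
  qed
  then have "{C \<in> C0. \<forall>k\<in>carrier K. h k <# C = C} \<noteq> {}"
    using cong by (intro notI) (simp add: dvd_eq_mod_eq_0)
  then obtain x where x: "x \<in> L" "\<And>k. k \<in> carrier K \<Longrightarrow> h k <# (x <# T) = x <# T"
    by (auto simp: C0_def)
  have "inv x \<otimes> h k \<otimes> x \<in> T" if k: "k \<in> carrier K" for k
  proof -
    have hx: "h k \<in> carrier G" "x \<in> carrier G" using k h LG x by (auto simp: hom_in_carrier)
    have "h k \<otimes> x \<in> h k <# (x <# T)"
      using hx T subgroup.one_closed[OF T] by (force simp: l_coset_def)
    then have "h k \<otimes> x \<in> x <# T" using x k by simp
    then obtain t where t: "t \<in> T" "h k \<otimes> x = x \<otimes> t" by (auto simp: l_coset_def)
    have "inv x \<otimes> h k \<otimes> x = inv x \<otimes> (x \<otimes> t)"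
      using hx t by (simp add: m_assoc)
    also have "\<dots> = t" using hx t T by (simp add: m_assoc[symmetric] subgroup.mem_carrier)
    finally show ?thesis using t by simp
  qed
  then show ?thesis using x by blast
qed

text \<open>\<open>H\<close> acts by left multiplication on its own cosets, whose number is a
  nontrivial power of \<open>p\<close>. Since the coset \<open>H\<close> is fixed, another coset x H
  is fixed too, and then x^-1 normalizes \<open>H\<close>.\<close>

lemma (in group) p_group_normalizer_grows:
  assumes p: "Factorial_Ring.prime (p::nat)" and ord: "order G = p ^ n"
    and H: "subgroup H G" and ne: "H \<noteq> carrier G"
  shows "\<exists>x\<in>carrier G. x \<notin> H \<and> (\<forall>h\<in>H. x \<otimes> h \<otimes> inv x \<in> H)"
proof -
  have fin: "finite (carrier G)" using ord p order_gt_0_iff_finite prime_gt_0_nat by simp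
  have HG: "H \<subseteq> carrier G" using H subgroup.subset by blast
  interpret H: group "G\<lparr>carrier := H\<rparr>" using H by (rule subgroup_imp_group)
  define C0 where "C0 = lcosets H"
  have cC0: "card C0 * card H = p ^ n" using l_lagrange[OF fin H] ord by (simp add: C0_def)
  then have "card C0 dvd p ^ n" "card H dvd p ^ n" by (metis dvd_triv_left dvd_triv_right)+
  then obtain k m where k: "card C0 = p ^ k" and m: "card H = p ^ m"
    using p by (auto simp: divides_primepow_nat)
  have "card C0 \<noteq> 1"
  proof
    assume "card C0 = 1"
    then have "card H = card (carrier G)" using cC0 ord by (simp add: order_def)
    then show False using HG fin ne card_subset_eq by blast
  qed
  then have pX: "p dvd card C0" using k by (cases k) auto
  have XG: "C \<subseteq> carrier G" if "C \<in> C0" for C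
    using that HG by (auto simp: C0_def LCOSETS_def l_coset_def)
  have act: "group_action (G\<lparr>carrier := H\<rparr>) C0 (\<lambda>k. restrict (\<lambda>C. k <# C) C0)"
  proof (rule H.group_actionI)
    fix k C assume k: "k \<in> carrier (G\<lparr>carrier := H\<rparr>)" and "C \<in> C0"
    then obtain x where x: "x \<in> carrier G" "C = x <# H" by (auto simp: C0_def LCOSETS_def)
    then have "k <# C = (k \<otimes> x) <# H" "k \<otimes> x \<in> carrier G"
      using k HG lcos_m_assoc[OF HG, of k x] by auto
    then show "k <# C \<in> C0" by (auto simp: C0_def LCOSETS_def)
  next
    fix k l C assume "k \<in> carrier (G\<lparr>carrier := H\<rparr>)" "l \<in> carrier (G\<lparr>carrier := H\<rparr>)" "C \<in> C0"
    then show "(k \<otimes>\<^bsub>G\<lparr>carrier := H\<rparr>\<^esub> l) <# C = k <# (l <# C)"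
      using HG XG lcos_m_assoc[of C k l] by auto
  qed (use XG lcos_mult_one in auto)
  have finX: "finite C0" using fin by (simp add: C0_def LCOSETS_def)
  let ?F = "{C \<in> C0. \<forall>k\<in>H. k <# C = C}"
  have "card C0 mod p = card ?F mod p"
    using group_action.p_group_fixed_points[OF act p _ finX, of m] m by (simp add: order_def cong: conj_cong)
  then have pF: "p dvd card ?F" using pX by (simp add: dvd_eq_mod_eq_0)
  have "H \<in> ?F"
  proof -
    have "H = \<one> <# H" using lcos_mult_one[OF HG] by simp
    moreover have "k <# H = H" if "k \<in> H" for k
      using that H by (meson coset_join3 HG subsetD)
    ultimately show ?thesis by (auto simp: C0_def LCOSETS_def)
  qed
  moreover have "?F \<noteq> {H}"
  proof
    assume "?F = {H}"
    then have "card ?F = 1" by simp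
    with pF p show False by (simp add: prime_gt_1_nat not_prime_unit)
  qed
  ultimately obtain C where C: "C \<in> ?F" "C \<noteq> H" by blast
  then obtain x where x: "x \<in> carrier G" "C = x <# H" by (auto simp: C0_def LCOSETS_def)
  have "inv x \<notin> H"
  proof
    assume "inv x \<in> H"
    then have "x \<in> H" using H x by (metis inv_inv subgroup.m_inv_closed)
    then show False using C x H by (meson coset_join3 HG subsetD)
  qed
  moreover have "inv x \<otimes> h \<otimes> inv (inv x) \<in> H" if h: "h \<in> H" for h
  proof -
    have hx: "h \<in> carrier G" using h HG by auto
    have "h \<otimes> x \<in> h <# (x <# H)"
      using hx x subgroup.one_closed[OF H] by (force simp: l_coset_def)
    then have "h \<otimes> x \<in> x <# H" using x C h by simp
    then obtain t where t: "t \<in> H" "h \<otimes> x = x \<otimes> t" by (auto simp: l_coset_def)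
    have "inv x \<otimes> h \<otimes> x = inv x \<otimes> (x \<otimes> t)"
      using hx x t by (simp add: m_assoc)
    also have "\<dots> = t" using x t HG by (simp add: m_assoc[symmetric] subsetD)
    finally show ?thesis using t x by simp
  qed
  ultimately show ?thesis using x by blast
qed

subsection \<open>Saturated fusion systems\<close>

locale saturated_fusion = group S for S :: "('a, 'b) monoid_scheme" (structure) +
  fixes p :: nat and F :: "('a set \<times> ('a \<Rightarrow> 'a)) set"
  assumes prime_p: "Factorial_Ring.prime p"
    and p_group: "finite_p_group p S"
    and sat: "saturated_fusion_system p S F"
begin

section \<open>Morphisms as maps: products, composition, restriction, inverses\<close>

lemma fin: "finite (carrier S)"
  using p_group by (simp add: finite_p_group_def)

lemma order_p_power: "\<exists>n. order S = p ^ n"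
  using p_group by (simp add: finite_p_group_def order_def)

lemma finite_subgroup: "subgroup P S \<Longrightarrow> finite P"
  using fin finite_subset subgroup.subset by blast

lemma card_subgroup: assumes "subgroup P S" shows "\<exists>n. card P = p ^ n"
proof -
  obtain n where "order S = p ^ n" using order_p_power by blast
  then have "card P dvd p ^ n" using lagrange[OF assms] by (metis dvd_triv_right)
  then show ?thesis using prime_p by (auto simp: divides_primepow_nat)
qed

lemma fus: "fusion_system S F"
  using sat by (simp add: saturated_fusion_system_def)

lemma F_D: "(P, \<phi>) \<in> F \<Longrightarrow>
    subgroup P S \<and> \<phi> \<in> hom (S\<lparr>carrier := P\<rparr>) S \<and> inj_on \<phi> P \<and> \<phi> \<in> extensional P"
  using fus unfolding fusion_system_def by (elim conjE) (drule (1) bspec, simp)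

lemma F_sub: "(P, \<phi>) \<in> F \<Longrightarrow> subgroup P S"
  and F_inj: "(P, \<phi>) \<in> F \<Longrightarrow> inj_on \<phi> P"
  and F_ext: "(P, \<phi>) \<in> F \<Longrightarrow> \<phi> \<in> extensional P"
  and F_hom: "(P, \<phi>) \<in> F \<Longrightarrow> \<phi> \<in> hom (S\<lparr>carrier := P\<rparr>) S"
  by (simp_all add: F_D)

lemma F_carrier: "(P, \<phi>) \<in> F \<Longrightarrow> x \<in> P \<Longrightarrow> x \<in> carrier S"
  by (rule subgroup.mem_carrier[OF F_sub])

lemma F_closed: "(P, \<phi>) \<in> F \<Longrightarrow> x \<in> P \<Longrightarrow> \<phi> x \<in> carrier S"
  using F_hom[of P \<phi>] by (auto simp: hom_def)

lemma F_mult: "(P, \<phi>) \<in> F \<Longrightarrow> x \<in> P \<Longrightarrow> y \<in> P \<Longrightarrow> \<phi> (x \<otimes> y) = \<phi> x \<otimes> \<phi> y"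
  using F_hom[of P \<phi>] by (auto simp: hom_def)

lemma F_group_hom: assumes "(P, \<phi>) \<in> F" shows "group_hom (S\<lparr>carrier := P\<rparr>) S \<phi>"
  using F_hom[OF assms] F_sub[OF assms] subgroup_imp_group is_group
  by (auto simp: group_hom_def group_hom_axioms_def)

lemma F_one: assumes "(P, \<phi>) \<in> F" shows "\<phi> \<one> = \<one>"
  using group_hom.hom_one[OF F_group_hom[OF assms]] by simp

lemma F_m_inv: assumes "(P, \<phi>) \<in> F" "x \<in> P" shows "\<phi> (inv x) = inv (\<phi> x)"
  using group_hom.hom_inv[OF F_group_hom[OF assms(1)], of x] assms F_sub m_inv_consistent
  by fastforce

lemma F_conj: "subgroup P S \<Longrightarrow> g \<in> carrier S \<Longrightarrow> (P, restrict (conjm S g) P) \<in> F"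
  using fus unfolding fusion_system_def by blast

lemma F_comp: "(P, \<phi>) \<in> F \<Longrightarrow> (Q, \<psi>) \<in> F \<Longrightarrow> \<phi> ` P \<subseteq> Q \<Longrightarrow> (P, restrict (\<psi> \<circ> \<phi>) P) \<in> F"
  using fus unfolding fusion_system_def by blast

lemma F_inverse: "(P, \<phi>) \<in> F \<Longrightarrow> (\<phi> ` P, restrict (inv_into P \<phi>) (\<phi> ` P)) \<in> F"
  using fus unfolding fusion_system_def by blast

lemma conjm_one: "x \<in> carrier S \<Longrightarrow> conjm S \<one> x = x"
  by (simp add: conjm_def)

lemma conjm_closed: "g \<in> carrier S \<Longrightarrow> x \<in> carrier S \<Longrightarrow> conjm S g x \<in> carrier S"
  by (simp add: conjm_def)

lemma conjm_mult: "g \<in> carrier S \<Longrightarrow> h \<in> carrier S \<Longrightarrow> x \<in> carrier S \<Longrightarrow>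
    conjm S (g \<otimes> h) x = conjm S g (conjm S h x)"
  by (simp add: conjm_def m_assoc inv_mult_group)

lemma conjm_hom: "g \<in> carrier S \<Longrightarrow> x \<in> carrier S \<Longrightarrow> y \<in> carrier S \<Longrightarrow>
    conjm S g (x \<otimes> y) = conjm S g x \<otimes> conjm S g y"
  by (simp add: conjm_def m_assoc inv_solve_left)

lemma conjm_inv: "g \<in> carrier S \<Longrightarrow> x \<in> carrier S \<Longrightarrow> conjm S (inv g) (conjm S g x) = x"
  using conjm_mult[of "inv g" g x] by (simp add: conjm_one)

lemma conjm_inj: "g \<in> carrier S \<Longrightarrow> inj_on (conjm S g) (carrier S)"
  by (rule inj_on_inverseI[where g="conjm S (inv g)"]) (rule conjm_inv)

lemma conjm_fixes_iff: "g \<in> carrier S \<Longrightarrow> x \<in> carrier S \<Longrightarrow> conjm S g x = x \<longleftrightarrow> g \<otimes> x = x \<otimes> g"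
  using inv_solve_right[of x "g \<otimes> x" g] by (auto simp: conjm_def)

text \<open>An inclusion is conjugation by \<open>\<one>\<close>, hence a morphism; restricting is
  composing with it.\<close>

lemma F_restrict: assumes "(P, \<phi>) \<in> F" "subgroup Q S" "Q \<subseteq> P" shows "(Q, restrict \<phi> Q) \<in> F"
proof -
  have car: "x \<in> carrier S" if "x \<in> Q" for x using subgroup.mem_carrier[OF assms(2) that] .
  have "(Q, restrict (conjm S \<one>) Q) \<in> F" using F_conj assms by simp
  moreover have "restrict (conjm S \<one>) Q ` Q \<subseteq> P" using assms car by (auto simp: conjm_one)
  ultimately have "(Q, restrict (\<phi> \<circ> restrict (conjm S \<one>) Q) Q) \<in> F" using F_comp assms by blast
  also have "restrict (\<phi> \<circ> restrict (conjm S \<one>) Q) Q = restrict \<phi> Q"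
    using car by (auto simp: conjm_one restrict_def)
  finally show ?thesis .
qed

lemma F_image_sub: assumes "(P, \<phi>) \<in> F" "subgroup A S" "A \<subseteq> P" shows "subgroup (\<phi> ` A) S"
proof -
  have "subgroup A (S\<lparr>carrier := P\<rparr>)" using assms F_sub subgroup_incl by blast
  then show ?thesis using group_hom.subgroup_img_is_subgroup[OF F_group_hom[OF assms(1)]] by blast
qed

lemma F_image: "(P, \<phi>) \<in> F \<Longrightarrow> subgroup (\<phi> ` P) S"
  using F_image_sub F_sub by blast

lemma F_back: assumes "(P, \<phi>) \<in> F" 
  obtains \<psi> where "(\<phi> ` P, \<psi>) \<in> F" "\<psi> ` \<phi> ` P = P" "\<And>x. x \<in> P \<Longrightarrow> \<psi> (\<phi> x) = x"
    "\<And>y. y \<in> \<phi> ` P \<Longrightarrow> \<phi> (\<psi> y) = y"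
proof
  let ?\<psi> = "restrict (inv_into P \<phi>) (\<phi> ` P)"
  show "(\<phi> ` P, ?\<psi>) \<in> F" using F_inverse assms by blast
  show *: "?\<psi> (\<phi> x) = x" if "x \<in> P" for x using that F_inj[OF assms] by simp
  then show "?\<psi> ` \<phi> ` P = P" by (force simp: image_image)
  show "\<phi> (?\<psi> y) = y" if "y \<in> \<phi> ` P" for y using that by (simp add: f_inv_into_f)
qed

lemma F_card: "(P, \<phi>) \<in> F \<Longrightarrow> A \<subseteq> P \<Longrightarrow> card (\<phi> ` A) = card A"
  using F_inj card_image inj_on_subset by metis

section \<open>Normalizers, centralizers and the extension axiom\<close>

lemma normalizer_iff:
  assumes "subgroup P S"
  shows "g \<in> normalizer_in S P \<longleftrightarrow> g \<in> carrier S \<and> (\<forall>x\<in>P. conjm S g x \<in> P)"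
proof -
  have "g <# P #> inv g = P \<longleftrightarrow> (\<forall>x\<in>P. conjm S g x \<in> P)" if g: "g \<in> carrier S"
  proof -
    have "g <# P #> inv g = conjm S g ` P"
      by (auto simp: l_coset_def r_coset_def conjm_def)
    \<comment> \<open>Conjugation is injective and \<open>P\<close> is finite, so mapping
      \<open>P\<close> into itself is already mapping it onto itself.\<close>
    moreover have "inj_on (conjm S g) P"
      using conjm_inj[OF g] subgroup.subset[OF assms] by (rule inj_on_subset)
    ultimately show ?thesis using finite_subgroup[OF assms] 
      by (metis card_image card_subset_eq image_eqI image_subsetI)
  qed
  then show ?thesis by (auto simp: normalizer_in_def)
qed

lemma normalizer_subgroup: assumes P: "subgroup P S" shows "subgroup (normalizer_in S P) S"
proof (rule subgroup.intro)
  show N: "normalizer_in S P \<subseteq> carrier S" by (auto simp: normalizer_in_def)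
  show "\<one> \<in> normalizer_in S P" 
    using P subgroup.mem_carrier[OF P] by (simp add: normalizer_iff conjm_one)
  show "x \<otimes> y \<in> normalizer_in S P" if "x \<in> normalizer_in S P" "y \<in> normalizer_in S P" for x y
    using that subgroup.mem_carrier[OF P] by (auto simp: normalizer_iff[OF P] conjm_mult)
  show "inv x \<in> normalizer_in S P" if x: "x \<in> normalizer_in S P" for x
  proof -
    have xc: "x \<in> carrier S" using x N by auto
    have "inj_on (conjm S x) P"
      using conjm_inj[OF xc] subgroup.subset[OF P] by (rule inj_on_subset)
    moreover have "conjm S x ` P \<subseteq> P" using x by (auto simp: normalizer_iff[OF P])
    ultimately have "conjm S x ` P = P" using finite_subgroup[OF P] by (simp add: endo_inj_surj)
    then have "conjm S (inv x) y \<in> P" if "y \<in> P" for y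
      using that conjm_inv[OF xc] subgroup.mem_carrier[OF P] by (metis imageE)
    then show ?thesis using xc by (simp add: normalizer_iff[OF P])
  qed
qed

lemma subset_normalizer: assumes P: "subgroup P S" shows "P \<subseteq> normalizer_in S P"
  using P by (auto simp: normalizer_iff conjm_def subgroup.mem_carrier subgroup.m_closed subgroup.m_inv_closed)

lemma centralizer_subset_normalizer: 
  assumes P: "subgroup P S" shows "centralizer_in S P \<subseteq> normalizer_in S P"
proof
  fix g assume g: "g \<in> centralizer_in S P"
  then have "conjm S g x = x" if "x \<in> P" for x
    using that conjm_fixes_iff[of g x] subgroup.mem_carrier[OF P] by (auto simp: centralizer_in_def)
  then show "g \<in> normalizer_in S P" using g by (auto simp: normalizer_iff[OF P] centralizer_in_def)
qed

lemma N_phi_iff: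
  assumes "(P, \<phi>) \<in> F"
  shows "g \<in> N_phi S P \<phi> \<longleftrightarrow> g \<in> normalizer_in S P \<and>
    (\<exists>h\<in>normalizer_in S (\<phi> ` P). \<forall>x\<in>P. \<phi> (conjm S g x) = conjm S h (\<phi> x))"
  using F_inj[OF assms] by (simp add: N_phi_def cong: ball_cong)

text \<open>A morphism carries conjugation by g in \<open>P\<close> to conjugation by \<phi>(g),
  which serves as the witness.\<close>

lemma subset_N_phi: assumes P: "(P, \<phi>) \<in> F" shows "P \<subseteq> N_phi S P \<phi>"
proof
  fix g assume g: "g \<in> P"
  have s: "subgroup P S" by (rule F_sub[OF P])
  have "\<phi> (conjm S g x) = conjm S (\<phi> g) (\<phi> x)" if "x \<in> P" for x
    using that g s F_mult[OF P] F_m_inv[OF P] by (simp add: conjm_def subgroup.m_closed subgroup.m_inv_closed)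
  then show "g \<in> N_phi S P \<phi>"
    using g subset_normalizer[OF s] subset_normalizer[OF F_image[OF P]] by (auto simp: N_phi_iff[OF P])
qed

lemma centralizer_subset_N_phi: assumes P: "(P, \<phi>) \<in> F" shows "centralizer_in S P \<subseteq> N_phi S P \<phi>"
proof
  fix g assume g: "g \<in> centralizer_in S P"
  have s: "subgroup P S" by (rule F_sub[OF P])
  have "conjm S g x = x" if "x \<in> P" for x
    using that g conjm_fixes_iff[of g x] subgroup.mem_carrier[OF s] by (auto simp: centralizer_in_def)
  then have "\<forall>x\<in>P. \<phi> (conjm S g x) = conjm S \<one> (\<phi> x)"
    using F_closed[OF P] by (simp add: conjm_one)
  moreover have "\<one> \<in> normalizer_in S (\<phi> ` P)"
    using normalizer_subgroup[OF F_image[OF P]] subgroup.one_closed by blast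
  ultimately show "g \<in> N_phi S P \<phi>"
    using g centralizer_subset_normalizer[OF s] by (auto simp: N_phi_iff[OF P])
qed

lemma fully_normalized_centralized: 
  "subgroup P S \<Longrightarrow> fully_normalized S F P \<Longrightarrow> fully_centralized S F P"
  and fully_normalized_Sylow: 
  "subgroup P S \<Longrightarrow> fully_normalized S F P \<Longrightarrow> card (AutS S P) = p ^ multiplicity p (card (AutF F P))"
  using sat unfolding saturated_fusion_system_def by blast+

text \<open>Axiom (I) turns full normalization of the image into the full centralization that axiom
  (II) asks for.\<close>

lemma extension:
  assumes "(P, \<phi>) \<in> F" "fully_normalized S F (\<phi> ` P)"
  obtains \<psi> where "(N_phi S P \<phi>, \<psi>) \<in> F" "\<And>x. x \<in> P \<Longrightarrow> \<psi> x = \<phi> x"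
  using assms fully_normalized_centralized[OF F_image[OF assms(1)]] sat 
  unfolding saturated_fusion_system_def by blast

section \<open>The group Aut_F(P) and its subgroup Aut_S(P)\<close>

definition aut_group :: "'a set \<Rightarrow> ('a \<Rightarrow> 'a) monoid" where
  "aut_group P = \<lparr>carrier = AutF F P, monoid.mult = compose P, one = restrict id P\<rparr>"

lemma aut_group_simps [simp]: "carrier (aut_group P) = AutF F P"
  "monoid.mult (aut_group P) = compose P" "one (aut_group P) = restrict id P"
  by (auto simp: aut_group_def)

lemma AutF_D: assumes "\<alpha> \<in> AutF F P" shows "(P, \<alpha>) \<in> F" "\<alpha> ` P = P" "x \<in> P \<Longrightarrow> \<alpha> x \<in> P"
  using assms by (auto simp: AutF_def)

lemma finite_AutF: assumes P: "subgroup P S" shows "finite (AutF F P)"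
proof (rule finite_subset)
  show "AutF F P \<subseteq> P \<rightarrow>\<^sub>E P"
    by (auto simp: AutF_def PiE_def Pi_def F_ext)
  show "finite (P \<rightarrow>\<^sub>E P)" using finite_subgroup[OF P] by (simp add: finite_PiE)
qed

lemma AutF_one: assumes P: "subgroup P S" shows "restrict id P \<in> AutF F P"
proof -
  have "restrict (conjm S \<one>) P = restrict id P"
    using subgroup.mem_carrier[OF P] by (auto simp: conjm_one restrict_def)
  then show ?thesis using F_conj[OF P, of \<one>] by (simp add: AutF_def)
qed

lemma AutF_comp: assumes "\<alpha> \<in> AutF F P" "\<beta> \<in> AutF F P" shows "compose P \<alpha> \<beta> \<in> AutF F P"
proof -
  have "(P, restrict (\<alpha> \<circ> \<beta>) P) \<in> F" using F_comp assms AutF_D by blast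
  moreover have "restrict (\<alpha> \<circ> \<beta>) P = compose P \<alpha> \<beta>" by (auto simp: compose_def)
  moreover have "compose P \<alpha> \<beta> ` P = P"
    using AutF_D(2)[OF assms(1)] AutF_D(2)[OF assms(2)] by (metis surj_compose)
  ultimately show ?thesis by (simp add: AutF_def)
qed

lemma AutF_inv: 
  assumes "\<alpha> \<in> AutF F P" 
  obtains \<beta> where "\<beta> \<in> AutF F P" "\<And>x. x \<in> P \<Longrightarrow> \<beta> (\<alpha> x) = x" "\<And>x. x \<in> P \<Longrightarrow> \<alpha> (\<beta> x) = x"
proof -
  obtain \<beta> where "(\<alpha> ` P, \<beta>) \<in> F" "\<beta> ` \<alpha> ` P = P" "\<And>x. x \<in> P \<Longrightarrow> \<beta> (\<alpha> x) = x" "\<And>y. y \<in> \<alpha> ` P \<Longrightarrow> \<alpha> (\<beta> y) = y"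
    using F_back[OF AutF_D(1)[OF assms]] by metis
  then show ?thesis using that[of \<beta>] AutF_D(2)[OF assms] by (simp add: AutF_def)
qed

text \<open>The maps in \<open>AutF F P\<close> are extensional on \<open>P\<close>, so the group
  laws for \<open>compose P\<close> hold as equalities of functions.\<close>

lemma aut_group_group: assumes P: "subgroup P S" shows "group (aut_group P)"
proof (rule groupI; simp)
  fix \<alpha> assume a: "\<alpha> \<in> AutF F P"
  show "compose P (restrict id P) \<alpha> = \<alpha>"
    using F_ext[OF AutF_D(1)[OF a]] AutF_D(3)[OF a] by (auto simp: compose_def extensional_def intro!: ext)
  obtain \<beta> where b: "\<beta> \<in> AutF F P" "\<And>x. x \<in> P \<Longrightarrow> \<beta> (\<alpha> x) = x" using AutF_inv[OF a] by metis
  have "compose P \<beta> \<alpha> = restrict id P" using b(2) by (auto simp: compose_def)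
  then show "\<exists>\<beta>\<in>AutF F P. compose P \<beta> \<alpha> = restrict id P" using b(1) by blast
next
  fix \<alpha> \<beta> \<gamma> assume "\<alpha> \<in> AutF F P" "\<beta> \<in> AutF F P" "\<gamma> \<in> AutF F P"
  then show "compose P (compose P \<alpha> \<beta>) \<gamma> = compose P \<alpha> (compose P \<beta> \<gamma>)"
    using AutF_D(3) by (auto simp: compose_def intro!: ext)
qed (auto simp: AutF_comp AutF_one P)

lemma aut_group_inv: 
  assumes P: "subgroup P S" and a: "\<alpha> \<in> AutF F P" 
  shows "inv\<^bsub>aut_group P\<^esub> \<alpha> \<in> AutF F P"
    "\<And>x. x \<in> P \<Longrightarrow> (inv\<^bsub>aut_group P\<^esub> \<alpha>) (\<alpha> x) = x"
    "\<And>x. x \<in> P \<Longrightarrow> \<alpha> ((inv\<^bsub>aut_group P\<^esub> \<alpha>) x) = x"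
proof -
  interpret A: group "aut_group P" using P by (rule aut_group_group)
  show "inv\<^bsub>aut_group P\<^esub> \<alpha> \<in> AutF F P" using A.inv_closed a by simp
  show "(inv\<^bsub>aut_group P\<^esub> \<alpha>) (\<alpha> x) = x" if "x \<in> P" for x
    using fun_cong[OF A.l_inv, of \<alpha> x] a that by (simp add: compose_def)
  show "\<alpha> ((inv\<^bsub>aut_group P\<^esub> \<alpha>) x) = x" if "x \<in> P" for x
    using fun_cong[OF A.r_inv, of \<alpha> x] a that by (simp add: compose_def)
qed

lemma conj_AutF: 
  assumes P: "subgroup P S" and g: "g \<in> normalizer_in S P" 
  shows "restrict (conjm S g) P \<in> AutF F P"
proof -
  have *: "conjm S g ` P \<subseteq> P" "g \<in> carrier S" using g by (auto simp: normalizer_iff[OF P])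
  have F: "(P, restrict (conjm S g) P) \<in> F" using F_conj P * by blast
  then have "inj_on (conjm S g) P" using F_inj inj_on_restrict_eq by blast
  then have "conjm S g ` P = P" using * finite_subgroup[OF P] by (simp add: endo_inj_surj)
  then show ?thesis using F by (simp add: AutF_def)
qed

text \<open>Any \<open>H\<close> normalizing \<open>P\<close> is allowed: the full normalizer has
  image \<open>AutS S P\<close>, and abelian subgroups of it supply the p-groups that are later
  moved by Sylow's theorem.\<close>

lemma conj_hom:
  assumes P: "subgroup P S" and H: "H \<subseteq> normalizer_in S P"
  shows "(\<lambda>g. restrict (conjm S g) P) \<in> hom (S\<lparr>carrier := H\<rparr>) (aut_group P)"
proof (rule homI)
  fix g h assume "g \<in> carrier (S\<lparr>carrier := H\<rparr>)" "h \<in> carrier (S\<lparr>carrier := H\<rparr>)"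
  then have gh: "g \<in> normalizer_in S P" "h \<in> normalizer_in S P" using H by auto
  then show "restrict (conjm S (g \<otimes>\<^bsub>S\<lparr>carrier := H\<rparr>\<^esub> h)) P
      = restrict (conjm S g) P \<otimes>\<^bsub>aut_group P\<^esub> restrict (conjm S h) P"
    using subgroup.mem_carrier[OF P] 
    by (auto simp: compose_def restrict_def normalizer_iff[OF P] conjm_mult intro!: ext)
qed (use H conj_AutF[OF P] in auto)

lemma AutS_subgroup: assumes P: "subgroup P S" shows "subgroup (AutS S P) (aut_group P)"
proof -
  interpret A: group "aut_group P" using P by (rule aut_group_group)
  have "group_hom (S\<lparr>carrier := normalizer_in S P\<rparr>) (aut_group P) (\<lambda>g. restrict (conjm S g) P)"
    using conj_hom[OF P order_refl] subgroup_imp_group[OF normalizer_subgroup[OF P]] A.is_group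
    by (auto simp: group_hom_def group_hom_axioms_def)
  from group_hom.img_is_subgroup[OF this] show ?thesis by (simp add: AutS_def)
qed

lemma AutS_subset: "subgroup P S \<Longrightarrow> AutS S P \<subseteq> AutF F P"
  using AutS_subgroup[THEN subgroup.subset] by simp

lemma subgroup_carrier: "subgroup (carrier S) S"
  by (rule subgroup_self)

lemma normalizer_card_le: "subgroup P S \<Longrightarrow> card (normalizer_in S P) \<le> card (carrier S)"
  using fin card_mono normalizer_subgroup subgroup.subset by metis

text \<open>An image of \<open>Q\<close> with the largest normalizer works, since a further morphism
  out of it composes to a morphism out of \<open>Q\<close>.\<close>

lemma fully_normalized_conjugate:
  assumes Q: "subgroup Q S"
  obtains \<chi> where "(Q, \<chi>) \<in> F" "fully_normalized S F (\<chi> ` Q)"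
proof -
  have "\<exists>\<chi>. (Q, \<chi>) \<in> F" using F_conj[OF Q one_closed] by blast
  moreover have "\<forall>\<chi>. (Q, \<chi>) \<in> F \<longrightarrow> card (normalizer_in S (\<chi> ` Q)) < Suc (card (carrier S))"
    using normalizer_card_le F_image by (simp add: less_Suc_eq_le)
  ultimately obtain \<chi> where c: "(Q, \<chi>) \<in> F" 
    "\<And>\<psi>. (Q, \<psi>) \<in> F \<Longrightarrow> card (normalizer_in S (\<psi> ` Q)) \<le> card (normalizer_in S (\<chi> ` Q))"
    using ex_has_greatest_nat[of "\<lambda>\<chi>. (Q, \<chi>) \<in> F" _ "\<lambda>\<chi>. card (normalizer_in S (\<chi> ` Q))" "Suc (card (carrier S))"] by blast
  have "fully_normalized S F (\<chi> ` Q)"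
    unfolding fully_normalized_def
  proof (intro allI impI)
    fix \<phi> assume f: "(\<chi> ` Q, \<phi>) \<in> F"
    then have "(Q, restrict (\<phi> \<circ> \<chi>) Q) \<in> F" using F_comp c(1) by blast
    from c(2)[OF this] show "card (normalizer_in S (\<phi> ` \<chi> ` Q)) \<le> card (normalizer_in S (\<chi> ` Q))"
      by (simp add: image_comp)
  qed
  then show ?thesis using that c(1) by blast
qed

text \<open>Transported along \<chi>, the conjugations by N_S(Q) form a p-subgroup of Aut_F(P),
  where P = \<chi>(Q), and Sylow's theorem conjugates it into Aut_S(P). Once \<chi> is corrected by
  the conjugating automorphism, the domain in the extension axiom is all of N_S(Q). The extension is
  one of the corrected map, so only its image of \<open>Q\<close> is prescribed.\<close>

lemma extend_to_normalizer:
  assumes f: "(Q, \<chi>) \<in> F" and fn: "fully_normalized S F (\<chi> ` Q)"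
  obtains \<psi> where "(normalizer_in S Q, \<psi>) \<in> F" "\<psi> ` Q = \<chi> ` Q"
proof -
  define P where "P = \<chi> ` Q"
  have Q: "subgroup Q S" and P: "subgroup P S" using F_sub f F_image P_def by auto
  interpret A: group "aut_group P" using P by (rule aut_group_group)
  obtain \<chi>i where i: "(P, \<chi>i) \<in> F" "\<chi>i ` P = Q" "\<And>x. x \<in> Q \<Longrightarrow> \<chi>i (\<chi> x) = x" "\<And>y. y \<in> P \<Longrightarrow> \<chi> (\<chi>i y) = y"
    using F_back[OF f] unfolding P_def by metis
  have iQ: "\<chi>i y \<in> Q" if "y \<in> P" for y using i(2) that by blast
  have cP: "\<chi> x \<in> P" if "x \<in> Q" for x using that by (simp add: P_def)
  let ?N = "normalizer_in S Q"
  have N: "subgroup ?N S" by (rule normalizer_subgroup[OF Q])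
  have nQ: "conjm S g x \<in> Q" if "g \<in> ?N" "x \<in> Q" for g x using that by (simp add: normalizer_iff[OF Q])
  have nc: "g \<in> carrier S" if "g \<in> ?N" for g using that by (simp add: normalizer_iff[OF Q])
  define h where "h g = (\<lambda>y\<in>P. \<chi> (conjm S g (\<chi>i y)))" for g
  have hA: "h g \<in> AutF F P" if g: "g \<in> ?N" for g
  proof -
    have "(P, restrict (restrict (conjm S g) Q \<circ> \<chi>i) P) \<in> F"
      using F_comp[OF i(1) F_conj[OF Q nc[OF g]]] i(2) by simp
    then have "(P, restrict (\<chi> \<circ> restrict (restrict (conjm S g) Q \<circ> \<chi>i) P) P) \<in> F"
      by (rule F_comp[OF _ f]) (use nQ[OF g] iQ in auto)
    also have "restrict (\<chi> \<circ> restrict (restrict (conjm S g) Q \<circ> \<chi>i) P) P = h g"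
      using iQ by (auto simp: h_def)
    finally have hF: "(P, h g) \<in> F" .
    have "h g ` P \<subseteq> P" using nQ[OF g] iQ cP by (auto simp: h_def)
    then have "h g ` P = P" using F_inj[OF hF] finite_subgroup[OF P] by (simp add: endo_inj_surj)
    then show ?thesis using hF by (simp add: AutF_def)
  qed
  have hom: "h \<in> hom (S\<lparr>carrier := ?N\<rparr>) (aut_group P)"
  proof (rule homI)
    fix a b assume "a \<in> carrier (S\<lparr>carrier := ?N\<rparr>)" "b \<in> carrier (S\<lparr>carrier := ?N\<rparr>)"
    then have ab: "a \<in> ?N" "b \<in> ?N" by auto
    show "h (a \<otimes>\<^bsub>S\<lparr>carrier := ?N\<rparr>\<^esub> b) = h a \<otimes>\<^bsub>aut_group P\<^esub> h b"
    proof
      fix y show "h (a \<otimes>\<^bsub>S\<lparr>carrier := ?N\<rparr>\<^esub> b) y = (h a \<otimes>\<^bsub>aut_group P\<^esub> h b) y"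
        using ab iQ nQ cP i(3) nc subgroup.mem_carrier[OF Q] by (simp add: h_def compose_def conjm_mult)
    qed
  qed (simp add: hA)
  obtain n where n: "card ?N = p ^ n" using card_subgroup[OF N] by blast
  have "\<exists>x\<in>AutF F P. \<forall>k\<in>carrier (S\<lparr>carrier := ?N\<rparr>). inv\<^bsub>aut_group P\<^esub> x \<otimes>\<^bsub>aut_group P\<^esub> h k \<otimes>\<^bsub>aut_group P\<^esub> x \<in> AutS S P"
    by (rule A.sylow_conjugate[OF prime_p _ AutS_subgroup[OF P], where n=n])
      (use finite_AutF[OF P] fully_normalized_Sylow[OF P] fn A.subgroup_self AutS_subset[OF P] 
        subgroup_imp_group[OF N] n hom hA in \<open>auto simp: order_def P_def\<close>)
  then obtain x where x: "x \<in> AutF F P" 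
    and xk: "\<And>k. k \<in> ?N \<Longrightarrow> inv\<^bsub>aut_group P\<^esub> x \<otimes>\<^bsub>aut_group P\<^esub> h k \<otimes>\<^bsub>aut_group P\<^esub> x \<in> AutS S P"
    by auto
  define b where "b = inv\<^bsub>aut_group P\<^esub> x"
  note b = aut_group_inv[OF P x, folded b_def]
  define \<chi>' where "\<chi>' = restrict (b \<circ> \<chi>) Q"
  have c': "(Q, \<chi>') \<in> F" unfolding \<chi>'_def using F_comp[OF f AutF_D(1)[OF b(1)]] by (simp add: P_def)
  have im: "\<chi>' ` Q = P" using AutF_D(2)[OF b(1)] by (auto simp: \<chi>'_def P_def image_comp)
  \<comment> \<open>The witness is the element \<open>t\<close> of N_S(P) that induces x^-1 (h g) x;
    since \<chi>' is \<chi> followed by b = x^-1, the two conjugations correspond.\<close>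
  have "?N \<subseteq> N_phi S Q \<chi>'"
  proof
    fix g assume g: "g \<in> ?N"
    obtain t where t: "t \<in> normalizer_in S P" "compose P (compose P b (h g)) x = restrict (conjm S t) P"
      using xk[OF g] by (auto simp: AutS_def b_def)
    have "\<chi>' (conjm S g u) = conjm S t (\<chi>' u)" if u: "u \<in> Q" for u
    proof -
      have bu: "b (\<chi> u) \<in> P" using b(1) cP[OF u] AutF_D(3) by blast
      have "conjm S t (\<chi>' u) = restrict (conjm S t) P (b (\<chi> u))" using u bu by (simp add: \<chi>'_def)
      also have "\<dots> = b (h g (x (b (\<chi> u))))" using bu AutF_D(3)[OF x bu] by (simp add: t(2)[symmetric] compose_def)
      also have "\<dots> = b (\<chi> (conjm S g u))" using b(3) cP u i(3) by (simp add: h_def)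
      finally show ?thesis using nQ[OF g u] by (simp add: \<chi>'_def)
    qed
    then show "g \<in> N_phi S Q \<chi>'" using g t(1) by (auto simp: N_phi_iff[OF c'] im)
  qed
  moreover have "N_phi S Q \<chi>' \<subseteq> ?N" by (auto simp: N_phi_def)
  ultimately have N_eq: "N_phi S Q \<chi>' = ?N" by blast
  have "fully_normalized S F (\<chi>' ` Q)" using fn im P_def by simp
  from extension[OF c' this] obtain \<psi> where ps: "(?N, \<psi>) \<in> F" "\<And>x. x \<in> Q \<Longrightarrow> \<psi> x = \<chi>' x"
    unfolding N_eq by blast
  have "\<psi> ` Q = \<chi>' ` Q" using ps(2) by (rule image_cong[OF refl])
  then have "\<psi> ` Q = \<chi> ` Q" by (simp add: im P_def)
  with ps(1) show ?thesis by (rule that)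
qed

subsection \<open>The norm map on the center\<close>

definition center_of :: "'a set \<Rightarrow> 'a set" where
  "center_of P = {z \<in> P. \<forall>y\<in>P. z \<otimes> y = y \<otimes> z}"

lemma center_of_comm: "z \<in> center_of P \<Longrightarrow> y \<in> P \<Longrightarrow> z \<otimes> y = y \<otimes> z"
  and center_of_in: "z \<in> center_of P \<Longrightarrow> z \<in> P"
  by (auto simp: center_of_def)

lemma center_of_subgroup:
  assumes P: "subgroup P S" shows "subgroup (center_of P) S"
proof (rule subgroupI)
  show "center_of P \<subseteq> carrier S" using subgroup.subset[OF P] by (auto simp: center_of_def)
  show "center_of P \<noteq> {}"
    using subgroup.one_closed[OF P] subgroup.mem_carrier[OF P] by (force simp: center_of_def)
  fix a assume a: "a \<in> center_of P"
  then have aP: "a \<in> P" by (simp add: center_of_def)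
  have "inv a \<otimes> y = y \<otimes> inv a" if y: "y \<in> P" for y
  proof -
    have "a \<otimes> y = y \<otimes> a" using a y by (simp add: center_of_def)
    then have "inv a \<otimes> (a \<otimes> y) \<otimes> inv a = inv a \<otimes> (y \<otimes> a) \<otimes> inv a" by simp
    moreover have "inv a \<otimes> (a \<otimes> y) \<otimes> inv a = y \<otimes> inv a"
      using subgroup.mem_carrier[OF P aP] subgroup.mem_carrier[OF P y] by (simp add: m_assoc[symmetric])
    moreover have "inv a \<otimes> (y \<otimes> a) \<otimes> inv a = inv a \<otimes> y"
      using subgroup.mem_carrier[OF P aP] subgroup.mem_carrier[OF P y] by (simp add: m_assoc)
    ultimately show ?thesis by simp
  qed
  then show "inv a \<in> center_of P" using aP subgroup.m_inv_closed[OF P] by (simp add: center_of_def)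
  fix b assume b: "b \<in> center_of P"
  then have bP: "b \<in> P" by (simp add: center_of_def)
  have "a \<otimes> b \<otimes> y = y \<otimes> (a \<otimes> b)" if y: "y \<in> P" for y
  proof -
    have "a \<otimes> b \<otimes> y = a \<otimes> (y \<otimes> b)" 
      using b y aP bP subgroup.mem_carrier[OF P] by (simp add: center_of_def m_assoc)
    also have "\<dots> = (a \<otimes> y) \<otimes> b" using y aP bP subgroup.mem_carrier[OF P] by (simp add: m_assoc)
    also have "\<dots> = y \<otimes> (a \<otimes> b)" 
      using a y aP bP subgroup.mem_carrier[OF P] by (simp add: center_of_def m_assoc)
    finally show ?thesis .
  qed
  then show "a \<otimes> b \<in> center_of P" using aP bP subgroup.m_closed[OF P] by (simp add: center_of_def)
qed

lemma center_of_comm_group: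
  assumes P: "subgroup P S" shows "comm_group (S\<lparr>carrier := center_of P\<rparr>)"
  by (rule group.group_comm_groupI[OF subgroup_imp_group[OF center_of_subgroup[OF P]]])
    (simp, metis center_of_comm center_of_in)

lemma grp_center_eq: "grp_center S = center_of (carrier S)"
  by (simp add: grp_center_def center_of_def)

lemma grp_center_subgroup: "subgroup (grp_center S) S"
  unfolding grp_center_eq by (rule center_of_subgroup[OF subgroup_carrier])

lemma AutF_center:
  assumes a: "\<alpha> \<in> AutF F P" and z: "z \<in> center_of P" shows "\<alpha> z \<in> center_of P"
proof -
  have "\<alpha> z \<otimes> y = y \<otimes> \<alpha> z" if "y \<in> P" for y
  proof -
    have "y \<in> \<alpha> ` P" using AutF_D(2)[OF a] that by simp
    then obtain x where x: "x \<in> P" "y = \<alpha> x" by blast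
    have zP: "z \<in> P" and zx: "z \<otimes> x = x \<otimes> z" using center_of_in[OF z] center_of_comm[OF z x(1)] by auto
    have "\<alpha> z \<otimes> y = \<alpha> (z \<otimes> x)" using F_mult[OF AutF_D(1)[OF a] zP x(1)] x(2) by simp
    also have "\<dots> = y \<otimes> \<alpha> z" unfolding zx using F_mult[OF AutF_D(1)[OF a] x(1) zP] x(2) by simp
    finally show ?thesis .
  qed
  then show ?thesis using z AutF_D(3)[OF a] by (simp add: center_of_def)
qed

text \<open>Orbit products and norms are formed in the abelian group Z(P), where
  \<open>finprod\<close> makes sense and on which Aut_F(P) acts.\<close>

lemma AutF_finprod:
  assumes a: "\<alpha> \<in> AutF F P" and I: "finite I" and f: "f \<in> I \<rightarrow> center_of P"
  shows "\<alpha> (finprod (S\<lparr>carrier := center_of P\<rparr>) f I) = finprod (S\<lparr>carrier := center_of P\<rparr>) (\<lambda>i. \<alpha> (f i)) I"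
  using I f
proof (induction I rule: finite_induct)
  case empty
  have P: "subgroup P S" using F_sub AutF_D(1)[OF a] by blast
  interpret Z: comm_group "S\<lparr>carrier := center_of P\<rparr>" by (rule center_of_comm_group[OF P])
  show ?case using F_one[OF AutF_D(1)[OF a]] by simp
next
  case (insert i I)
  have P: "subgroup P S" using F_sub AutF_D(1)[OF a] by blast
  interpret Z: comm_group "S\<lparr>carrier := center_of P\<rparr>" by (rule center_of_comm_group[OF P])
  have c: "finprod (S\<lparr>carrier := center_of P\<rparr>) f I \<in> center_of P"
    using Z.finprod_closed[of f I] insert.prems by simp
  have "f i \<in> P" "finprod (S\<lparr>carrier := center_of P\<rparr>) f I \<in> P" 
    using insert.prems c by (auto simp: center_of_def)
  then show ?case
    using insert AutF_center[OF a] F_mult[OF AutF_D(1)[OF a]] by (simp add: Pi_iff)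
qed

text \<open>\<open>Q\<close> is normal in \<open>S\<close>, hence fully normalized, so the index m
  of Aut_S(Q) in Aut_F(Q) is prime to \<open>p\<close>. Aut_S(Q) acts trivially on Z(S), so the norm
  \<open>N y\<close>, the product of \<alpha>(y) over coset representatives \<alpha>, is well
  defined. Its values are invariant, and on \<open>W\<close> it is the m-th power map, which is
  bijective because m is invertible modulo |S|. Hence the kernel \<open>K\<close> of the norm is a
  complement of \<open>W\<close>.\<close>

lemma norm_direct_factor:
  assumes Q: "subgroup Q S" and nQ: "normalizer_in S Q = carrier S" and ZQ: "grp_center S \<subseteq> Q"
  shows "direct_factor S {z \<in> grp_center S. \<forall>\<alpha>\<in>AutF F Q. \<alpha> z = z} (grp_center S)"
proof -
  define W where "W = {z \<in> grp_center S. \<forall>\<alpha>\<in>AutF F Q. \<alpha> z = z}"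
  define T where "T = AutS S Q"
  define A where "A = aut_group Q"
  define Z where "Z = S\<lparr>carrier := center_of Q\<rparr>"
  have Zs: "subgroup (center_of Q) S" by (rule center_of_subgroup[OF Q])
  interpret A: group A unfolding A_def using Q by (rule aut_group_group)
  interpret Z: comm_group Z unfolding Z_def by (rule center_of_comm_group[OF Q])
  have Zsimps [simp]: "carrier Z = center_of Q" "\<And>x y. x \<otimes>\<^bsub>Z\<^esub> y = x \<otimes> y" "\<one>\<^bsub>Z\<^esub> = \<one>"
    by (auto simp: Z_def)
  have Asimps: "carrier A = AutF F Q" by (simp add: A_def)
  have T: "subgroup T A" unfolding T_def A_def by (rule AutS_subgroup[OF Q])
  have finA: "finite (carrier A)" using finite_AutF[OF Q] by (simp add: Asimps)
  have cS: "x \<in> carrier S" if "x \<in> grp_center S" for x using that by (simp add: grp_center_def)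
  have cQ: "x \<in> center_of Q" if "x \<in> grp_center S" for x
    using that ZQ subgroup.mem_carrier[OF Q] by (auto simp: grp_center_def center_of_def)
  have fixT: "t y = y" if "t \<in> T" and y: "y \<in> grp_center S" for t y
  proof -
    obtain g where g: "g \<in> carrier S" "t = restrict (conjm S g) Q"
      using \<open>t \<in> T\<close> nQ by (auto simp: T_def AutS_def)
    have "g \<otimes> y = y \<otimes> g" using g y by (simp add: grp_center_def)
    then have "conjm S g y = y" using conjm_fixes_iff[OF g(1) cS[OF y]] by simp
    then show ?thesis using g(2) ZQ y by auto
  qed
  \<comment> \<open>Conjugations by all of \<open>S\<close> are among the automorphisms of
    \<open>Q\<close>, so invariant elements lie in Z(S).\<close>
  have fixed_center: "z \<in> grp_center S" if zQ: "z \<in> Q" and zf: "\<And>\<alpha>. \<alpha> \<in> AutF F Q \<Longrightarrow> \<alpha> z = z" for z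
  proof -
    have zc: "z \<in> carrier S" using subgroup.mem_carrier[OF Q zQ] .
    have "g \<otimes> z = z \<otimes> g" if g: "g \<in> carrier S" for g
      using zf[OF conj_AutF[OF Q, of g]] nQ g zQ conjm_fixes_iff[OF g zc] by simp
    then show ?thesis using zc by (simp add: grp_center_def)
  qed
  define C where "C = lcosets\<^bsub>A\<^esub> T"
  define m where "m = card C"
  have finC: "finite C" using finA by (simp add: C_def LCOSETS_def)
  have m: "m * card T = card (AutF F Q)" 
    using A.l_lagrange[OF finA T] by (simp add: m_def C_def order_def Asimps)
  have fn: "fully_normalized S F Q"
    unfolding fully_normalized_def using nQ normalizer_card_le F_image by auto
  have pm: "\<not> p dvd m"
  proof
    assume "p dvd m"
    then have "p ^ Suc (multiplicity p (card (AutF F Q))) dvd card (AutF F Q)"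
      using m fully_normalized_Sylow[OF Q fn] unfolding T_def by (metis mult_dvd_mono dvd_refl power_Suc)
    moreover have "card (AutF F Q) \<noteq> 0" using finA A.one_closed by (auto simp: Asimps)
    moreover have "\<not> is_unit p" using prime_gt_1_nat[OF prime_p] by simp
    ultimately show False
      using power_dvd_iff_le_multiplicity[of "card (AutF F Q)" p "Suc (multiplicity p (card (AutF F Q)))"] by simp
  qed
  obtain n where n: "order S = p ^ n" using order_p_power by blast
  have "coprime m (p ^ n)" 
    using prime_imp_coprime[OF prime_p pm] by (simp add: coprime_commute)
  moreover have "m \<noteq> 0" using pm by (intro notI) simp
  \<comment> \<open>Here \<open>x\<close> inverts \<open>m\<close> modulo the order of
    \<open>S\<close>, so that the power \<open>m * x\<close> is the identity on
    \<open>S\<close>.\<close>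
  ultimately obtain x y where xy: "m * x = p ^ n * y + 1"
    using bezout_nat[of m "p ^ n"] by auto
  have pow: "z [^] (m * x) = z" if "z \<in> carrier S" for z
    using that pow_order_eq_1[OF that] n by (simp add: xy nat_pow_mult[symmetric] nat_pow_pow[symmetric])
  \<comment> \<open>The representative is arbitrary, but its values on Z(S) depend on the coset
    only, because \<open>T\<close> fixes Z(S) pointwise.\<close>
  define r where "r c = (SOME \<alpha>. \<alpha> \<in> c)" for c :: "('a \<Rightarrow> 'a) set"
  have r: "r (\<alpha> <#\<^bsub>A\<^esub> T) y = \<alpha> y" if a: "\<alpha> \<in> AutF F Q" and y: "y \<in> grp_center S" for \<alpha> y
  proof -
    have "\<alpha> \<otimes>\<^bsub>A\<^esub> \<one>\<^bsub>A\<^esub> \<in> \<alpha> <#\<^bsub>A\<^esub> T" using subgroup.one_closed[OF T] unfolding l_coset_def by blast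
    then have "r (\<alpha> <#\<^bsub>A\<^esub> T) \<in> \<alpha> <#\<^bsub>A\<^esub> T" unfolding r_def some_in_eq by blast
    then obtain t where t: "t \<in> T" "r (\<alpha> <#\<^bsub>A\<^esub> T) = compose Q \<alpha> t" 
      by (auto simp: l_coset_def A_def)
    then show ?thesis using fixT[OF t(1) y] ZQ y by (auto simp: compose_def)
  qed
  have Cex: "\<exists>\<alpha>\<in>AutF F Q. c = \<alpha> <#\<^bsub>A\<^esub> T" if "c \<in> C" for c
    using that by (auto simp: C_def LCOSETS_def Asimps)
  have rcl: "r c y \<in> center_of Q" if "c \<in> C" "y \<in> grp_center S" for c y
    using Cex[OF that(1)] r[OF _ that(2)] AutF_center cQ that(2) by metis
  define N where "N y = finprod Z (\<lambda>c. r c y) C" for y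
  have Ncl: "N y \<in> center_of Q" if "y \<in> grp_center S" for y
    using Z.finprod_closed[of "\<lambda>c. r c y" C] rcl that by (auto simp: N_def)
  have Nfix: "\<beta> (N y) = N y" if b: "\<beta> \<in> AutF F Q" and y: "y \<in> grp_center S" for \<beta> y
  proof -
    have TA: "T \<subseteq> carrier A" using T by (rule subgroup.subset)
    have CA: "c \<subseteq> carrier A" if "c \<in> C" for c
      using that A.lcosets_subset_PowG[OF T] by (auto simp: C_def)
    \<comment> \<open>Left multiplication by \<beta> permutes the cosets, so applying \<beta> to the
      norm only reindexes the product.\<close>
    have shift: "\<beta> <#\<^bsub>A\<^esub> (\<alpha> <#\<^bsub>A\<^esub> T) = compose Q \<beta> \<alpha> <#\<^bsub>A\<^esub> T" if "\<alpha> \<in> AutF F Q" for \<alpha>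
      using A.lcos_m_assoc[OF TA, of \<beta> \<alpha>] that b by (simp add: A_def)
    have inj: "inj_on (\<lambda>c. \<beta> <#\<^bsub>A\<^esub> c) C"
    proof (rule inj_on_inverseI[where g="\<lambda>c. inv\<^bsub>A\<^esub> \<beta> <#\<^bsub>A\<^esub> c"])
      fix c assume "c \<in> C"
      then show "inv\<^bsub>A\<^esub> \<beta> <#\<^bsub>A\<^esub> (\<beta> <#\<^bsub>A\<^esub> c) = c"
        using A.lcos_m_assoc[OF CA, of c "inv\<^bsub>A\<^esub> \<beta>" \<beta>] b CA A.lcos_mult_one A.inv_closed[of \<beta>] by (simp add: Asimps)
    qed
    have "(\<lambda>c. \<beta> <#\<^bsub>A\<^esub> c) ` C \<subseteq> C"
    proof
      fix c assume "c \<in> (\<lambda>c. \<beta> <#\<^bsub>A\<^esub> c) ` C"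
      then obtain \<alpha> where "\<alpha> \<in> AutF F Q" "c = \<beta> <#\<^bsub>A\<^esub> (\<alpha> <#\<^bsub>A\<^esub> T)" using Cex by blast
      then show "c \<in> C" using AutF_comp[OF b] shift by (auto simp: C_def LCOSETS_def Asimps)
    qed
    then have im: "(\<lambda>c. \<beta> <#\<^bsub>A\<^esub> c) ` C = C" using inj finC by (simp add: endo_inj_surj)
    have "\<beta> (r c y) = r (\<beta> <#\<^bsub>A\<^esub> c) y" if "c \<in> C" for c
    proof -
      obtain \<alpha> where a: "\<alpha> \<in> AutF F Q" "c = \<alpha> <#\<^bsub>A\<^esub> T" using Cex[OF \<open>c \<in> C\<close>] by blast
      then show ?thesis using shift[OF a(1)] r[OF a(1) y] r[OF AutF_comp[OF b a(1)] y] ZQ y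
        by (auto simp: compose_def)
    qed
    note br = this
    have shC: "\<beta> <#\<^bsub>A\<^esub> c \<in> C" if "c \<in> C" for c using im that by blast
    have "\<beta> (N y) = finprod Z (\<lambda>c. \<beta> (r c y)) C"
      using AutF_finprod[OF b finC, of "\<lambda>c. r c y"] rcl y by (simp add: N_def Z_def)
    also have "\<dots> = finprod Z (\<lambda>c. r (\<beta> <#\<^bsub>A\<^esub> c) y) C"
      by (rule Z.finprod_cong') (use br shC rcl y in auto)
    also have "\<dots> = finprod Z (\<lambda>c. r c y) ((\<lambda>c. \<beta> <#\<^bsub>A\<^esub> c) ` C)"
      by (rule Z.finprod_reindex[symmetric]) (use inj shC rcl y in auto)
    finally show ?thesis by (simp add: im N_def)
  qed
  have NW: "N y \<in> W" if y: "y \<in> grp_center S" for y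
    unfolding W_def using fixed_center[of "N y"] Nfix[OF _ y] Ncl[OF y] by (auto simp: center_of_def)
  have Nmult: "N (a \<otimes> b) = N a \<otimes> N b" if ab: "a \<in> grp_center S" "b \<in> grp_center S" for a b
  proof -
    have "r c (a \<otimes> b) = r c a \<otimes>\<^bsub>Z\<^esub> r c b" if c: "c \<in> C" for c
    proof -
      obtain \<alpha> where a: "\<alpha> \<in> AutF F Q" "c = \<alpha> <#\<^bsub>A\<^esub> T" using Cex[OF c] by blast
      have "a \<otimes> b \<in> grp_center S" using ab subgroup.m_closed[OF grp_center_subgroup] by blast
      then show ?thesis using r[OF a(1)] ab a(2) F_mult[OF AutF_D(1)[OF a(1)]] ZQ by (simp add: subset_iff)
    qed
    then have "N (a \<otimes> b) = finprod Z (\<lambda>c. r c a \<otimes>\<^bsub>Z\<^esub> r c b) C"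
      unfolding N_def by (intro Z.finprod_cong') (use rcl ab Z.m_closed in auto)
    also have "\<dots> = N a \<otimes>\<^bsub>Z\<^esub> N b"
      unfolding N_def by (intro Z.finprod_multf) (use rcl ab in auto)
    finally show ?thesis by simp
  qed
  have NWpow: "N z = z [^] m" if z: "z \<in> W" for z
  proof -
    have zZ: "z \<in> grp_center S" using z by (simp add: W_def)
    have "r c z = z" if "c \<in> C" for c using Cex[OF that] r[OF _ zZ] z by (auto simp: W_def)
    then have "N z = finprod Z (\<lambda>c. z) C" unfolding N_def by (intro Z.finprod_cong') (use cQ zZ in auto)
    also have "\<dots> = z [^]\<^bsub>Z\<^esub> m" using cQ[OF zZ] by (simp add: m_def Z.finprod_const)
    also have "\<dots> = z [^] m" unfolding Z_def by (simp add: nat_pow_consistent[symmetric])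
    finally show ?thesis .
  qed
  have Wfix: "\<alpha> z = z" if "z \<in> W" "\<alpha> \<in> AutF F Q" for z \<alpha> using that unfolding W_def by blast
  have Wsub: "subgroup W S"
  proof (rule subgroupI)
    show "W \<subseteq> carrier S" using cS by (auto simp: W_def)
    have "\<one> \<in> W" using subgroup.one_closed[OF grp_center_subgroup] F_one[OF AutF_D(1)[of _ Q]] by (auto simp: W_def)
    then show "W \<noteq> {}" by blast
    fix a assume a: "a \<in> W"
    then have aZ: "a \<in> grp_center S" and aQ: "a \<in> Q" using ZQ by (auto simp: W_def)
    have "\<alpha> (inv a) = inv a" if "\<alpha> \<in> AutF F Q" for \<alpha>
      using F_m_inv[OF AutF_D(1)[OF that] aQ] Wfix[OF a that] by simp
    then show "inv a \<in> W" using aZ subgroup.m_inv_closed[OF grp_center_subgroup] by (simp add: W_def)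
    fix b assume b: "b \<in> W"
    then have bZ: "b \<in> grp_center S" and bQ: "b \<in> Q" using ZQ by (auto simp: W_def)
    have "\<alpha> (a \<otimes> b) = a \<otimes> b" if "\<alpha> \<in> AutF F Q" for \<alpha>
      using F_mult[OF AutF_D(1)[OF that] aQ bQ] Wfix[OF a that] Wfix[OF b that] by simp
    then show "a \<otimes> b \<in> W" using aZ bZ subgroup.m_closed[OF grp_center_subgroup] by (simp add: W_def)
  qed
  have Wc: "z \<in> carrier S" "z \<in> grp_center S" if "z \<in> W" for z using that cS by (auto simp: W_def)
  have oneZ: "\<one> \<in> grp_center S" by (rule subgroup.one_closed[OF grp_center_subgroup])
  have Ncar: "N y \<in> carrier S" if "y \<in> grp_center S" for y using NW[OF that] Wc by blast
  have N1: "N \<one> = \<one>" using Nmult[OF oneZ oneZ] Ncar[OF oneZ] by (simp add: r_cancel_one')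
  have Ninv: "N (inv y) = inv (N y)" if y: "y \<in> grp_center S" for y
  proof -
    have iy: "inv y \<in> grp_center S" using y subgroup.m_inv_closed[OF grp_center_subgroup] by blast
    have "N (inv y) \<otimes> N y = \<one>" using Nmult[OF iy y] N1 cS[OF y] by simp
    then show ?thesis using Ncar y iy inv_equality by metis
  qed
  define K where "K = {y \<in> grp_center S. N y = \<one>}"
  have Ksub: "subgroup K S"
  proof (rule subgroupI)
    show "K \<subseteq> carrier S" using cS by (auto simp: K_def)
    show "K \<noteq> {}" using oneZ N1 by (auto simp: K_def)
  qed (use Ninv Nmult subgroup.m_inv_closed[OF grp_center_subgroup] 
      subgroup.m_closed[OF grp_center_subgroup] in \<open>auto simp: K_def\<close>)
  have "z = \<one>" if "z \<in> W" "z \<in> K" for z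
  proof -
    have "z [^] m = \<one>" using that NWpow by (simp add: K_def)
    then have "z [^] (m * x) = \<one>" using Wc[OF that(1)] by (simp add: nat_pow_pow[symmetric])
    then show ?thesis using pow Wc[OF that(1)] by simp
  qed
  then have int: "W \<inter> K = {\<one>}" using subgroup.one_closed[OF Wsub] subgroup.one_closed[OF Ksub] by blast
  have prod: "W <#> K = grp_center S"
  proof
    show "W <#> K \<subseteq> grp_center S"
      using subgroup.m_closed[OF grp_center_subgroup] by (auto simp: set_mult_def W_def K_def)
    show "grp_center S \<subseteq> W <#> K"
    proof
      fix y assume y: "y \<in> grp_center S"
      have powW: "w [^] (k::nat) \<in> W" if "w \<in> W" for w k
        by (induction k) (use that subgroup.one_closed[OF Wsub] subgroup.m_closed[OF Wsub] in auto)
      \<comment> \<open>The component of \<open>y\<close> in \<open>W\<close>: N w = (N y)^(m x) = N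
        y, so w^-1 y lies in the kernel of the norm.\<close>
      define w where "w = N y [^] x"
      have w: "w \<in> W" unfolding w_def by (rule powW[OF NW[OF y]])
      have "N w = N y [^] (m * x)"
        using NWpow[OF w] Ncar[OF y] by (simp add: w_def nat_pow_pow mult.commute)
      then have Nw: "N w = N y" using pow Ncar[OF y] by simp
      have iw: "inv w \<in> grp_center S"
        using Wc(2)[OF w] subgroup.m_inv_closed[OF grp_center_subgroup] by blast
      have "inv w \<otimes> y \<in> grp_center S" using iw y subgroup.m_closed[OF grp_center_subgroup] by blast
      moreover have "N (inv w \<otimes> y) = \<one>"
        using Nmult[OF iw y] Ninv[OF Wc(2)[OF w]] Nw Ncar[OF y] by simp
      ultimately have "inv w \<otimes> y \<in> K" by (simp add: K_def)
      moreover have "y = w \<otimes> (inv w \<otimes> y)" using Wc(1)[OF w] cS[OF y] by (simp add: m_assoc[symmetric])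
      ultimately show "y \<in> W <#> K" using w by (auto simp: set_mult_def)
    qed
  qed
  show ?thesis
    unfolding direct_factor_def W_def[symmetric]
    using Wsub Ksub int prod by (auto simp: W_def K_def)
qed

subsection \<open>The center and the largest normal subgroup of a fusion system\<close>

lemma center_fusionD:
  assumes z: "z \<in> center_fusion S F" and f: "(P, \<phi>) \<in> F" and zP: "z \<in> P"
  shows "\<phi> z = z"
proof -
  have "\<forall>(P, \<phi>) \<in> F. \<exists>\<psi>. (generate S (insert z P), \<psi>) \<in> F \<and> (\<forall>x\<in>P. \<psi> x = \<phi> x) \<and> \<psi> z = z"
    using z by (simp add: center_fusion_def)
  from bspec[OF this f] obtain \<psi> where "\<forall>x\<in>P. \<psi> x = \<phi> x" "\<psi> z = z" by auto
  then show ?thesis using zP by simp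
qed

text \<open>If the image of \<phi> is fully normalized, \<phi> extends to a subgroup containing the
  centralizer of \<open>P\<close>, hence z, and the extension fixes z by \<open>fix_z\<close>. In
  general take \<chi> from the image to a fully normalized subgroup: \<chi> \<phi> and \<chi> both
  extend with z fixed, and the first extension followed by the inverse of the second extends
  \<phi>.\<close>

lemma center_fusionI:
  assumes z: "z \<in> grp_center S" and fix_z: "\<And>P \<phi>. (P, \<phi>) \<in> F \<Longrightarrow> z \<in> P \<Longrightarrow> \<phi> z = z"
  shows "z \<in> center_fusion S F"
proof -
  have zc: "z \<in> carrier S" using z by (simp add: grp_center_def)
  have ext: "\<exists>\<psi>. (generate S (insert z P), \<psi>) \<in> F \<and> (\<forall>x\<in>P. \<psi> x = \<phi> x) \<and> \<psi> z = z"
    if f: "(P, \<phi>) \<in> F" and fn: "fully_normalized S F (\<phi> ` P)" for P \<phi>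
  proof -
    obtain \<psi> where ps: "(N_phi S P \<phi>, \<psi>) \<in> F" "\<And>x. x \<in> P \<Longrightarrow> \<psi> x = \<phi> x" 
      using extension[OF f fn] by metis
    have P: "subgroup P S" by (rule F_sub[OF f])
    have "z \<in> centralizer_in S P"
      using z subgroup.mem_carrier[OF P] unfolding grp_center_def centralizer_in_def by blast
    then have zN: "z \<in> N_phi S P \<phi>" using centralizer_subset_N_phi[OF f] by blast
    let ?D = "generate S (insert z P)"
    have D: "subgroup ?D S" using zc subgroup.subset[OF P] by (intro generate_is_subgroup) auto
    have DN: "?D \<subseteq> N_phi S P \<phi>"
      using zN subset_N_phi[OF f] by (intro generate_subgroup_incl[OF _ F_sub[OF ps(1)]]) auto
    have "(?D, restrict \<psi> ?D) \<in> F" by (rule F_restrict[OF ps(1) D DN])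
    moreover have "x \<in> ?D" if "x \<in> insert z P" for x using that by (rule generate.incl)
    ultimately show ?thesis using ps(2) fix_z[OF ps(1) zN]
      by (intro exI[of _ "restrict \<psi> ?D"]) auto
  qed
  have "\<exists>\<psi>. (generate S (insert z P), \<psi>) \<in> F \<and> (\<forall>x\<in>P. \<psi> x = \<phi> x) \<and> \<psi> z = z"
    if f: "(P, \<phi>) \<in> F" for P \<phi>
  proof -
    obtain \<chi> where c: "(\<phi> ` P, \<chi>) \<in> F" "fully_normalized S F (\<chi> ` \<phi> ` P)"
      using fully_normalized_conjugate[OF F_image[OF f]] by metis
    let ?D = "generate S (insert z P)" and ?E = "generate S (insert z (\<phi> ` P))"
    obtain \<chi>1 where c1: "(?E, \<chi>1) \<in> F" "\<forall>x\<in>\<phi> ` P. \<chi>1 x = \<chi> x" "\<chi>1 z = z"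
      using ext[OF c] by blast
    have g: "(P, restrict (\<chi> \<circ> \<phi>) P) \<in> F" by (rule F_comp[OF f c(1)]) simp
    have "restrict (\<chi> \<circ> \<phi>) P ` P = \<chi> ` \<phi> ` P" by (simp add: image_comp)
    then obtain \<psi> where ps: "(?D, \<psi>) \<in> F" "\<forall>x\<in>P. \<psi> x = restrict (\<chi> \<circ> \<phi>) P x" "\<psi> z = z"
      using ext[OF g] c(2) by auto
    have incE: "x \<in> ?E" if "x \<in> insert z (\<phi> ` P)" for x using that by (rule generate.incl)
    have incD: "x \<in> ?D" if "x \<in> insert z P" for x using that by (rule generate.incl)
    have sE: "subgroup (\<chi>1 ` ?E) S" by (rule F_image[OF c1(1)])
    have D: "subgroup ?D S" by (rule F_sub[OF ps(1)])
    have base: "\<psi> x \<in> \<chi>1 ` ?E" if "x \<in> insert z P" for x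
    proof (cases "x \<in> P")
      case True
      then have "\<psi> x = \<chi>1 (\<phi> x)" using ps(2) c1(2) by simp
      then show ?thesis using incE[of "\<phi> x"] True by blast
    next
      case False
      then have "\<psi> x = \<chi>1 z" using that ps(3) c1(3) by simp
      then show ?thesis using incE[of z] by blast
    qed
    have "\<psi> x \<in> \<chi>1 ` ?E" if "x \<in> ?D" for x
      using that
    proof (induction x rule: generate.induct)
      case one then show ?case using F_one[OF ps(1)] subgroup.one_closed[OF sE] by simp
    next
      case (incl x) then show ?case by (rule base)
    next
      case (inv x) then show ?case 
        using base[OF inv] F_m_inv[OF ps(1) incD[OF inv]] subgroup.m_inv_closed[OF sE] by simp
    next
      case (eng x y) then show ?case using F_mult[OF ps(1)] subgroup.m_closed[OF sE] by simp
    qed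
    then have im: "\<psi> ` ?D \<subseteq> \<chi>1 ` ?E" by blast
    obtain \<kappa> where k: "(\<chi>1 ` ?E, \<kappa>) \<in> F" "\<And>x. x \<in> ?E \<Longrightarrow> \<kappa> (\<chi>1 x) = x"
      using F_back[OF c1(1)] by metis
    have "(?D, restrict (\<kappa> \<circ> \<psi>) ?D) \<in> F" by (rule F_comp[OF ps(1) k(1) im])
    moreover have "restrict (\<kappa> \<circ> \<psi>) ?D x = \<phi> x" if "x \<in> P" for x
      using that incD[of x] ps(2) c1(2) k(2)[OF incE, of "\<phi> x"] by simp
    moreover have "restrict (\<kappa> \<circ> \<psi>) ?D z = z" 
      using incD[of z] ps(3) c1(3) k(2)[OF incE, of z] by simp
    ultimately show ?thesis by blast
  qed
  then show ?thesis using z by (auto simp: center_fusion_def)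
qed

section \<open>Normal subgroups of the fusion system\<close>

lemma normal_in_fusion_one: "normal_in_fusion S F {\<one>}"
  unfolding normal_in_fusion_def
proof (intro conjI ballI, rule one_is_normal, clarify)
  fix Q \<phi> assume f: "(Q, \<phi>) \<in> F"
  have "{\<one>} <#> Q = Q" using F_carrier[OF f] by (auto simp: set_mult_def)
  then show "\<exists>\<psi>. ({\<one>} <#> Q, \<psi>) \<in> F \<and> (\<forall>x\<in>Q. \<psi> x = \<phi> x) \<and> \<psi> ` {\<one>} = {\<one>}"
    using f F_one[OF f] by auto
qed

lemma normal_in_fusionD:
  assumes R: "normal_in_fusion S F R" and f: "(Q, \<phi>) \<in> F"
  obtains \<psi> where "(R <#> Q, \<psi>) \<in> F" "\<And>x. x \<in> Q \<Longrightarrow> \<psi> x = \<phi> x" "\<psi> ` R = R"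
proof -
  have "\<forall>(Q, \<phi>) \<in> F. \<exists>\<psi>. (R <#> Q, \<psi>) \<in> F \<and> (\<forall>x\<in>Q. \<psi> x = \<phi> x) \<and> \<psi> ` R = R"
    using R by (simp add: normal_in_fusion_def)
  from bspec[OF this f] show ?thesis using that by auto
qed

lemma subset_set_mult:
  assumes "subgroup A S" "subgroup B S" shows "A \<subseteq> A <#> B" "B \<subseteq> A <#> B"
proof -
  show "A \<subseteq> A <#> B"
  proof
    fix a assume "a \<in> A"
    then have "a = a \<otimes> \<one>" using subgroup.mem_carrier[OF assms(1)] by simp
    then show "a \<in> A <#> B" using \<open>a \<in> A\<close> subgroup.one_closed[OF assms(2)] unfolding set_mult_def by blast
  qed
  show "B \<subseteq> A <#> B"
  proof
    fix b assume "b \<in> B"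
    then have "b = \<one> \<otimes> b" using subgroup.mem_carrier[OF assms(2)] by simp
    then show "b \<in> A <#> B" using \<open>b \<in> B\<close> subgroup.one_closed[OF assms(1)] unfolding set_mult_def by blast
  qed
qed

text \<open>A morphism is extended first over \<open>R1\<close> and the result then over
  \<open>R2\<close>. The second extension agrees with the first on \<open>R1\<close>, so it still
  preserves \<open>R1\<close>.\<close>

lemma normal_in_fusion_mult:
  assumes R1: "normal_in_fusion S F R1" and R2: "normal_in_fusion S F R2"
  shows "normal_in_fusion S F (R1 <#> R2)"
proof -
  have n1: "R1 \<lhd> S" and n2: "R2 \<lhd> S" using R1 R2 by (auto simp: normal_in_fusion_def)
  have s1: "subgroup R1 S" and s2: "subgroup R2 S" using n1 n2 by (auto intro: normal_imp_subgroup)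
  have s12: "subgroup (R1 <#> R2) S" by (rule mult_norm_subgroup[OF n1 s2])
  have comm: "R2 <#> R1 = R1 <#> R2" by (rule commut_normal[OF s2 n1])
  have "R1 <#> R2 \<lhd> S"
  proof (rule normal_invI[OF s12])
    fix x h assume x: "x \<in> carrier S" and "h \<in> R1 <#> R2"
    then obtain a b where ab: "a \<in> R1" "b \<in> R2" "h = a \<otimes> b" by (auto simp: set_mult_def)
    then have c: "a \<in> carrier S" "b \<in> carrier S" using subgroup.mem_carrier s1 s2 by metis+
    have "x \<otimes> h \<otimes> inv x = (x \<otimes> a \<otimes> inv x) \<otimes> (x \<otimes> b \<otimes> inv x)"
      using conjm_hom[OF x c] ab(3) by (simp add: conjm_def)
    moreover have "x \<otimes> a \<otimes> inv x \<in> R1" "x \<otimes> b \<otimes> inv x \<in> R2"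
      using n1 n2 x ab by (auto simp: normal_inv_iff)
    ultimately show "x \<otimes> h \<otimes> inv x \<in> R1 <#> R2" by (auto simp: set_mult_def)
  qed
  moreover have "\<exists>\<psi>. (R1 <#> R2 <#> Q, \<psi>) \<in> F \<and> (\<forall>x\<in>Q. \<psi> x = \<phi> x) \<and> \<psi> ` (R1 <#> R2) = R1 <#> R2"
    if f: "(Q, \<phi>) \<in> F" for Q \<phi>
  proof -
    have Q: "subgroup Q S" by (rule F_sub[OF f])
    obtain \<psi>1 where p1: "(R1 <#> Q, \<psi>1) \<in> F" "\<And>x. x \<in> Q \<Longrightarrow> \<psi>1 x = \<phi> x" "\<psi>1 ` R1 = R1"
      using normal_in_fusionD[OF R1 f] by metis
    have s1Q: "subgroup (R1 <#> Q) S" by (rule F_sub[OF p1(1)])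
    obtain \<psi>2 where p2: "(R2 <#> (R1 <#> Q), \<psi>2) \<in> F" "\<And>x. x \<in> R1 <#> Q \<Longrightarrow> \<psi>2 x = \<psi>1 x" "\<psi>2 ` R2 = R2"
      using normal_in_fusionD[OF R2 p1(1)] by metis
    have eq: "R2 <#> (R1 <#> Q) = R1 <#> R2 <#> Q"
      using set_mult_assoc[of R2 R1 Q] comm s1 s2 Q by (simp add: subgroup.subset)
    have im1: "\<psi>2 ` R1 = R1"
      using p2(2) subset_set_mult(1)[OF s1 Q] p1(3) by (metis image_cong subsetD)
    have in1: "x \<in> R2 <#> (R1 <#> Q)" if "x \<in> R1" for x
      using that subset_set_mult(1)[OF s1 Q] subset_set_mult(2)[OF s2 s1Q] by blast
    have in2: "x \<in> R2 <#> (R1 <#> Q)" if "x \<in> R2" for x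
      using that subset_set_mult(1)[OF s2 s1Q] by blast
    have "\<psi>2 ` (R1 <#> R2) = (\<psi>2 ` R1) <#> (\<psi>2 ` R2)"
    proof
      show "\<psi>2 ` (R1 <#> R2) \<subseteq> \<psi>2 ` R1 <#> \<psi>2 ` R2"
        using F_mult[OF p2(1) in1 in2] by (auto simp: set_mult_def)
      show "\<psi>2 ` R1 <#> \<psi>2 ` R2 \<subseteq> \<psi>2 ` (R1 <#> R2)"
      proof
        fix u assume "u \<in> \<psi>2 ` R1 <#> \<psi>2 ` R2"
        then obtain a b where ab: "a \<in> R1" "b \<in> R2" "u = \<psi>2 a \<otimes> \<psi>2 b" by (auto simp: set_mult_def)
        then have "u = \<psi>2 (a \<otimes> b)" "a \<otimes> b \<in> R1 <#> R2" 
          using F_mult[OF p2(1) in1 in2] by (auto simp: set_mult_def)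
        then show "u \<in> \<psi>2 ` (R1 <#> R2)" by blast
      qed
    qed
    then have "\<psi>2 ` (R1 <#> R2) = R1 <#> R2" using im1 p2(3) by simp
    moreover have "\<forall>x\<in>Q. \<psi>2 x = \<phi> x" using p2(2) p1(2) subset_set_mult(2)[OF s1 Q] by auto
    ultimately show ?thesis using p2(1) eq by auto
  qed
  ultimately show ?thesis by (auto simp: normal_in_fusion_def)
qed

text \<open>\<open>Op_fusion\<close> is a \<open>THE\<close> term, so a largest normal subgroup must
  be exhibited: one of maximal order contains every other, because the product of the two is again
  normal.\<close>

lemma Op_fusion_normal: "normal_in_fusion S F (Op_fusion S F)"
proof -
  have sub: "R \<subseteq> carrier S" if "normal_in_fusion S F R" for R
    using that by (auto simp: normal_in_fusion_def dest!: normal_imp_subgroup intro: subgroup.mem_carrier)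
  have "\<forall>R. normal_in_fusion S F R \<longrightarrow> card R < Suc (card (carrier S))"
    using card_mono[OF fin sub] by (simp add: less_Suc_eq_le)
  then obtain R where R: "normal_in_fusion S F R" 
    and max: "\<And>Q. normal_in_fusion S F Q \<Longrightarrow> card Q \<le> card R"
    using ex_has_greatest_nat[of "normal_in_fusion S F" _ card "Suc (card (carrier S))"] normal_in_fusion_one
    by blast
  have s: "subgroup R S" if "normal_in_fusion S F R" for R
    using that by (auto simp: normal_in_fusion_def intro: normal_imp_subgroup)
  have top: "Q \<subseteq> R" if Q: "normal_in_fusion S F Q" for Q
  proof -
    note QR = normal_in_fusion_mult[OF Q R]
    have "finite (Q <#> R)" using sub[OF QR] fin finite_subset by blast
    then have "R = Q <#> R"
      using subset_set_mult(2)[OF s[OF Q] s[OF R]] max[OF QR] by (intro card_seteq) auto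
    then show ?thesis using subset_set_mult(1)[OF s[OF Q] s[OF R]] by simp
  qed
  have "normal_in_fusion S F (Op_fusion S F) \<and> (\<forall>Q. normal_in_fusion S F Q \<longrightarrow> Q \<subseteq> Op_fusion S F)"
    unfolding Op_fusion_def
  proof (rule theI[where a=R])
    show "normal_in_fusion S F R \<and> (\<forall>Q. normal_in_fusion S F Q \<longrightarrow> Q \<subseteq> R)" using R top by blast
    show "R' = R" if "normal_in_fusion S F R' \<and> (\<forall>Q. normal_in_fusion S F Q \<longrightarrow> Q \<subseteq> R')" for R'
      using that R top by blast
  qed
  then show ?thesis by blast
qed

lemma normal_normalizer: assumes "R \<lhd> S" shows "normalizer_in S R = carrier S"
proof -
  have "subgroup R S" using assms by (rule normal_imp_subgroup)
  then show ?thesis using assms by (auto simp: normalizer_iff normal_inv_iff conjm_def)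
qed

text \<open>By normality every morphism extends over \<open>R\<close> with \<open>R\<close>
  preserved, so its effect on an element of Z(S) is that of some member of
  \<open>AutF F R\<close>.\<close>

lemma direct_factor_of_center_le_Op:
  assumes "grp_center S \<subseteq> Op_fusion S F"
  shows "direct_factor S (center_fusion S F) (grp_center S)"
proof -
  define R where "R = Op_fusion S F"
  have R: "normal_in_fusion S F R" unfolding R_def by (rule Op_fusion_normal)
  then have n: "R \<lhd> S" by (simp add: normal_in_fusion_def)
  have s: "subgroup R S" using n by (rule normal_imp_subgroup)
  have ZR: "grp_center S \<subseteq> R" using assms by (simp add: R_def)
  have "center_fusion S F = {z \<in> grp_center S. \<forall>\<alpha>\<in>AutF F R. \<alpha> z = z}"
  proof (intro equalityI subsetI)
    fix z assume z: "z \<in> center_fusion S F"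
    then have "z \<in> grp_center S" by (simp add: center_fusion_def)
    then show "z \<in> {z \<in> grp_center S. \<forall>\<alpha>\<in>AutF F R. \<alpha> z = z}"
      using center_fusionD[OF z] AutF_D(1) ZR by blast
  next
    fix z assume "z \<in> {z \<in> grp_center S. \<forall>\<alpha>\<in>AutF F R. \<alpha> z = z}"
    then have z: "z \<in> grp_center S" and fz: "\<And>\<alpha>. \<alpha> \<in> AutF F R \<Longrightarrow> \<alpha> z = z" by blast+
    show "z \<in> center_fusion S F"
    proof (rule center_fusionI[OF z])
      fix P \<phi> assume f: "(P, \<phi>) \<in> F" and zP: "z \<in> P"
      obtain \<psi> where ps: "(R <#> P, \<psi>) \<in> F" "\<And>x. x \<in> P \<Longrightarrow> \<psi> x = \<phi> x" "\<psi> ` R = R"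
        using normal_in_fusionD[OF R f] by metis
      have "(R, restrict \<psi> R) \<in> F" 
        using F_restrict[OF ps(1) s] subset_set_mult(1)[OF s F_sub[OF f]] by blast
      then have "restrict \<psi> R \<in> AutF F R" using ps(3) by (simp add: AutF_def)
      from fz[OF this] have "\<psi> z = z" using z ZR by auto
      then show "\<phi> z = z" using ps(2)[OF zP] by simp
    qed
  qed
  then show ?thesis using norm_direct_factor[OF s normal_normalizer[OF n] ZR] by simp
qed

subsection \<open>The Thompson subgroup\<close>

definition abelian_sub :: "'a set \<Rightarrow> 'a set set" where
  "abelian_sub Q = {A. subgroup A S \<and> A \<subseteq> Q \<and> (\<forall>x\<in>A. \<forall>y\<in>A. x \<otimes> y = y \<otimes> x)}"

text \<open>Not a rank in the sense of generators: the version of J(Q) used here is built on abelian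
  subgroups of maximal order.\<close>

definition ab_rank :: "'a set \<Rightarrow> nat" where
  "ab_rank Q = Max (card ` abelian_sub Q)"

definition max_ab :: "'a set \<Rightarrow> 'a set set" where
  "max_ab Q = {A \<in> abelian_sub Q. card A = ab_rank Q}"

definition thompson :: "'a set \<Rightarrow> 'a set" where
  "thompson Q = generate S (\<Union>(max_ab Q))"

text \<open>Compares subgroups lexicographically by rank and then by the order of the Thompson subgroup.\<close>

definition level :: "'a set \<Rightarrow> nat" where
  "level Q = ab_rank Q * Suc (card (carrier S)) + card (thompson Q)"

lemma abelian_subD:
  assumes "A \<in> abelian_sub Q"
  shows "subgroup A S" "A \<subseteq> Q" "\<And>x y. x \<in> A \<Longrightarrow> y \<in> A \<Longrightarrow> x \<otimes> y = y \<otimes> x"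
  using assms unfolding abelian_sub_def by blast+

lemma finite_abelian_sub: "finite (abelian_sub Q)"
proof (rule finite_subset)
  show "abelian_sub Q \<subseteq> Pow (carrier S)" using abelian_subD(1) subgroup.subset by blast
qed (simp add: fin)

lemma ab_rank_ge: "A \<in> abelian_sub Q \<Longrightarrow> card A \<le> ab_rank Q"
  unfolding ab_rank_def by (simp add: finite_abelian_sub)

lemma max_abD:
  assumes "A \<in> max_ab Q"
  shows "A \<in> abelian_sub Q" "card A = ab_rank Q" "subgroup A S" "A \<subseteq> Q"
    "\<And>x y. x \<in> A \<Longrightarrow> y \<in> A \<Longrightarrow> x \<otimes> y = y \<otimes> x"
  using assms abelian_subD unfolding max_ab_def by blast+

lemma max_ab_nonempty:
  assumes "subgroup Q S" obtains A where "A \<in> max_ab Q"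
proof -
  have "{\<one>} \<in> abelian_sub Q"
    using triv_subgroup subgroup.one_closed[OF assms] by (simp add: abelian_sub_def)
  then have "ab_rank Q \<in> card ` abelian_sub Q"
    unfolding ab_rank_def using finite_abelian_sub by (intro Max_in) auto
  then show ?thesis using that by (auto simp: max_ab_def)
qed

lemma thompson_subgroup: "subgroup (thompson Q) S"
  unfolding thompson_def 
  by (rule generate_is_subgroup) (use max_abD(3) subgroup.subset in blast)

lemma max_ab_thompson: "A \<in> max_ab Q \<Longrightarrow> A \<subseteq> thompson Q"
  unfolding thompson_def by (auto intro: generate.incl)

lemma thompson_le: 
  assumes "subgroup H S" "\<And>A. A \<in> max_ab Q \<Longrightarrow> A \<subseteq> H" shows "thompson Q \<subseteq> H"
  unfolding thompson_def by (rule generate_subgroup_incl[OF _ assms(1)]) (use assms(2) in blast)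

lemma thompson_subset: "subgroup Q S \<Longrightarrow> thompson Q \<subseteq> Q"
  by (rule thompson_le) (auto dest: max_abD(4))

lemma card_thompson: "card (thompson Q) < Suc (card (carrier S))"
  using card_mono[OF fin subgroup.subset[OF thompson_subgroup]] by (simp add: less_Suc_eq_le)

lemma ab_rank_mono: assumes "subgroup Q S" "Q \<subseteq> R" shows "ab_rank Q \<le> ab_rank R"
proof -
  obtain A where A: "A \<in> max_ab Q" using max_ab_nonempty[OF assms(1)] .
  then have "A \<in> abelian_sub R" using max_abD[OF A] assms(2) by (auto simp: abelian_sub_def)
  then show ?thesis using ab_rank_ge max_abD(2)[OF A] by metis
qed

text \<open>When the maximal orders agree, the generating abelian subgroups of J(Q) are among those
  of J(R).\<close>

lemma thompson_mono: 
  assumes "Q \<subseteq> R" "ab_rank Q = ab_rank R" shows "thompson Q \<subseteq> thompson R"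
proof (rule thompson_le[OF thompson_subgroup])
  fix A assume A: "A \<in> max_ab Q"
  then have "A \<in> max_ab R" using max_abD[OF A] assms by (auto simp: max_ab_def abelian_sub_def)
  then show "A \<subseteq> thompson R" by (rule max_ab_thompson)
qed

text \<open>The order of a Thompson subgroup stays below the weight
  \<open>Suc (card (carrier S))\<close>, so the first component always decides.\<close>

lemma level_less_rank: assumes "ab_rank Q < ab_rank R" shows "level Q < level R"
proof -
  have "level Q < Suc (ab_rank Q) * Suc (card (carrier S))"
    using card_thompson[of Q] by (simp add: level_def)
  also have "\<dots> \<le> ab_rank R * Suc (card (carrier S))" using assms by (intro mult_right_mono) auto
  also have "\<dots> \<le> level R" by (simp add: level_def)
  finally show ?thesis .
qed

lemma level_mono: assumes "subgroup Q S" "Q \<subseteq> R" shows "level Q \<le> level R"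
proof (cases "ab_rank Q = ab_rank R")
  case True
  have "card (thompson Q) \<le> card (thompson R)"
    using thompson_mono[OF assms(2) True] finite_subgroup[OF thompson_subgroup] by (rule card_mono[rotated])
  then show ?thesis by (simp add: level_def True)
next
  case False
  then show ?thesis using ab_rank_mono[OF assms] level_less_rank[of Q R] by simp
qed

text \<open>Equal levels force both components to agree, and nested Thompson subgroups of equal
  order coincide. This is how a failure of the level to grow is exploited.\<close>

lemma level_eq:
  assumes "subgroup Q S" "Q \<subseteq> R" "level Q = level R"
  shows "ab_rank Q = ab_rank R" "thompson Q = thompson R"
proof -
  show r: "ab_rank Q = ab_rank R"
    using ab_rank_mono[OF assms(1,2)] level_less_rank[of Q R] assms(3) by linarith
  then have "card (thompson Q) = card (thompson R)" using assms(3) by (simp add: level_def)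
  then show "thompson Q = thompson R"
    using thompson_mono[OF assms(2) r] finite_subgroup[OF thompson_subgroup] by (simp add: card_subset_eq)
qed

text \<open>Every member of \<open>max_ab Q\<close> lies in J(Q) by construction, so a domain can be
  replaced by its Thompson subgroup without changing its level.\<close>

lemma thompson_idem:
  assumes Q: "subgroup Q S"
  shows "ab_rank (thompson Q) = ab_rank Q" "thompson (thompson Q) = thompson Q"
proof -
  obtain A where A: "A \<in> max_ab Q" using max_ab_nonempty[OF Q] .
  have in_ab: "B \<in> abelian_sub (thompson Q)" if "B \<in> max_ab Q" for B
    using max_abD[OF that] max_ab_thompson[OF that] by (auto simp: abelian_sub_def)
  have "ab_rank Q \<le> ab_rank (thompson Q)" using ab_rank_ge[OF in_ab[OF A]] max_abD(2)[OF A] by simp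
  then show r: "ab_rank (thompson Q) = ab_rank Q"
    using ab_rank_mono[OF thompson_subgroup thompson_subset[OF Q]] by simp
  have "thompson Q \<subseteq> thompson (thompson Q)"
  proof (rule thompson_le[OF thompson_subgroup])
    fix B assume B: "B \<in> max_ab Q"
    then have "B \<in> max_ab (thompson Q)" using in_ab[OF B] r max_abD(2)[OF B] by (simp add: max_ab_def)
    then show "B \<subseteq> thompson (thompson Q)" by (rule max_ab_thompson)
  qed
  then show "thompson (thompson Q) = thompson Q" using thompson_subset[OF thompson_subgroup] by blast
qed

lemma level_thompson: "subgroup Q S \<Longrightarrow> level (thompson Q) = level Q"
  by (simp add: level_def thompson_idem)

lemma abelian_sub_image:
  assumes f: "(Q, \<phi>) \<in> F" and A: "A \<in> abelian_sub Q" shows "\<phi> ` A \<in> abelian_sub (\<phi> ` Q)"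
proof -
  note AD = abelian_subD[OF A]
  have "\<phi> x \<otimes> \<phi> y = \<phi> y \<otimes> \<phi> x" if "x \<in> A" "y \<in> A" for x y
  proof -
    have Q: "x \<in> Q" "y \<in> Q" using that AD(2) by auto
    show ?thesis using F_mult[OF f Q] F_mult[OF f Q(2,1)] AD(3)[OF that] by simp
  qed
  then show ?thesis using F_image_sub[OF f AD(1,2)] AD(2) by (auto simp: abelian_sub_def)
qed

lemma ab_rank_image_ge: assumes f: "(Q, \<phi>) \<in> F" shows "ab_rank Q \<le> ab_rank (\<phi> ` Q)"
proof -
  obtain A where A: "A \<in> max_ab Q" using max_ab_nonempty[OF F_sub[OF f]] .
  show ?thesis
    using ab_rank_ge[OF abelian_sub_image[OF f max_abD(1)[OF A]]] F_card[OF f max_abD(4)[OF A]] max_abD(2)[OF A]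
    by simp
qed

lemma ab_rank_image: assumes f: "(Q, \<phi>) \<in> F" shows "ab_rank (\<phi> ` Q) = ab_rank Q"
proof -
  obtain \<psi> where "(\<phi> ` Q, \<psi>) \<in> F" "\<psi> ` \<phi> ` Q = Q" using F_back[OF f] by metis
  then show ?thesis using ab_rank_image_ge[OF f] ab_rank_image_ge[of "\<phi> ` Q" \<psi>] by simp
qed

lemma thompson_image_le: 
  assumes f: "(Q, \<phi>) \<in> F" and x: "x \<in> thompson Q" shows "\<phi> x \<in> thompson (\<phi> ` Q)"
proof -
  have Q: "subgroup Q S" by (rule F_sub[OF f])
  have base: "\<phi> x \<in> thompson (\<phi> ` Q)" if x: "x \<in> \<Union>(max_ab Q)" for x
  proof -
    obtain A where A: "A \<in> max_ab Q" "x \<in> A" using x by blast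
    have "\<phi> ` A \<in> max_ab (\<phi> ` Q)"
      using abelian_sub_image[OF f max_abD(1)[OF A(1)]] F_card[OF f max_abD(4)[OF A(1)]]
        max_abD(2)[OF A(1)] ab_rank_image[OF f] by (simp add: max_ab_def)
    then show ?thesis using max_ab_thompson A(2) by blast
  qed
  have inQ: "y \<in> Q" if "y \<in> generate S (\<Union>(max_ab Q))" for y
    using that thompson_subset[OF Q] by (auto simp: thompson_def)
  show ?thesis
    using x unfolding thompson_def[of Q]
  proof (induction x rule: generate.induct)
    case one then show ?case using F_one[OF f] subgroup.one_closed[OF thompson_subgroup] by simp
  next
    case (incl x) then show ?case by (rule base)
  next
    case (inv x)
    then have "x \<in> Q" using inQ generate.incl by metis
    then show ?case using base[OF inv] F_m_inv[OF f] subgroup.m_inv_closed[OF thompson_subgroup] by simp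
  next
    case (eng x y)
    then show ?case using F_mult[OF f inQ inQ] subgroup.m_closed[OF thompson_subgroup] by simp
  qed
qed

lemma thompson_image: assumes f: "(Q, \<phi>) \<in> F" shows "thompson (\<phi> ` Q) = \<phi> ` thompson Q"
proof
  obtain \<psi> where b: "(\<phi> ` Q, \<psi>) \<in> F" "\<psi> ` \<phi> ` Q = Q" "\<And>y. y \<in> \<phi> ` Q \<Longrightarrow> \<phi> (\<psi> y) = y"
    using F_back[OF f] by metis
  show "thompson (\<phi> ` Q) \<subseteq> \<phi> ` thompson Q"
  proof
    fix y assume y: "y \<in> thompson (\<phi> ` Q)"
    then have "\<psi> y \<in> thompson Q" using thompson_image_le[OF b(1) y] b(2) by simp
    moreover have "\<phi> (\<psi> y) = y" using b(3) y thompson_subset[OF F_image[OF f]] by blast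
    ultimately show "y \<in> \<phi> ` thompson Q" by (metis imageI)
  qed
  show "\<phi> ` thompson Q \<subseteq> thompson (\<phi> ` Q)" using thompson_image_le[OF f] by blast
qed

lemma level_image: assumes f: "(Q, \<phi>) \<in> F" shows "level (\<phi> ` Q) = level Q"
  using ab_rank_image[OF f] thompson_image[OF f] F_card[OF f thompson_subset[OF F_sub[OF f]]]
  by (simp add: level_def)

section \<open>Consequences of the maximality of abelian subgroups\<close>

lemma commuting_mult_abelian:
  assumes A: "A \<in> abelian_sub Q" and B: "B \<in> abelian_sub Q" and Q: "subgroup Q S"
    and comm: "\<And>a b. a \<in> A \<Longrightarrow> b \<in> B \<Longrightarrow> a \<otimes> b = b \<otimes> a"
  shows "A <#> B \<in> abelian_sub Q"
proof -
  note AD = abelian_subD[OF A] and BD = abelian_subD[OF B]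
  have c: "x \<in> carrier S" if "x \<in> A \<or> x \<in> B" for x
    using that subgroup.mem_carrier[OF AD(1)] subgroup.mem_carrier[OF BD(1)] by blast
  have sw: "(a \<otimes> b) \<otimes> (a' \<otimes> b') = (a \<otimes> a') \<otimes> (b \<otimes> b')" 
    if "a \<in> A" "a' \<in> A" "b \<in> B" "b' \<in> B" for a a' b b'
  proof -
    have "(a \<otimes> b) \<otimes> (a' \<otimes> b') = a \<otimes> (b \<otimes> a') \<otimes> b'" using that c by (simp add: m_assoc)
    also have "\<dots> = a \<otimes> (a' \<otimes> b) \<otimes> b'" using comm[of a' b] that by simp
    finally show ?thesis using that c by (simp add: m_assoc)
  qed
  have "subgroup (A <#> B) S"
  proof (rule subgroupI)
    show "A <#> B \<subseteq> carrier S" using c by (auto simp: set_mult_def)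
    show "A <#> B \<noteq> {}"
      using subgroup.one_closed[OF AD(1)] subgroup.one_closed[OF BD(1)] by (auto simp: set_mult_def)
    show "inv u \<in> A <#> B" if "u \<in> A <#> B" for u
    proof -
      obtain a b where ab: "a \<in> A" "b \<in> B" "u = a \<otimes> b" using \<open>u \<in> A <#> B\<close> by (auto simp: set_mult_def)
      have "inv u = inv a \<otimes> inv b" 
        using comm[OF ab(1,2)] ab c by (simp add: inv_mult_group[symmetric])
      then show ?thesis 
        using subgroup.m_inv_closed[OF AD(1) ab(1)] subgroup.m_inv_closed[OF BD(1) ab(2)]
        by (auto simp: set_mult_def)
    qed
    show "u \<otimes> v \<in> A <#> B" if "u \<in> A <#> B" "v \<in> A <#> B" for u v
    proof -
      obtain a b a' b' where ab: "a \<in> A" "b \<in> B" "u = a \<otimes> b" "a' \<in> A" "b' \<in> B" "v = a' \<otimes> b'"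
        using \<open>u \<in> A <#> B\<close> \<open>v \<in> A <#> B\<close> by (auto simp: set_mult_def)
      then show ?thesis
        using sw[of a a' b b'] subgroup.m_closed[OF AD(1), of a a'] subgroup.m_closed[OF BD(1), of b b']
        by (auto simp: set_mult_def)
    qed
  qed
  moreover have "A <#> B \<subseteq> Q"
    using AD(2) BD(2) subgroup.m_closed[OF Q] by (auto simp: set_mult_def)
  moreover have "u \<otimes> v = v \<otimes> u" if "u \<in> A <#> B" "v \<in> A <#> B" for u v
  proof -
    obtain a b a' b' where ab: "a \<in> A" "b \<in> B" "u = a \<otimes> b" "a' \<in> A" "b' \<in> B" "v = a' \<otimes> b'"
      using \<open>u \<in> A <#> B\<close> \<open>v \<in> A <#> B\<close> by (auto simp: set_mult_def)
    then show ?thesis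
      using sw[of a a' b b'] sw[of a' a b' b] AD(3)[of a a'] BD(3)[of b b'] by simp
  qed
  ultimately show ?thesis by (simp add: abelian_sub_def)
qed

text \<open>The product \<open>A <#> B\<close> is abelian, so by maximality it is no larger than
  \<open>A\<close>.\<close>

lemma max_ab_absorbs:
  assumes A: "A \<in> max_ab Q" and B: "B \<in> abelian_sub Q" and Q: "subgroup Q S"
    and comm: "\<And>a b. a \<in> A \<Longrightarrow> b \<in> B \<Longrightarrow> a \<otimes> b = b \<otimes> a"
  shows "B \<subseteq> A"
proof -
  have AB: "A <#> B \<in> abelian_sub Q" by (rule commuting_mult_abelian[OF max_abD(1)[OF A] B Q comm])
  have "A = A <#> B"
  proof (rule card_seteq)
    show "finite (A <#> B)" using finite_subgroup abelian_subD(1)[OF AB] by blast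
    show "A \<subseteq> A <#> B" by (rule subset_set_mult[OF max_abD(3)[OF A] abelian_subD(1)[OF B]])
    show "card (A <#> B) \<le> card A" using ab_rank_ge[OF AB] max_abD(2)[OF A] by simp
  qed
  then show ?thesis using subset_set_mult(2)[OF max_abD(3)[OF A] abelian_subD(1)[OF B]] by simp
qed

text \<open>The part of Z(S) inside \<open>Q\<close> is abelian and commutes with every member of
  \<open>max_ab Q\<close>, so it is absorbed. Thus a central z stays in the domain on passing to
  J(Q).\<close>

lemma central_in_thompson:
  assumes z: "z \<in> grp_center S" and zQ: "z \<in> Q" and Q: "subgroup Q S"
  shows "z \<in> thompson Q"
proof -
  obtain A where A: "A \<in> max_ab Q" using max_ab_nonempty[OF Q] .
  have comm: "a \<otimes> b = b \<otimes> a" if "a \<in> carrier S" "b \<in> grp_center S \<inter> Q" for a b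
  proof -
    have "b \<otimes> a = a \<otimes> b" using that unfolding grp_center_def by blast
    then show ?thesis by simp
  qed
  have "grp_center S \<inter> Q \<in> abelian_sub Q"
    using subgroups_Inter_pair[OF grp_center_subgroup Q] subgroup.mem_carrier[OF Q] comm
    unfolding abelian_sub_def by blast
  then have "grp_center S \<inter> Q \<subseteq> A"
    by (rule max_ab_absorbs[OF A _ Q]) (use comm subgroup.mem_carrier[OF max_abD(3)[OF A]] in blast)
  then show ?thesis using z zQ max_ab_thompson[OF A] by blast
qed

text \<open>Conjugation by \<open>g\<close> is an automorphism of \<open>Q\<close>, and
  automorphisms preserve J(Q).\<close>

lemma normalizer_thompson:
  assumes Q: "subgroup Q S" and g: "g \<in> normalizer_in S Q"
  shows "g \<in> normalizer_in S (thompson Q)"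
proof -
  have gc: "g \<in> carrier S" using g by (simp add: normalizer_iff[OF Q])
  note a = conj_AutF[OF Q g]
  have "restrict (conjm S g) Q x \<in> thompson Q" if "x \<in> thompson Q" for x
    using thompson_image_le[OF AutF_D(1)[OF a] that] AutF_D(2)[OF a] by simp
  then have "conjm S g x \<in> thompson Q" if "x \<in> thompson Q" for x
    using subsetD[OF thompson_subset[OF Q] that] that by fastforce
  then show ?thesis using gc by (simp add: normalizer_iff[OF thompson_subgroup])
qed

lemma normalizer_grows:
  assumes R: "subgroup R S" and ne: "R \<noteq> carrier S"
  shows "\<exists>g\<in>normalizer_in S R. g \<notin> R"
proof -
  obtain n where "order S = p ^ n" using order_p_power by blast
  from p_group_normalizer_grows[OF prime_p this R ne] show ?thesis
    by (auto simp: normalizer_iff[OF R] conjm_def)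
qed

text \<open>Otherwise J(N_S(Q)) = Q, so everything normalizing N_S(Q) normalizes \<open>Q\<close>.
  Then N_S(Q) is its own normalizer, which in a p-group means that it is \<open>S\<close>, and Q =
  J(S).\<close>

lemma level_normalizer:
  assumes Q: "subgroup Q S" and QJ: "thompson Q = Q" and ne: "Q \<noteq> thompson (carrier S)"
  shows "level Q < level (normalizer_in S Q)"
proof (rule ccontr)
  let ?R = "normalizer_in S Q"
  have R: "subgroup ?R S" by (rule normalizer_subgroup[OF Q])
  assume "\<not> level Q < level ?R"
  then have "level Q = level ?R" using level_mono[OF Q subset_normalizer[OF Q]] by simp
  then have JR: "thompson ?R = Q" using level_eq(2)[OF Q subset_normalizer[OF Q]] QJ by simp
  then have "?R \<noteq> carrier S" using ne by auto
  then obtain g where "g \<in> normalizer_in S ?R" "g \<notin> ?R" using normalizer_grows[OF R] by blast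
  then show False using normalizer_thompson[OF R] JR by simp
qed

section \<open>The action on the center of a subgroup, and Thompson replacement\<close>

lemma conjm_m_inv: "g \<in> carrier S \<Longrightarrow> x \<in> carrier S \<Longrightarrow> conjm S g (inv x) = inv (conjm S g x)"
  by (simp add: conjm_def inv_mult_group m_assoc)

lemma conjm_center:
  assumes P: "subgroup P S" and g: "g \<in> normalizer_in S P" and v: "v \<in> center_of P"
  shows "conjm S g v \<in> center_of P"
  using AutF_center[OF conj_AutF[OF P g] v] center_of_in[OF v] by simp

lemma fixed_subgroup:
  assumes V: "subgroup V S" and g: "g \<in> carrier S" shows "subgroup {v \<in> V. conjm S g v = v} S"
proof (rule subgroupI)
  show "{v \<in> V. conjm S g v = v} \<noteq> {}"
    using subgroup.one_closed[OF V] g by (auto simp: conjm_def)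
qed (use g subgroup.mem_carrier[OF V] subgroup.m_closed[OF V] subgroup.m_inv_closed[OF V]
    in \<open>auto simp: conjm_hom conjm_m_inv\<close>)

text \<open>Thompson's replacement argument. \<open>B\<close> is \<open>[x, A] C\<^sub>A([x, A])\<close>, where \<open>x\<close> is not in
  \<open>V0 = {v. [v, A] \<subseteq> A}\<close> but is fixed by \<open>A\<close> modulo \<open>V0\<close>.\<close>

lemma thompson_replacement:
  assumes P: "subgroup P S" and A: "A \<in> max_ab (normalizer_in S P)"
    and nV: "\<not> (\<forall>v\<in>center_of P. \<forall>a\<in>A. conjm S a v \<otimes> inv v \<in> A)"
  shows "\<exists>B\<in>max_ab (normalizer_in S P). card (A \<inter> center_of P) < card (B \<inter> center_of P)
    \<and> \<not> center_of P \<subseteq> B"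
proof -
  define R where "R = normalizer_in S P"
  define V where "V = center_of P"
  \<comment> \<open>The commutator [a, v]. For fixed \<open>a\<close> it is an endomorphism of the
    abelian group \<open>V\<close>, as \<open>kmult\<close> and \<open>kinv\<close> show.\<close>
  define k where "k a v = conjm S a v \<otimes> inv v" for a v
  have R: "subgroup R S" unfolding R_def by (rule normalizer_subgroup[OF P])
  have V: "subgroup V S" unfolding V_def by (rule center_of_subgroup[OF P])
  note AD = max_abD[OF A, folded R_def]
  have Vc: "v \<in> carrier S" if "v \<in> V" for v using that by (rule subgroup.mem_carrier[OF V])
  have Ac: "a \<in> carrier S" if "a \<in> A" for a using that by (rule subgroup.mem_carrier[OF AD(3)])
  have Vcomm: "v \<otimes> w = w \<otimes> v" if "v \<in> V" "w \<in> V" for v w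
    using that center_of_comm center_of_in unfolding V_def by blast
  have VR: "V \<subseteq> R" using center_of_in subset_normalizer[OF P] unfolding V_def R_def by blast
  have act: "conjm S a v \<in> V" if "a \<in> A" "v \<in> V" for a v
    using conjm_center[OF P] that AD(4) unfolding V_def R_def by blast
  have kV: "k a v \<in> V" if "a \<in> A" "v \<in> V" for a v
    using act[OF that] that(2) subgroup.m_closed[OF V] subgroup.m_inv_closed[OF V] by (simp add: k_def)
  have actcomm: "conjm S a (conjm S b v) = conjm S b (conjm S a v)" if "a \<in> A" "b \<in> A" "v \<in> V" for a b v
    using AD(5)[OF that(1,2)] that Ac Vc by (metis conjm_mult)
  have kmult: "k a (v \<otimes> w) = k a v \<otimes> k a w" if "a \<in> A" "v \<in> V" "w \<in> V" for a v w
  proof -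
    have c: "conjm S a v \<in> V" "conjm S a w \<in> V" "inv v \<in> V" "inv w \<in> V" 
      using act that subgroup.m_inv_closed[OF V] by auto
    have "k a (v \<otimes> w) = conjm S a v \<otimes> (conjm S a w \<otimes> inv w) \<otimes> inv v"
      using that Ac Vc c by (simp add: k_def conjm_hom inv_mult_group m_assoc)
    also have "\<dots> = conjm S a v \<otimes> (inv v \<otimes> (conjm S a w \<otimes> inv w))"
      using Vcomm[of "conjm S a w \<otimes> inv w" "inv v"] c Vc subgroup.m_closed[OF V] by (simp add: m_assoc)
    finally show ?thesis using c Vc by (simp add: k_def m_assoc)
  qed
  have kinv: "k a (inv v) = inv (k a v)" if "a \<in> A" "v \<in> V" for a v
  proof -
    have c: "conjm S a v \<in> V" "inv v \<in> V" using act that subgroup.m_inv_closed[OF V] by auto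
    have "k a (inv v) = inv (conjm S a v) \<otimes> inv (inv v)" 
      using that Ac Vc by (simp add: k_def conjm_m_inv)
    also have "\<dots> = inv (inv v \<otimes> conjm S a v)" using c Vc by (simp add: inv_mult_group)
    also have "\<dots> = inv (k a v)" using Vcomm[OF c] by (simp add: k_def)
    finally show ?thesis .
  qed
  have kfix: "k a v = \<one> \<longleftrightarrow> conjm S a v = v" if "a \<in> A" "v \<in> V" for a v
    using act[OF that] Vc that by (metis k_def inv_solve_right l_one one_closed)
  have fixA: "conjm S a v = v" if "a \<in> A" "v \<in> A" for a v
    using conjm_fixes_iff[OF Ac Ac, OF that] AD(5)[OF that] by simp
  have fixed_in_A: "u \<in> A" if u: "u \<in> V" and uf: "\<And>a. a \<in> A \<Longrightarrow> conjm S a u = u" for u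
  proof -
    let ?B = "\<Inter>a\<in>A. {v \<in> V. conjm S a v = v}"
    have B1: "\<one> \<in> A" by (rule subgroup.one_closed[OF AD(3)])
    have sB: "subgroup ?B S" by (rule subgroups_Inter) (use B1 fixed_subgroup[OF V Ac] in auto)
    have BV: "?B \<subseteq> V" using B1 by blast
    have "x \<otimes> y = y \<otimes> x" if "x \<in> ?B" "y \<in> ?B" for x y 
      by (rule Vcomm) (use that BV in \<open>auto simp only: subset_iff\<close>)
    then have "?B \<in> abelian_sub R" 
      unfolding abelian_sub_def using sB order_trans[OF BV VR] by blast
    moreover have "a \<otimes> b = b \<otimes> a" if "a \<in> A" "b \<in> ?B" for a b
      using that conjm_fixes_iff[OF Ac Vc, of a b] by auto
    ultimately have "?B \<subseteq> A" using max_ab_absorbs[OF A[folded R_def] _ R] by blast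
    then show ?thesis using u uf by blast
  qed
  define V0 where "V0 = {v \<in> V. \<forall>a\<in>A. k a v \<in> A}"
  have V0V: "V0 \<subseteq> V" by (auto simp: V0_def)
  have V0: "subgroup V0 S"
  proof (rule subgroupI)
    show "V0 \<subseteq> carrier S" using Vc by (auto simp: V0_def)
    have "k a \<one> = \<one>" if "a \<in> A" for a using that Ac by (simp add: k_def conjm_def)
    then show "V0 \<noteq> {}" using subgroup.one_closed[OF V] subgroup.one_closed[OF AD(3)] by (auto simp: V0_def)
  qed (use kmult kinv subgroup.m_closed[OF V] subgroup.m_inv_closed[OF V] 
      subgroup.m_closed[OF AD(3)] subgroup.m_inv_closed[OF AD(3)] in \<open>auto simp: V0_def\<close>)
  have V0ne: "V0 \<noteq> V" using nV unfolding V0_def k_def V_def by blast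
  have AV0: "v \<in> V0" if "v \<in> A" "v \<in> V" for v
  proof -
    have "k a v = \<one>" if "a \<in> A" for a using kfix[OF that \<open>v \<in> V\<close>] fixA[OF that \<open>v \<in> A\<close>] by simp
    then show ?thesis using \<open>v \<in> V\<close> subgroup.one_closed[OF AD(3)] by (simp add: V0_def)
  qed
  have actV0: "conjm S b v \<in> V0" if b: "b \<in> A" and v: "v \<in> V0" for b v
  proof -
    have vV: "v \<in> V" using v V0V by blast
    have "k a (conjm S b v) \<in> A" if a: "a \<in> A" for a
    proof -
      have ka: "k a v \<in> A" using v a by (simp add: V0_def)
      have "k a (conjm S b v) = conjm S b (k a v)"
        using actcomm[OF a b vV] a b vV act[OF a vV] Ac Vc by (simp add: k_def conjm_hom conjm_m_inv)
      then show ?thesis using fixA[OF b ka] ka by simp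
    qed
    then show ?thesis using act[OF b vV] by (simp add: V0_def)
  qed
  \<comment> \<open>The p-group \<open>A\<close> acts on the nontrivial p-group V/V0, so the number
    of fixed cosets is divisible by \<open>p\<close>, and a coset other than \<open>V0\<close> is
    fixed; x represents it.\<close>
  have "\<exists>x\<in>V. x \<notin> V0 \<and> (\<forall>a\<in>A. k a x \<in> V0)"
  proof -
    interpret G: group "S\<lparr>carrier := A\<rparr>" by (rule subgroup_imp_group[OF AD(3)])
    interpret GV: group "S\<lparr>carrier := V\<rparr>" by (rule subgroup_imp_group[OF V])
    define Cs where "Cs = (\<lambda>x. x <# V0) ` V"
    have sub: "subgroup V0 (S\<lparr>carrier := V\<rparr>)" by (rule subgroup_incl[OF V0 V V0V])
    have "Cs = lcosets\<^bsub>S\<lparr>carrier := V\<rparr>\<^esub> V0" by (auto simp: Cs_def LCOSETS_def)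
    then have cC: "card Cs * card V0 = card V"
      using GV.l_lagrange[OF _ sub] finite_subgroup[OF V] by (simp add: order_def)
    obtain n where n: "card V = p ^ n" using card_subgroup[OF V] by blast
    have "card Cs dvd p ^ n" unfolding n[symmetric] cC[symmetric] by simp
    then obtain j where j: "card Cs = p ^ j" using prime_p by (auto simp: divides_primepow_nat)
    have "card Cs \<noteq> 1"
    proof
      assume "card Cs = 1"
      then have "card V0 = card V" using cC by simp
      then show False using V0ne V0V finite_subgroup[OF V] card_subset_eq by blast
    qed
    then have pC: "p dvd card Cs" using j by (cases j) auto
    have shift: "conjm S a ` (x <# V0) = conjm S a x <# V0" if a: "a \<in> A" and x: "x \<in> V" for a x
    proof -
      have "conjm S a ` V0 \<subseteq> V0" using actV0[OF a] by blast
      moreover have "inj_on (conjm S a) V0" 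
        using conjm_inj[OF Ac[OF a]] subgroup.subset[OF V0] by (rule inj_on_subset)
      ultimately have im: "conjm S a ` V0 = V0" using finite_subgroup[OF V0] by (simp add: endo_inj_surj)
      have "conjm S a ` (x <# V0) = (\<lambda>v. conjm S a x \<otimes> conjm S a v) ` V0"
      proof -
        have "conjm S a ` (x <# V0) = (\<lambda>v. conjm S a (x \<otimes> v)) ` V0" by (auto simp: l_coset_def)
        also have "\<dots> = (\<lambda>v. conjm S a x \<otimes> conjm S a v) ` V0"
          by (rule image_cong[OF refl conjm_hom[OF Ac[OF a] Vc[OF x]]]) (rule subgroup.mem_carrier[OF V0])
        finally show ?thesis .
      qed
      also have "\<dots> = (\<lambda>v. conjm S a x \<otimes> v) ` (conjm S a ` V0)" by (simp add: image_image)
      also have "\<dots> = conjm S a x <# V0" unfolding im by (auto simp: l_coset_def)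
      finally show ?thesis .
    qed
    have ga: "group_action (S\<lparr>carrier := A\<rparr>) Cs (\<lambda>a. restrict (\<lambda>C. conjm S a ` C) Cs)"
    proof (rule G.group_actionI)
      fix a C assume "a \<in> carrier (S\<lparr>carrier := A\<rparr>)" "C \<in> Cs"
      then show "conjm S a ` C \<in> Cs" using shift act by (auto simp: Cs_def)
    next
      fix C assume "C \<in> Cs"
      then obtain x where "x \<in> V" "C = x <# V0" by (auto simp: Cs_def)
      then show "conjm S \<one>\<^bsub>S\<lparr>carrier := A\<rparr>\<^esub> ` C = C"
        using shift[OF subgroup.one_closed[OF AD(3)]] Vc by (simp add: conjm_one)
    next
      fix a b C assume "a \<in> carrier (S\<lparr>carrier := A\<rparr>)" "b \<in> carrier (S\<lparr>carrier := A\<rparr>)" "C \<in> Cs"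
      then obtain x where x: "x \<in> V" "C = x <# V0" "a \<in> A" "b \<in> A" by (auto simp: Cs_def)
      then show "conjm S (a \<otimes>\<^bsub>S\<lparr>carrier := A\<rparr>\<^esub> b) ` C = conjm S a ` (conjm S b ` C)"
        using shift[OF x(4,1)] shift[OF x(3) act[OF x(4,1)]] 
          shift[OF subgroup.m_closed[OF AD(3) x(3,4)] x(1)] Ac Vc by (simp add: conjm_mult)
    qed
    have finC: "finite Cs" using finite_subgroup[OF V] by (simp add: Cs_def)
    obtain m where m: "card A = p ^ m" using card_subgroup[OF AD(3)] by blast
    let ?F = "{C \<in> Cs. \<forall>a\<in>A. conjm S a ` C = C}"
    have "card Cs mod p = card ?F mod p"
      using group_action.p_group_fixed_points[OF ga prime_p _ finC, of m] m 
      by (simp add: order_def cong: conj_cong)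
    then have pF: "p dvd card ?F" using pC by (simp add: dvd_eq_mod_eq_0)
    have coset_V0: "v <# V0 = V0" if "v \<in> V0" for v
      using coset_join3[OF _ V0 that] subgroup.mem_carrier[OF V0 that] by simp
    have "V0 = \<one> <# V0" using coset_V0[OF subgroup.one_closed[OF V0]] by simp
    moreover have "conjm S a ` (\<one> <# V0) = \<one> <# V0" if "a \<in> A" for a
      using shift[OF that subgroup.one_closed[OF V]] Ac[OF that] by (simp add: conjm_def)
    ultimately have "V0 \<in> ?F" using subgroup.one_closed[OF V] by (auto simp: Cs_def)
    moreover have "?F \<noteq> {V0}"
    proof
      assume "?F = {V0}"
      then have "card ?F = 1" by simp
      with pF show False using prime_gt_1_nat[OF prime_p] by simp
    qed
    ultimately obtain C where C: "C \<in> ?F" "C \<noteq> V0" by blast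
    then obtain x where x: "x \<in> V" "C = x <# V0" by (auto simp: Cs_def)
    have "x \<notin> V0" using coset_V0[of x] C x by auto
    moreover have "k a x \<in> V0" if a: "a \<in> A" for a
    proof -
      have "conjm S a ` (x <# V0) = x <# V0" using C a x by simp
      then have eq: "conjm S a x <# V0 = x <# V0" using shift[OF a x(1)] by simp
      have "conjm S a x \<otimes> \<one> \<in> conjm S a x <# V0" 
        using subgroup.one_closed[OF V0] unfolding l_coset_def by blast
      then have "conjm S a x \<in> x <# V0" unfolding eq using Vc[OF act[OF a x(1)]] by simp
      then obtain v where v: "v \<in> V0" "conjm S a x = x \<otimes> v" by (auto simp: l_coset_def)
      then have "conjm S a x = v \<otimes> x" using Vcomm x(1) V0V by auto
      then have "k a x = v" using v(1) V0V Vc x(1) by (auto simp: k_def m_assoc)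
      then show ?thesis using v by simp
    qed
    ultimately show ?thesis using x(1) by blast
  qed
  then obtain x where x: "x \<in> V" "x \<notin> V0" and kx: "\<And>a. a \<in> A \<Longrightarrow> k a x \<in> V0" by blast
  \<comment> \<open>\<open>M\<close> is [x, A], and \<open>D\<close> below is its centralizer in
    \<open>A\<close>.\<close>
  define M where "M = generate S ((\<lambda>a. k a x) ` A)"
  have gV: "(\<lambda>a. k a x) ` A \<subseteq> V" using kV x(1) by blast
  have M: "subgroup M S" unfolding M_def 
    by (rule generate_is_subgroup) (use gV Vc in blast)
  \<comment> \<open>This is where the choice of \<open>x\<close> as fixed modulo \<open>V0\<close>
    is spent; it will prevent \<open>V\<close> from lying in \<open>B\<close>.\<close>
  have MV0: "M \<subseteq> V0" unfolding M_def by (rule generate_subgroup_incl[OF _ V0]) (use kx in blast)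
  have MV: "M \<subseteq> V" using MV0 V0V by blast
  have kM: "k a x \<in> M" if "a \<in> A" for a unfolding M_def using that by (auto intro: generate.incl)
  define D where "D = {a \<in> A. \<forall>m\<in>M. conjm S a m = m}"
  have DA: "D \<subseteq> A" by (auto simp: D_def)
  have D: "subgroup D S"
  proof (rule subgroupI)
    show "D \<subseteq> carrier S" using Ac by (auto simp: D_def)
    show "D \<noteq> {}" using subgroup.one_closed[OF AD(3)] MV Vc by (force simp: D_def conjm_one)
    fix a assume a: "a \<in> D"
    have "conjm S (inv a) m = m" if m: "m \<in> M" for m
    proof -
      have "conjm S a m = m" using a m by (simp add: D_def)
      then show ?thesis using conjm_inv[of a m] a DA Ac MV Vc m by auto
    qed
    then show "inv a \<in> D" using a subgroup.m_inv_closed[OF AD(3)] by (simp add: D_def)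
    fix b assume b: "b \<in> D"
    have "conjm S (a \<otimes> b) m = m" if m: "m \<in> M" for m
    proof -
      have "conjm S a m = m" "conjm S b m = m" using a b m by (auto simp: D_def)
      then show ?thesis using conjm_mult[of a b m] a b DA Ac MV Vc m by auto
    qed
    then show "a \<otimes> b \<in> D" using a b subgroup.m_closed[OF AD(3)] by (simp add: D_def)
  qed
  have DI: "a \<in> D" if a: "a \<in> A" and "\<And>b. b \<in> A \<Longrightarrow> conjm S a (k b x) = k b x" for a
  proof -
    have "M \<subseteq> {v \<in> V. conjm S a v = v}" unfolding M_def
      by (rule generate_subgroup_incl[OF _ fixed_subgroup[OF V Ac[OF a]]]) (use that kV x(1) in auto)
    then show ?thesis using a by (auto simp: D_def)
  qed
  define B where "B = M <#> D"
  have Mab: "M \<in> abelian_sub R" using M MV VR Vcomm unfolding abelian_sub_def by blast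
  have Dab: "D \<in> abelian_sub R" using D DA AD(4,5) unfolding abelian_sub_def by blast
  have Bab: "B \<in> abelian_sub R" unfolding B_def
  proof (rule commuting_mult_abelian[OF Mab Dab R])
    fix m d assume md: "m \<in> M" "d \<in> D"
    then have "conjm S d m = m" by (simp add: D_def)
    moreover have "d \<in> carrier S" "m \<in> carrier S" using md DA Ac MV Vc by auto
    ultimately have "d \<otimes> m = m \<otimes> d" using conjm_fixes_iff by blast
    then show "m \<otimes> d = d \<otimes> m" by simp
  qed
  have finB: "finite B" by (rule finite_subgroup[OF abelian_subD(1)[OF Bab]])
  define r where "r a = (SOME b. b \<in> a <# D)" for a
  have r: "r a \<in> A" "inv (r a) \<otimes> a \<in> D" if a: "a \<in> A" for a
  proof -
    have "a \<otimes> \<one> \<in> a <# D" using subgroup.one_closed[OF D] unfolding l_coset_def by blast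
    then have "r a \<in> a <# D" unfolding r_def some_in_eq by blast
    then obtain d where d: "d \<in> D" "r a = a \<otimes> d" by (auto simp: l_coset_def)
    then have dA: "d \<in> A" using DA by blast
    show "r a \<in> A" using d(2) dA a subgroup.m_closed[OF AD(3)] by simp
    have "inv (r a) \<otimes> a = inv d" using d(2) a dA Ac by (simp add: inv_mult_group m_assoc)
    then show "inv (r a) \<otimes> a \<in> D" using d(1) subgroup.m_inv_closed[OF D] by simp
  qed
  have r_eq: "r a = r b" if a: "a \<in> A" and b: "b \<in> A" and ab: "inv b \<otimes> a \<in> D" for a b
  proof -
    have "a = b \<otimes> (inv b \<otimes> a)" using Ac a b by (simp add: m_assoc[symmetric])
    then have "a <# D = b <# ((inv b \<otimes> a) <# D)"
      using lcos_m_assoc[OF subgroup.subset[OF D], of b "inv b \<otimes> a"] Ac a b by simp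
    also have "(inv b \<otimes> a) <# D = D" using coset_join3[OF _ D ab] Ac a b by simp
    finally show ?thesis by (simp add: r_def)
  qed
  \<comment> \<open>An injection of \<open>A\<close> into \<open>B\<close>: write a as a coset
    representative times an element of \<open>D\<close> and replace the representative by its
    commutator with x. It expresses that the index of \<open>D\<close> in \<open>A\<close> is at
    most the index of the intersection of \<open>M\<close> and \<open>D\<close> in
    \<open>M\<close>.\<close>
  let ?g = "\<lambda>a. k (r a) x \<otimes> (inv (r a) \<otimes> a)"
  have "inj_on ?g A"
  proof (rule inj_onI)
    fix a b assume a: "a \<in> A" and b: "b \<in> A" and eq: "?g a = ?g b"
    define s t d e where "s = r a" and "t = r b" and "d = inv s \<otimes> a" and "e = inv t \<otimes> b"
    have st: "s \<in> A" "t \<in> A" and de: "d \<in> D" "e \<in> D" 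
      using r[OF a] r[OF b] by (auto simp: s_def t_def d_def e_def)
    then have deA: "d \<in> A" "e \<in> A" using DA by auto
    have c: "s \<in> carrier S" "t \<in> carrier S" "d \<in> carrier S" "e \<in> carrier S" "a \<in> carrier S" "b \<in> carrier S"
      using Ac st deA a b by auto
    have xc: "x \<in> carrier S" using Vc x(1) by simp
    have kc: "k s x \<in> V" "k t x \<in> V" using kV st x(1) by auto
    have kcc: "k s x \<in> carrier S" "k t x \<in> carrier S" using Vc kc by auto
    have eq': "k s x \<otimes> d = k t x \<otimes> e" using eq by (simp add: s_def t_def d_def e_def)
    \<comment> \<open>The quotient of the commutators [s, x] and [t, x]. It lies in \<open>A\<close>
      as a quotient of elements of \<open>D\<close>, and in \<open>V\<close> as a quotient of
      commutators, so it is fixed by \<open>A\<close> and commutes with x.\<close>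
    define u where "u = e \<otimes> inv d"
    have uA: "u \<in> A" using deA subgroup.m_closed[OF AD(3)] subgroup.m_inv_closed[OF AD(3)] by (simp add: u_def)
    have uc: "u \<in> carrier S" by (rule Ac[OF uA])
    have "k s x = k s x \<otimes> d \<otimes> inv d" using c kcc by (simp add: m_assoc)
    then have ks: "k s x = k t x \<otimes> u" unfolding eq' using c kcc by (simp add: u_def m_assoc)
    then have "u = inv (k t x) \<otimes> k s x" using uc kcc by (simp add: m_assoc[symmetric])
    then have uV: "u \<in> V" using kc subgroup.m_closed[OF V] subgroup.m_inv_closed[OF V] by simp
    have cs: "conjm S s x \<in> carrier S" "conjm S t x \<in> carrier S" using c xc by (auto simp: conjm_closed)
    have "conjm S s x = k s x \<otimes> x" using cs xc by (simp add: k_def m_assoc)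
    also have "\<dots> = k t x \<otimes> (u \<otimes> x)" using ks kcc uc xc by (simp add: m_assoc)
    also have "\<dots> = k t x \<otimes> x \<otimes> u" using Vcomm[OF uV x(1)] kcc uc xc by (simp add: m_assoc)
    also have "k t x \<otimes> x = conjm S t x" using cs xc by (simp add: k_def m_assoc)
    finally have su: "conjm S s x = conjm S t x \<otimes> u" .
    \<comment> \<open>The conjugates of x under s and t differ by \<open>u\<close>, which g fixes,
      so \<open>u\<close> cancels in their commutators with g. Hence s and t act alike on the
      generators of \<open>M\<close>.\<close>
    have agree: "conjm S s (k g x) = conjm S t (k g x)" if g: "g \<in> A" for g
    proof -
      have gc: "g \<in> carrier S" by (rule Ac[OF g])
      have cg: "conjm S g (conjm S t x) \<in> carrier S" using cs gc by (simp add: conjm_closed)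
      have "conjm S s (k g x) = conjm S s (conjm S g x) \<otimes> inv (conjm S s x)"
        using c gc xc by (simp add: k_def conjm_hom conjm_m_inv conjm_closed)
      also have "\<dots> = conjm S g (conjm S s x) \<otimes> inv (conjm S s x)" using actcomm[OF st(1) g x(1)] by simp
      also have "\<dots> = conjm S g (conjm S t x) \<otimes> u \<otimes> inv (conjm S t x \<otimes> u)"
        using su fixA[OF g uA] gc cs uc by (simp add: conjm_hom)
      also have "\<dots> = conjm S g (conjm S t x) \<otimes> inv (conjm S t x)"
        using cg cs uc by (simp add: inv_mult_group m_assoc[symmetric]) (simp add: m_assoc)
      also have "\<dots> = conjm S t (conjm S g x) \<otimes> inv (conjm S t x)" using actcomm[OF st(2) g x(1)] by simp
      also have "\<dots> = conjm S t (k g x)"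
        using c gc xc by (simp add: k_def conjm_hom conjm_m_inv conjm_closed)
      finally show ?thesis .
    qed
    have ts: "inv t \<otimes> s \<in> D"
    proof (rule DI)
      show "inv t \<otimes> s \<in> A" using st subgroup.m_closed[OF AD(3)] subgroup.m_inv_closed[OF AD(3)] by simp
      fix g assume g: "g \<in> A"
      have kg: "k g x \<in> carrier S" using Vc[OF kV[OF g x(1)]] .
      then have "conjm S (inv t \<otimes> s) (k g x) = conjm S (inv t) (conjm S t (k g x))"
        using c agree[OF g] by (simp add: conjm_mult)
      then show "conjm S (inv t \<otimes> s) (k g x) = k g x" using conjm_inv c kg by simp
    qed
    have "inv b \<otimes> a = inv e \<otimes> (inv t \<otimes> s) \<otimes> d"
      using c by (simp add: d_def e_def inv_mult_group m_assoc) (simp add: m_assoc[symmetric])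
    also have "\<dots> \<in> D" using ts de subgroup.m_closed[OF D] subgroup.m_inv_closed[OF D] by simp
    finally have "s = t" using r_eq[OF a b] by (simp add: s_def t_def)
    then have "d = e" using eq' c kcc by simp
    then have "s \<otimes> (inv s \<otimes> a) = s \<otimes> (inv s \<otimes> b)" using \<open>s = t\<close> by (simp add: d_def e_def)
    then show "a = b" using c by (simp add: m_assoc[symmetric])
  qed
  moreover have "?g ` A \<subseteq> B" using r kM by (auto simp: B_def set_mult_def)
  ultimately have "card A \<le> card B" using finB by (rule card_inj_on_le)
  then have Bmax: "B \<in> max_ab R" using ab_rank_ge[OF Bab] AD(2) Bab by (simp add: max_ab_def)
  have MB: "M \<subseteq> B" and DB: "D \<subseteq> B" using subset_set_mult[OF M D] by (auto simp: B_def)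
  have AVD: "A \<inter> V \<subseteq> D"
  proof
    fix a assume a: "a \<in> A \<inter> V"
    then have "conjm S a m = m" if "m \<in> M" for m
      using conjm_fixes_iff[of a m] Vcomm[of a m] MV Vc that by auto
    then show "a \<in> D" using a by (simp add: D_def)
  qed
  \<comment> \<open>Strict because x is not in \<open>V0\<close>: some commutator with x lies in
    \<open>M\<close> but outside \<open>A\<close>.\<close>
  have "A \<inter> V \<subset> B \<inter> V"
  proof -
    obtain a where a: "a \<in> A" "k a x \<notin> A" using x unfolding V0_def by blast
    have "k a x \<in> B \<inter> V" using kM[OF a(1)] MB MV by blast
    then show ?thesis using a AVD DB by blast
  qed
  then have "card (A \<inter> V) < card (B \<inter> V)" using finB by (intro psubset_card_mono) auto
  \<comment> \<open>If B = M D contained \<open>V\<close>, each element of \<open>V\<close> would be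
    a product of one from \<open>M\<close> and one from the intersection of \<open>D\<close> and
    \<open>V\<close>, both inside \<open>V0\<close>.\<close>
  moreover have "\<not> V \<subseteq> B"
  proof
    assume VB: "V \<subseteq> B"
    have "V \<subseteq> V0"
    proof
      fix v assume v: "v \<in> V"
      then obtain m d where md: "m \<in> M" "d \<in> D" "v = m \<otimes> d" using VB by (auto simp: B_def set_mult_def)
      have c: "m \<in> carrier S" "d \<in> carrier S" using md MV Vc DA Ac by auto
      have "d = inv m \<otimes> v" using md(3) c by (simp add: m_assoc[symmetric])
      then have "d \<in> V" using v md(1) MV subgroup.m_closed[OF V] subgroup.m_inv_closed[OF V] by auto
      then have "d \<in> V0" using AV0 md(2) DA by blast
      then show "v \<in> V0" using md MV0 subgroup.m_closed[OF V0] by auto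
    qed
    then show False using V0ne V0V by blast
  qed
  ultimately show ?thesis using Bmax unfolding R_def V_def by blast
qed

text \<open>Choose \<open>A\<close> outside \<open>P\<close> with the largest intersection with
  Z(P). If [Z(P), A] were not inside \<open>A\<close>, replacement would give some B with a larger
  intersection, so B lies in \<open>P\<close> by the choice of \<open>A\<close>. Then B commutes
  with Z(P) and absorbs it, contrary to what replacement guarantees. As \<open>A\<close> is abelian,
  the conclusion gives [Z(P), A, A] = 1.\<close>

lemma quadratic_max_ab:
  assumes P: "subgroup P S" and ex: "A0 \<in> max_ab (normalizer_in S P)" "\<not> A0 \<subseteq> P"
  obtains A where "A \<in> max_ab (normalizer_in S P)" "\<not> A \<subseteq> P"
    "\<And>v a. v \<in> center_of P \<Longrightarrow> a \<in> A \<Longrightarrow> conjm S a v \<otimes> inv v \<in> A"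
proof -
  let ?R = "normalizer_in S P" and ?V = "center_of P"
  have R: "subgroup ?R S" by (rule normalizer_subgroup[OF P])
  have V: "subgroup ?V S" by (rule center_of_subgroup[OF P])
  have "\<forall>A. A \<in> max_ab ?R \<and> \<not> A \<subseteq> P \<longrightarrow> card (A \<inter> ?V) < Suc (card ?V)"
    using finite_subgroup[OF V] by (auto simp: less_Suc_eq_le intro: card_mono)
  then obtain A where A: "A \<in> max_ab ?R" "\<not> A \<subseteq> P"
    and max: "\<And>B. B \<in> max_ab ?R \<Longrightarrow> \<not> B \<subseteq> P \<Longrightarrow> card (B \<inter> ?V) \<le> card (A \<inter> ?V)"
    using ex_has_greatest_nat[of "\<lambda>A. A \<in> max_ab ?R \<and> \<not> A \<subseteq> P" A0 "\<lambda>A. card (A \<inter> ?V)" "Suc (card ?V)"] ex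
    by blast
  have "\<forall>v\<in>?V. \<forall>a\<in>A. conjm S a v \<otimes> inv v \<in> A"
  proof (rule ccontr)
    assume "\<not> (\<forall>v\<in>?V. \<forall>a\<in>A. conjm S a v \<otimes> inv v \<in> A)"
    from thompson_replacement[OF P A(1) this] obtain B where
      B: "B \<in> max_ab ?R" "card (A \<inter> ?V) < card (B \<inter> ?V)" "\<not> ?V \<subseteq> B" by blast
    have BP: "B \<subseteq> P" using max[OF B(1)] B(2) by force
    have "?V \<in> abelian_sub ?R"
      using V center_of_in center_of_comm subset_normalizer[OF P] unfolding abelian_sub_def by blast
    moreover have "a \<otimes> b = b \<otimes> a" if "a \<in> B" "b \<in> ?V" for a b
      using center_of_comm[OF that(2), of a] BP that(1) by auto
    ultimately show False using max_ab_absorbs[OF B(1) _ R] B(3) by blast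
  qed
  then show ?thesis using that A by blast
qed

subsection \<open>The norm argument for odd p\<close>

text \<open>The orbit is \<open>v D\<close> with \<open>D = [v, A]\<close> a group of odd order divisible by \<open>p\<close>, and the
  product of the elements of a finite abelian group of odd order is trivial.\<close>

lemma nontrivial_orbit_product:
  assumes P: "subgroup P S" and A: "subgroup A S" and AN: "A \<subseteq> normalizer_in S P"
    and Acomm: "\<And>a b. a \<in> A \<Longrightarrow> b \<in> A \<Longrightarrow> a \<otimes> b = b \<otimes> a"
    and quad: "\<And>v a. v \<in> center_of P \<Longrightarrow> a \<in> A \<Longrightarrow> conjm S a v \<otimes> inv v \<in> A"
    and "odd p" and v: "v \<in> center_of P" and nf: "\<not> (\<forall>a\<in>A. conjm S a v = v)"
  shows "\<exists>n. finprod (S\<lparr>carrier := center_of P\<rparr>) (\<lambda>v. v) ((\<lambda>a. conjm S a v) ` A) = (v [^] p) [^] (n::nat)"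
proof -
  define V where "V = center_of P"
  define Z where "Z = S\<lparr>carrier := V\<rparr>"
  have V: "subgroup V S" unfolding V_def by (rule center_of_subgroup[OF P])
  interpret Z: comm_group Z unfolding Z_def V_def by (rule center_of_comm_group[OF P])
  have Zsimps [simp]: "carrier Z = V" "\<And>x y. x \<otimes>\<^bsub>Z\<^esub> y = x \<otimes> y" "\<one>\<^bsub>Z\<^esub> = \<one>"
    by (auto simp: Z_def)
  have Vc: "v \<in> carrier S" if "v \<in> V" for v using that by (rule subgroup.mem_carrier[OF V])
  have Ac: "a \<in> carrier S" if "a \<in> A" for a using that by (rule subgroup.mem_carrier[OF A])
  have Vcomm: "v \<otimes> w = w \<otimes> v" if "v \<in> V" "w \<in> V" for v w
    using that center_of_comm center_of_in unfolding V_def by blast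
  have vV: "v \<in> V" using v by (simp add: V_def)
  have vc: "v \<in> carrier S" by (rule Vc[OF vV])
  have act: "conjm S a w \<in> V" if "a \<in> A" "w \<in> V" for a w
    using conjm_center[OF P] that AN unfolding V_def by blast
  define k where "k a = conjm S a v \<otimes> inv v" for a
  have kV: "k a \<in> V" if "a \<in> A" for a
    using act[OF that vV] vV subgroup.m_closed[OF V] subgroup.m_inv_closed[OF V] by (simp add: k_def)
  have kA: "k a \<in> A" if "a \<in> A" for a using quad[OF v that] by (simp add: k_def)
  have cv: "conjm S a v = v \<otimes> k a" if "a \<in> A" for a
  proof -
    have "conjm S a v = k a \<otimes> v" using Vc[OF act[OF that vV]] vc by (simp add: k_def m_assoc)
    then show ?thesis using Vcomm[OF kV[OF that] vV] by simp
  qed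
  \<comment> \<open>By \<open>quad\<close> the commutator \<open>k b\<close> lies in the abelian
    group \<open>A\<close>, so a fixes it. Hence \<open>k\<close> is multiplicative in its argument
    from \<open>A\<close>, and its image [v, A] is a subgroup.\<close>
  have "k \<in> hom (S\<lparr>carrier := A\<rparr>) S"
  proof (rule homI)
    fix a b assume "a \<in> carrier (S\<lparr>carrier := A\<rparr>)" "b \<in> carrier (S\<lparr>carrier := A\<rparr>)"
    then have ab: "a \<in> A" "b \<in> A" by auto
    have c: "k a \<in> carrier S" "k b \<in> carrier S" "conjm S a v \<in> carrier S" 
      using kV ab Vc act vV by auto
    have "conjm S a (k b) = k b" using conjm_fixes_iff[of a "k b"] Ac ab kA Acomm by simp
    then have "conjm S (a \<otimes> b) v = conjm S a v \<otimes> k b"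
      using ab Ac vc c by (simp add: conjm_mult cv[OF ab(2)] conjm_hom)
    also have "\<dots> = v \<otimes> (k a \<otimes> k b)" using cv[OF ab(1)] c vc by (simp add: m_assoc)
    also have "\<dots> = (k a \<otimes> k b) \<otimes> v" 
      using Vcomm[OF vV, of "k a \<otimes> k b"] kV ab subgroup.m_closed[OF V] by simp
    finally show "k (a \<otimes>\<^bsub>S\<lparr>carrier := A\<rparr>\<^esub> b) = k a \<otimes> k b"
      using c vc by (simp add: k_def[of "a \<otimes> b"] m_assoc)
  qed (use kV Vc in auto)
  then have "group_hom (S\<lparr>carrier := A\<rparr>) S k"
    using subgroup_imp_group[OF A] is_group by (simp add: group_hom_def group_hom_axioms_def)
  from group_hom.img_is_subgroup[OF this] have D: "subgroup (k ` A) S" by simp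
  define D' where "D' = k ` A"
  have D': "subgroup D' S" using D by (simp add: D'_def)
  have DV: "D' \<subseteq> V" using kV by (auto simp: D'_def)
  have finD: "finite D'" by (rule finite_subgroup[OF D'])
  have Oeq: "(\<lambda>a. conjm S a v) ` A = (\<lambda>d. v \<otimes> d) ` D'" using cv by (auto simp: D'_def image_image)
  have inj: "inj_on (\<lambda>d. v \<otimes> d) D'"
    using vc Vc DV by (intro inj_onI) (metis l_cancel subsetD)
  define e where "e = finprod Z (\<lambda>d. d) D'"
  have eV: "e \<in> V" using Z.finprod_closed[of "\<lambda>d. d" D'] DV by (auto simp: e_def)
  have "finprod Z (\<lambda>v. v) ((\<lambda>d. v \<otimes> d) ` D') = finprod Z (\<lambda>d. v \<otimes>\<^bsub>Z\<^esub> d) D'"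
    using Z.finprod_reindex[of "\<lambda>v. v" "\<lambda>d. v \<otimes> d" D'] inj DV vV subgroup.m_closed[OF V] 
    by (auto simp: Pi_iff subset_iff)
  also have "\<dots> = finprod Z (\<lambda>d. v) D' \<otimes>\<^bsub>Z\<^esub> finprod Z (\<lambda>d. d) D'"
    by (rule Z.finprod_multf) (use DV vV in auto)
  also have "finprod Z (\<lambda>d. v) D' = v [^]\<^bsub>Z\<^esub> card D'" using Z.finprod_const[of v D'] vV by simp
  also have "\<dots> = v [^] card D'" by (simp add: Z_def nat_pow_consistent[symmetric])
  finally have prod: "finprod Z (\<lambda>v. v) ((\<lambda>d. v \<otimes> d) ` D') = v [^] card D' \<otimes> e" by (simp add: e_def)
  \<comment> \<open>Inversion permutes \<open>D'\<close>, so \<open>e\<close> is also the product of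
    all inverses.\<close>
  have "e \<otimes> e = \<one>"
  proof -
    have iD: "inv d \<in> D'" if "d \<in> D'" for d using subgroup.m_inv_closed[OF D' that] .
    have Dc: "d \<in> carrier S" if "d \<in> D'" for d using subgroup.mem_carrier[OF D' that] .
    have injD: "inj_on (\<lambda>d. inv d) D'" using Dc by (intro inj_onI) (metis inv_inv)
    then have imD: "(\<lambda>d. inv d) ` D' = D'" using iD finD by (intro endo_inj_surj) auto
    have "e = finprod Z (\<lambda>d. d) ((\<lambda>d. inv d) ` D')" by (simp add: e_def imD)
    also have "\<dots> = finprod Z (\<lambda>d. inv d) D'"
      by (rule Z.finprod_reindex) (use injD iD DV in auto)
    finally have "e \<otimes> e = finprod Z (\<lambda>d. d) D' \<otimes>\<^bsub>Z\<^esub> finprod Z (\<lambda>d. inv d) D'" by (simp add: e_def)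
    also have "\<dots> = finprod Z (\<lambda>d. d \<otimes>\<^bsub>Z\<^esub> inv d) D'"
      by (rule Z.finprod_multf[symmetric]) (use DV iD in auto)
    also have "\<dots> = \<one>\<^bsub>Z\<^esub>" by (rule Z.finprod_one_eqI) (use Dc in simp)
    finally show ?thesis by simp
  qed
  moreover obtain n where n: "order S = p ^ n" using order_p_power by blast
  \<comment> \<open>A group of odd order has no involutions; this step breaks down for p =
    2.\<close>
  ultimately have "e = \<one>"
  proof -
    have ec: "e \<in> carrier S" by (rule Vc[OF eV])
    have "odd (order S)" using n \<open>odd p\<close> by simp
    then obtain m where "order S = 2 * m + 1" by (elim oddE)
    then have "e [^] (2 * m + 1) = \<one>" using pow_order_eq_1[OF ec] by simp
    moreover have "e [^] (2 * m) = (e [^] (2::nat)) [^] m" using ec by (simp add: nat_pow_pow)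
    moreover have "e [^] (2::nat) = \<one>" using \<open>e \<otimes> e = \<one>\<close> ec by (simp add: numeral_2_eq_2)
    ultimately show ?thesis using ec by simp
  qed
  have "card D' \<noteq> 1"
  proof
    assume "card D' = 1"
    then obtain u where "D' = {u}" by (rule card_1_singletonE)
    then have D1: "D' = {\<one>}" using subgroup.one_closed[OF D'] by auto
    have "conjm S a v = v" if "a \<in> A" for a
    proof -
      have "k a = \<one>" using D1 that by (auto simp: D'_def)
      then show ?thesis using cv[OF that] vc by simp
    qed
    with nf show False by blast
  qed
  moreover obtain j where "card D' = p ^ j" using card_subgroup[OF D'] by blast
  \<comment> \<open>A nontrivial orbit has size a positive power of \<open>p\<close>, so v^|D'| is a
    power of v^p.\<close>
  ultimately obtain i where "card D' = p * i" by (cases j) auto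
  then have "finprod Z (\<lambda>v. v) ((\<lambda>d. v \<otimes> d) ` D') = (v [^] p) [^] i"
    using prod \<open>e = \<one>\<close> vc by (simp add: nat_pow_pow)
  then show ?thesis unfolding Oeq Z_def V_def by blast
qed

text \<open>Nontrivial \<open>A\<close>-orbits are split off one at a time. All elements of
  \<open>U\<close> have the same p-th power \<open>c\<close>, so each such orbit contributes a power
  of \<open>c\<close>, and the fixed points remain.\<close>

lemma quadratic_fixed_point_product:
  assumes P: "subgroup P S" and A: "subgroup A S" and AN: "A \<subseteq> normalizer_in S P"
    and Acomm: "\<And>a b. a \<in> A \<Longrightarrow> b \<in> A \<Longrightarrow> a \<otimes> b = b \<otimes> a"
    and quad: "\<And>v a. v \<in> center_of P \<Longrightarrow> a \<in> A \<Longrightarrow> conjm S a v \<otimes> inv v \<in> A"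
    and p: "odd p" and c: "c \<in> center_of P"
    and "U \<subseteq> center_of P" and "\<And>a v. a \<in> A \<Longrightarrow> v \<in> U \<Longrightarrow> conjm S a v \<in> U"
    and "\<And>v. v \<in> U \<Longrightarrow> v [^] p = c"
  shows "\<exists>n. finprod (S\<lparr>carrier := center_of P\<rparr>) (\<lambda>v. v) U =
    finprod (S\<lparr>carrier := center_of P\<rparr>) (\<lambda>v. v) {v \<in> U. \<forall>a\<in>A. conjm S a v = v} \<otimes> c [^] (n::nat)"
  using assms(8-10)
proof (induction "card U" arbitrary: U rule: less_induct)
  case less
  define V where "V = center_of P"
  define Z where "Z = S\<lparr>carrier := V\<rparr>"
  have V: "subgroup V S" unfolding V_def by (rule center_of_subgroup[OF P])
  interpret Z: comm_group Z unfolding Z_def V_def by (rule center_of_comm_group[OF P])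
  have Zsimps [simp]: "carrier Z = V" "\<And>x y. x \<otimes>\<^bsub>Z\<^esub> y = x \<otimes> y" "\<one>\<^bsub>Z\<^esub> = \<one>"
    by (auto simp: Z_def)
  have Vc: "v \<in> carrier S" if "v \<in> V" for v using that by (rule subgroup.mem_carrier[OF V])
  have Ac: "a \<in> carrier S" if "a \<in> A" for a using that by (rule subgroup.mem_carrier[OF A])
  have UV: "U \<subseteq> V" using less.prems(1) by (simp add: V_def)
  have finU: "finite U" using UV finite_subgroup[OF V] finite_subset by blast
  have cc: "c \<in> carrier S" using c Vc by (simp add: V_def)
  let ?Fx = "\<lambda>U. {v \<in> U. \<forall>a\<in>A. conjm S a v = v}"
  have pc: "finprod Z (\<lambda>v. v) W \<in> V" if "W \<subseteq> V" for W 
    using Z.finprod_closed[of "\<lambda>v. v" W] that by auto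
  show ?case
  proof (cases "?Fx U = U")
    case True
    have "finprod Z (\<lambda>v. v) U = finprod Z (\<lambda>v. v) U \<otimes> c [^] (0::nat)" using Vc[OF pc[OF UV]] by simp
    then show ?thesis using True unfolding Z_def V_def by (metis (no_types, lifting))
  next
    case False
    then obtain v where v: "v \<in> U" "\<not> (\<forall>a\<in>A. conjm S a v = v)" by blast
    have vc: "v \<in> carrier S" using v(1) UV Vc by blast
    define Ob where "Ob = (\<lambda>a. conjm S a v) ` A"
    have OU: "Ob \<subseteq> U" using less.prems(2) v(1) by (auto simp: Ob_def)
    have "conjm S \<one> v \<in> Ob" using subgroup.one_closed[OF A] by (auto simp: Ob_def)
    then have vO: "v \<in> Ob" using vc by (simp add: conjm_one)
    have lt: "card (U - Ob) < card U" using vO v(1) finU by (intro psubset_card_mono) auto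
    have inv_closed: "conjm S a w \<in> U - Ob" if a: "a \<in> A" and w: "w \<in> U - Ob" for a w
    proof -
      have "conjm S a w \<notin> Ob"
      proof
        assume "conjm S a w \<in> Ob"
        then obtain b where b: "b \<in> A" "conjm S a w = conjm S b v" by (auto simp: Ob_def)
        have "w = conjm S (inv a) (conjm S b v)" using conjm_inv[of a w] b a w Ac UV Vc by auto
        also have "\<dots> = conjm S (inv a \<otimes> b) v" using a b Ac vc by (simp add: conjm_mult)
        finally have "w \<in> Ob" using a b subgroup.m_closed[OF A] subgroup.m_inv_closed[OF A] by (auto simp: Ob_def)
        with w show False by simp
      qed
      then show ?thesis using less.prems(2) a w by simp
    qed
    have fixO: "w \<notin> Ob" if w: "\<forall>a\<in>A. conjm S a w = w" for w
    proof
      assume "w \<in> Ob"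
      then obtain b where b: "b \<in> A" "w = conjm S b v" by (auto simp: Ob_def)
      have "conjm S (inv b) w = w" using w b(1) subgroup.m_inv_closed[OF A] by blast
      then have "v = w" using conjm_inv[of b v] b Ac vc by simp
      with w v(2) show False by blast
    qed
    obtain n where n: "finprod Z (\<lambda>v. v) (U - Ob) = finprod Z (\<lambda>v. v) (?Fx (U - Ob)) \<otimes> c [^] (n::nat)"
      using less.hyps[OF lt] less.prems inv_closed unfolding Z_def V_def by auto
    obtain m where m: "finprod Z (\<lambda>v. v) Ob = c [^] (m::nat)"
      using nontrivial_orbit_product[OF P A AN Acomm quad p _ v(2)] less.prems(1,3) v(1)
      unfolding Ob_def Z_def V_def by auto
    have Fx: "?Fx (U - Ob) = ?Fx U" using fixO by blast
    have "finprod Z (\<lambda>v. v) U = finprod Z (\<lambda>v. v) ((U - Ob) \<union> Ob)" using OU by (simp add: Un_absorb2)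
    also have "\<dots> = finprod Z (\<lambda>v. v) (U - Ob) \<otimes>\<^bsub>Z\<^esub> finprod Z (\<lambda>v. v) Ob"
      by (rule Z.finprod_Un_disjoint) (use finU finite_subset[OF OU finU] UV OU in auto)
    also have "\<dots> = finprod Z (\<lambda>v. v) (?Fx U) \<otimes> c [^] (n + m)"
    proof -
      have "?Fx U \<subseteq> V" using UV by blast
      then have "finprod Z (\<lambda>v. v) (?Fx U) \<in> carrier S" by (rule Vc[OF pc])
      then show ?thesis using cc unfolding Zsimps n m Fx by (simp add: m_assoc nat_pow_mult)
    qed
    finally show ?thesis unfolding Z_def V_def by blast
  qed
qed

section \<open>From orbit products to the invariance of central elements\<close>

lemma F_pow: assumes f: "(P, \<phi>) \<in> F" and x: "x \<in> P" shows "\<phi> (x [^] (n::nat)) = \<phi> x [^] n"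
proof (induction n)
  case 0 show ?case using F_one[OF f] by simp
next
  case (Suc n)
  have "x [^] n \<in> P" 
    by (induction n) (use x subgroup.one_closed[OF F_sub[OF f]] subgroup.m_closed[OF F_sub[OF f]] in auto)
  then show ?case using Suc F_mult[OF f _ x] by simp
qed

lemma conjm_central: 
  assumes "z \<in> grp_center S" "g \<in> carrier S" shows "conjm S g z = z"
proof -
  have "z \<in> carrier S" "g \<otimes> z = z \<otimes> g" using assms by (simp_all add: grp_center_def)
  then show ?thesis using conjm_fixes_iff assms(2) by blast
qed

lemma central_in_normalizer: 
  assumes "z \<in> grp_center S" "subgroup P S" shows "z \<in> normalizer_in S P"
proof -
  have "z \<in> carrier S" "\<And>x. x \<in> P \<Longrightarrow> z \<otimes> x = x \<otimes> z" 
    using assms(1) subgroup.mem_carrier[OF assms(2)] unfolding grp_center_def by blast+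
  then have "z \<in> centralizer_in S P" by (simp add: centralizer_in_def)
  then show ?thesis using centralizer_subset_normalizer[OF assms(2)] by blast
qed

text \<open>Glauberman's norm argument: the product of the \<open>Aut\<^sub>F P\<close>-orbit of \<open>z\<close> is \<open>z\<close> times a power
  of \<open>z\<^sup>p\<close>, because \<open>z\<close> is the only point of that orbit fixed by \<open>A\<close>.\<close>

lemma norm_argument:
  assumes "odd p" and z: "z \<in> grp_center S"
    and P: "subgroup P S" and fn: "fully_normalized S F P" and zP: "z \<in> P"
    and zp: "\<And>\<alpha>. \<alpha> \<in> AutF F P \<Longrightarrow> \<alpha> (z [^] p) = z [^] p"
    and good: "\<And>U \<psi>. (U, \<psi>) \<in> F \<Longrightarrow> z \<in> U \<Longrightarrow> level P < level U \<Longrightarrow> \<psi> z = z"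
    and JP: "thompson P = P" and lt: "level P < level (normalizer_in S P)"
    and a: "\<alpha> \<in> AutF F P"
  shows "\<alpha> z = z"
proof -
  define R where "R = normalizer_in S P"
  define V where "V = center_of P"
  define Z where "Z = S\<lparr>carrier := V\<rparr>"
  have R: "subgroup R S" unfolding R_def by (rule normalizer_subgroup[OF P])
  have PR: "P \<subseteq> R" unfolding R_def by (rule subset_normalizer[OF P])
  have V: "subgroup V S" unfolding V_def by (rule center_of_subgroup[OF P])
  interpret Z: comm_group Z unfolding Z_def V_def by (rule center_of_comm_group[OF P])
  interpret G: group "aut_group P" by (rule aut_group_group[OF P])
  have Zsimps [simp]: "carrier Z = V" "\<And>x y. x \<otimes>\<^bsub>Z\<^esub> y = x \<otimes> y" "\<one>\<^bsub>Z\<^esub> = \<one>"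
    by (auto simp: Z_def)
  have Vc: "v \<in> carrier S" if "v \<in> V" for v using that by (rule subgroup.mem_carrier[OF V])
  have zc: "z \<in> carrier S" using z by (simp add: grp_center_def)
  have zV: "z \<in> V" 
    using z zP subgroup.mem_carrier[OF P] unfolding V_def center_of_def grp_center_def by blast
  \<comment> \<open>Otherwise P and \<open>R\<close> have the same maximal abelian order and J(R)
    lies in P = J(P), so the level could not grow from \<open>P\<close> to \<open>R\<close>.\<close>
  have "\<exists>A\<in>max_ab R. \<not> A \<subseteq> P"
  proof (rule ccontr)
    assume "\<not> (\<exists>A\<in>max_ab R. \<not> A \<subseteq> P)"
    then have sub: "A \<subseteq> P" if "A \<in> max_ab R" for A using that by blast
    obtain A where A: "A \<in> max_ab R" using max_ab_nonempty[OF R] .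
    have "A \<in> abelian_sub P" using max_abD[OF A] sub[OF A] unfolding abelian_sub_def by blast
    then have "ab_rank R = ab_rank P"
      using ab_rank_ge max_abD(2)[OF A] ab_rank_mono[OF P PR] by fastforce
    moreover have "thompson R \<subseteq> thompson P" unfolding JP by (rule thompson_le[OF P sub])
    then have "card (thompson R) \<le> card (thompson P)"
      using finite_subgroup[OF thompson_subgroup] by (rule card_mono[rotated])
    ultimately show False using lt by (simp add: level_def R_def)
  qed
  then obtain A0 where A0: "A0 \<in> max_ab (normalizer_in S P)" "\<not> A0 \<subseteq> P" unfolding R_def by blast
  obtain A where A: "A \<in> max_ab R" and AP: "\<not> A \<subseteq> P"
    and quad: "\<And>v a. v \<in> center_of P \<Longrightarrow> a \<in> A \<Longrightarrow> conjm S a v \<otimes> inv v \<in> A"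
    using quadratic_max_ab[OF P A0] unfolding R_def by metis
  note AD = max_abD[OF A]
  have AN: "A \<subseteq> normalizer_in S P" using AD(4) by (simp add: R_def)
  have Ac: "a \<in> carrier S" if "a \<in> A" for a using that by (rule subgroup.mem_carrier[OF AD(3)])
  \<comment> \<open>At equal level J(U) = J(P) = P, while \<open>A\<close> is of maximal order in
    \<open>U\<close> as well and would lie in J(U).\<close>
  have above: "level P < level U" if U: "subgroup U S" "P \<subseteq> U" "A \<subseteq> U" for U
  proof (rule ccontr)
    assume "\<not> level P < level U"
    then have "level P = level U" using level_mono[OF P U(2)] by simp
    note eq = level_eq[OF P U(2) this]
    have AU: "A \<in> abelian_sub U" using AD U(3) unfolding abelian_sub_def by blast
    have "card A = ab_rank U"
      using ab_rank_ge[OF AU] AD(2) eq(1) ab_rank_mono[OF P PR] by simp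
    then have "A \<in> max_ab U" using AU by (simp add: max_ab_def)
    then have "A \<subseteq> P" using max_ab_thompson eq(2) JP by metis
    with AP show False by simp
  qed
  \<comment> \<open>If \<beta> carries the action of \<open>A\<close> on \<open>P\<close> into
    Aut_S(P), it extends to a subgroup containing \<open>P\<close> and \<open>A\<close>. That
    subgroup has larger level, where z is known to be fixed.\<close>
  have transport: "\<beta> z = z" if b: "\<beta> \<in> AutF F P"
    and bA: "\<And>a. a \<in> A \<Longrightarrow> \<exists>h\<in>normalizer_in S P. \<forall>x\<in>P. \<beta> (conjm S a x) = conjm S h (\<beta> x)" for \<beta>
  proof -
    note bF = AutF_D(1)[OF b] and bP = AutF_D(2)[OF b]
    have "A \<subseteq> N_phi S P \<beta>"
    proof
      fix a assume a: "a \<in> A"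
      then show "a \<in> N_phi S P \<beta>" using bA[OF a] AN unfolding N_phi_iff[OF bF] bP by blast
    qed
    moreover have "fully_normalized S F (\<beta> ` P)" using fn bP by simp
    then obtain \<psi> where ps: "(N_phi S P \<beta>, \<psi>) \<in> F" "\<And>x. x \<in> P \<Longrightarrow> \<psi> x = \<beta> x"
      using extension[OF bF] by metis
    ultimately have "level P < level (N_phi S P \<beta>)" using above F_sub[OF ps(1)] subset_N_phi[OF bF] by blast
    then have "\<psi> z = z" using good[OF ps(1)] subset_N_phi[OF bF] zP by blast
    then show ?thesis using ps(2)[OF zP] by simp
  qed
  \<comment> \<open>The stabilizer of z. It contains Aut_S(P) because z is central in
    \<open>S\<close>, so Sylow's theorem can be applied with a conjugating element that fixes
    z.\<close>
  define L where "L = {\<alpha> \<in> AutF F P. \<alpha> z = z}"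
  have L: "subgroup L (aut_group P)"
  proof (rule G.subgroupI)
    show "L \<subseteq> carrier (aut_group P)" by (auto simp: L_def)
    show "L \<noteq> {}" using AutF_one[OF P] zP by (force simp: L_def)
    show "inv\<^bsub>aut_group P\<^esub> \<beta> \<in> L" if "\<beta> \<in> L" for \<beta>
      using aut_group_inv[OF P, of \<beta>] that zP unfolding L_def by (metis (mono_tags, lifting) mem_Collect_eq)
    show "\<beta> \<otimes>\<^bsub>aut_group P\<^esub> \<gamma> \<in> L" if "\<beta> \<in> L" "\<gamma> \<in> L" for \<beta> \<gamma>
      using that AutF_comp[of \<beta> P \<gamma>] zP by (simp add: L_def compose_def)
  qed
  have TL: "AutS S P \<subseteq> L"
  proof
    fix t assume t: "t \<in> AutS S P"
    then obtain g where g: "g \<in> normalizer_in S P" "t = restrict (conjm S g) P" by (auto simp: AutS_def)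
    then have "t z = z" using zP conjm_central[OF z] normalizer_iff[OF P] by simp
    then show "t \<in> L" using t AutS_subset[OF P] by (auto simp: L_def)
  qed
  define Om where "Om = (\<lambda>\<alpha>. \<alpha> z) ` AutF F P"
  have OmV: "Om \<subseteq> V" using AutF_center zV unfolding Om_def V_def by blast
  have finOm: "finite Om" using OmV finite_subgroup[OF V] finite_subset by blast
  have Omc: "\<beta> v \<in> Om" if "\<beta> \<in> AutF F P" "v \<in> Om" for \<beta> v
  proof -
    obtain \<gamma> where g: "\<gamma> \<in> AutF F P" "v = \<gamma> z" using \<open>v \<in> Om\<close> by (auto simp: Om_def)
    have "\<beta> v = compose P \<beta> \<gamma> z" using g(2) zP by (simp add: compose_def)
    then show ?thesis using AutF_comp[OF \<open>\<beta> \<in> AutF F P\<close> g(1)] by (auto simp: Om_def)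
  qed
  have zOm: "z \<in> Om"
  proof -
    have "z = restrict id P z" using zP by simp
    then show ?thesis using AutF_one[OF P] unfolding Om_def by blast
  qed
  define c where "c = z [^] p"
  have cV: "c \<in> V" unfolding c_def
    using zV subgroup.one_closed[OF V] subgroup.m_closed[OF V] by (induction p) auto
  have pow: "v [^] p = c" if v: "v \<in> Om" for v
  proof -
    obtain \<gamma> where g: "\<gamma> \<in> AutF F P" "v = \<gamma> z" using v by (auto simp: Om_def)
    then show ?thesis using F_pow[OF AutF_D(1)[OF g(1)] zP, of p] zp[OF g(1)] by (simp add: c_def)
  qed
  have actOm: "conjm S a v \<in> Om" if "a \<in> A" "v \<in> Om" for a v
  proof -
    have "v \<in> P" using that(2) OmV center_of_in unfolding V_def by blast
    moreover have "restrict (conjm S a) P \<in> AutF F P" using conj_AutF[OF P] AN that(1) by blast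
    ultimately show ?thesis using Omc[of "restrict (conjm S a) P" v] that(2) by simp
  qed
  \<comment> \<open>If \<open>A\<close> fixes \<gamma>(z), then the conjugate of its action by
    \<gamma>^-1 fixes z, so an element of \<open>L\<close> moves it into Aut_S(P). The resulting
    automorphism falls under \<open>transport\<close>, which leads back to \<gamma>(z) = z.\<close>
  have fixed: "{v \<in> Om. \<forall>a\<in>A. conjm S a v = v} = {z}"
  proof (intro equalityI subsetI)
    fix v assume "v \<in> {z}"
    then show "v \<in> {v \<in> Om. \<forall>a\<in>A. conjm S a v = v}" using zOm conjm_central[OF z] Ac by auto
  next
    fix v assume "v \<in> {v \<in> Om. \<forall>a\<in>A. conjm S a v = v}"
    then obtain \<gamma> where g: "\<gamma> \<in> AutF F P" "v = \<gamma> z" and vf: "\<And>a. a \<in> A \<Longrightarrow> conjm S a v = v" 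
      by (auto simp: Om_def)
    define \<delta> where "\<delta> = inv\<^bsub>aut_group P\<^esub> \<gamma>"
    note \<delta> = aut_group_inv[OF P g(1), folded \<delta>_def]
    define h where "h a = compose P (compose P \<delta> (restrict (conjm S a) P)) \<gamma>" for a
    note ch = conj_hom[OF P AN]
    have ca: "restrict (conjm S a) P \<in> AutF F P" if "a \<in> A" for a using conj_AutF[OF P] AN that by blast
    have hG: "h a \<in> AutF F P" if "a \<in> A" for a
      unfolding h_def by (intro AutF_comp \<delta>(1) ca[OF that] g(1))
    have hom: "h \<in> hom (S\<lparr>carrier := A\<rparr>) (aut_group P)"
    proof (rule homI)
      fix a b assume "a \<in> carrier (S\<lparr>carrier := A\<rparr>)" "b \<in> carrier (S\<lparr>carrier := A\<rparr>)"
      then have ab: "a \<in> A" "b \<in> A" by auto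
      have m: "restrict (conjm S (a \<otimes> b)) P = compose P (restrict (conjm S a) P) (restrict (conjm S b) P)"
        using hom_mult[OF ch, of a b] ab by simp
      show "h (a \<otimes>\<^bsub>S\<lparr>carrier := A\<rparr>\<^esub> b) = h a \<otimes>\<^bsub>aut_group P\<^esub> h b"
      proof
        fix x
        show "h (a \<otimes>\<^bsub>S\<lparr>carrier := A\<rparr>\<^esub> b) x = (h a \<otimes>\<^bsub>aut_group P\<^esub> h b) x"
        proof (cases "x \<in> P")
          case True
          have 1: "\<gamma> x \<in> P" using AutF_D(3)[OF g(1) True] .
          have 2: "restrict (conjm S b) P (\<gamma> x) \<in> P" using AutF_D(3)[OF ca[OF ab(2)] 1] .
          have 3: "\<delta> (restrict (conjm S b) P (\<gamma> x)) \<in> P" using AutF_D(3)[OF \<delta>(1) 2] .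
          show ?thesis using True 1 2 3 \<delta>(3)[OF 2] unfolding h_def
            by (simp only: aut_group_simps compose_eq partial_object.simps monoid.simps m) (simp add: compose_eq m)
        next
          case False
          then show ?thesis by (simp add: h_def compose_def)
        qed
      qed
    qed (simp add: hG)
    have hL: "h a \<in> L" if "a \<in> A" for a
    proof -
      have "\<gamma> z \<in> P" using AutF_D(3)[OF g(1) zP] .
      then have "h a z = \<delta> (conjm S a v)" using zP g(2) by (simp add: h_def compose_def)
      also have "\<dots> = z" using vf[OF that] \<delta>(2)[OF zP] g(2) by simp
      finally show ?thesis using hG[OF that] by (simp add: L_def)
    qed
    obtain n where n: "card A = p ^ n" using card_subgroup[OF AD(3)] by blast
    have "\<exists>x\<in>L. \<forall>k\<in>carrier (S\<lparr>carrier := A\<rparr>). inv\<^bsub>aut_group P\<^esub> x \<otimes>\<^bsub>aut_group P\<^esub> h k \<otimes>\<^bsub>aut_group P\<^esub> x \<in> AutS S P"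
      by (rule G.sylow_conjugate[OF prime_p _ AutS_subgroup[OF P] _ L TL, where n=n])
        (use finite_AutF[OF P] fully_normalized_Sylow[OF P fn]
          subgroup_imp_group[OF AD(3)] n hom hL in \<open>auto simp: order_def\<close>)
    then obtain l where l: "l \<in> L" 
      and lk: "\<And>k. k \<in> A \<Longrightarrow> compose P (compose P (inv\<^bsub>aut_group P\<^esub> l) (h k)) l \<in> AutS S P" by auto
    have lG: "l \<in> AutF F P" and lz: "l z = z" using l by (auto simp: L_def)
    define m where "m = inv\<^bsub>aut_group P\<^esub> l"
    note m = aut_group_inv[OF P lG, folded m_def]
    \<comment> \<open>This is l^-1 \<gamma>^-1: it conjugates the action of \<open>A\<close> into
      Aut_S(P), and since l fixes z, \<beta>(z) = z amounts to \<gamma>(z) = z.\<close>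
    define \<beta> where "\<beta> = compose P m \<delta>"
    have b: "\<beta> \<in> AutF F P" unfolding \<beta>_def by (rule AutF_comp[OF m(1) \<delta>(1)])
    have "\<beta> z = z"
    proof (rule transport[OF b])
      fix a assume aA: "a \<in> A"
      obtain t where t: "t \<in> normalizer_in S P" "compose P (compose P m (h a)) l = restrict (conjm S t) P"
        using lk[OF aA] by (auto simp: AutS_def m_def)
      have "\<beta> (conjm S a x) = conjm S t (\<beta> x)" if x: "x \<in> P" for x
      proof -
        have dx: "\<delta> x \<in> P" using AutF_D(3)[OF \<delta>(1) x] .
        have bx: "\<beta> x = m (\<delta> x)" "\<beta> x \<in> P" using x AutF_D(3)[OF b x] by (auto simp: \<beta>_def compose_def)
        have lb: "l (\<beta> x) = \<delta> x" using bx(1) m(3)[OF dx] by simp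
        have cx: "conjm S a x \<in> P" using AutF_D(3)[OF ca[OF aA] x] x by simp
        have "conjm S t (\<beta> x) = restrict (conjm S t) P (\<beta> x)" using bx(2) by simp
        also have "\<dots> = m (h a (\<delta> x))" unfolding t(2)[symmetric] using bx(2) lb dx by (simp add: compose_def)
        also have "h a (\<delta> x) = \<delta> (conjm S a x)" using dx \<delta>(3)[OF x] x by (simp add: h_def compose_def)
        also have "m (\<delta> (conjm S a x)) = \<beta> (conjm S a x)" using cx by (simp add: \<beta>_def compose_def)
        finally show ?thesis by simp
      qed
      then show "\<exists>h\<in>normalizer_in S P. \<forall>x\<in>P. \<beta> (conjm S a x) = conjm S h (\<beta> x)" using t(1) by blast
    qed
    then have "m (\<delta> z) = z" using zP by (simp add: \<beta>_def compose_def)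
    moreover have dz: "\<delta> z \<in> P" using AutF_D(3)[OF \<delta>(1) zP] .
    ultimately have "\<delta> z = l z" using m(3)[OF dz] by simp
    then have "\<gamma> z = z" using lz \<delta>(3)[OF zP] by simp
    then show "v \<in> {z}" using g(2) by simp
  qed
  have "\<exists>n. finprod (S\<lparr>carrier := center_of P\<rparr>) (\<lambda>v. v) Om =
    finprod (S\<lparr>carrier := center_of P\<rparr>) (\<lambda>v. v) {v \<in> Om. \<forall>a\<in>A. conjm S a v = v} \<otimes> c [^] (n::nat)"
    by (rule quadratic_fixed_point_product[OF P AD(3) AN AD(5) quad \<open>odd p\<close>])
      (use cV OmV actOm pow in \<open>auto simp: V_def\<close>)
  then obtain n where n: "finprod Z (\<lambda>v. v) Om = z \<otimes> c [^] (n::nat)"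
    unfolding fixed Z_def[unfolded V_def, symmetric] using zV Z.finprod_insert[of "{}" z "\<lambda>v. v"] Vc[OF zV] by auto
  \<comment> \<open>\<alpha> permutes the orbit, so it fixes the product z c^n. It also fixes c^n,
    which is then cancelled.\<close>
  have "inj_on \<alpha> Om" 
    using F_inj[OF AutF_D(1)[OF a]] by (rule inj_on_subset) (use OmV center_of_in in \<open>auto simp: V_def\<close>)
  moreover have "\<alpha> ` Om \<subseteq> Om" using Omc[OF a] by blast
  ultimately have aOm: "inj_on \<alpha> Om" "\<alpha> ` Om = Om" using finOm by (simp_all add: endo_inj_surj)
  have "\<alpha> (finprod Z (\<lambda>v. v) Om) = finprod Z (\<lambda>v. \<alpha> v) Om"
    unfolding Z_def V_def by (rule AutF_finprod[OF a finOm]) (use OmV in \<open>auto simp: V_def\<close>)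
  also have "\<dots> = finprod Z (\<lambda>v. v) (\<alpha> ` Om)"
    by (rule Z.finprod_reindex[symmetric]) (use aOm OmV in auto)
  finally have "\<alpha> (z \<otimes> c [^] n) = z \<otimes> c [^] n" using n aOm(2) by simp
  moreover have cP: "c \<in> P" using cV center_of_in unfolding V_def by blast
  moreover have cnP: "c [^] n \<in> P"
    using cP subgroup.one_closed[OF P] subgroup.m_closed[OF P] by (induction n) auto
  moreover have "\<alpha> (c [^] n) = c [^] n" using F_pow[OF AutF_D(1)[OF a] cP] zp[OF a] by (simp add: c_def)
  ultimately have "\<alpha> z \<otimes> c [^] n = z \<otimes> c [^] n" using F_mult[OF AutF_D(1)[OF a] zP cnP] by simp
  then show ?thesis
    using r_cancel[of "c [^] n" "\<alpha> z" z] zc F_closed[OF AutF_D(1)[OF a] zP] subgroup.mem_carrier[OF P cnP] by simp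
qed

text \<open>\<open>Q\<close> and its image \<open>Q'\<close> are carried onto one fully normalized
  \<open>P\<close> by morphisms \<psi>1 and \<psi>2 defined on their normalizers. These normalizers
  have larger level, so \<psi>1 and \<psi>2 fix z by the maximal choice, and the automorphism
  \<psi>2 \<phi> \<psi>1^-1 of \<open>P\<close> fixes z only if \<phi> does.\<close>

lemma fixed_central_step:
  assumes "odd p" and z: "z \<in> grp_center S"
    and zJ: "\<forall>\<alpha>\<in>AutF F (thompson (carrier S)). \<alpha> z = z"
    and zp: "\<And>Q \<phi>. (Q, \<phi>) \<in> F \<Longrightarrow> z \<in> Q \<Longrightarrow> \<phi> (z [^] p) = z [^] p"
    and f0: "(Q0, \<phi>0) \<in> F" "z \<in> Q0"
  shows "\<phi>0 z = z"
proof (rule ccontr)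
  assume "\<phi>0 z \<noteq> z"
  define J where "J = thompson (carrier S)"
  define bad where "bad Q \<longleftrightarrow> (\<exists>\<phi>. (Q, \<phi>) \<in> F \<and> z \<in> Q \<and> \<phi> z \<noteq> z)" for Q
  have "bad Q0" using f0 \<open>\<phi>0 z \<noteq> z\<close> by (auto simp: bad_def)
  moreover have "\<forall>Q. bad Q \<longrightarrow> level Q < Suc (level (carrier S))"
    using level_mono F_sub subgroup.subset unfolding bad_def less_Suc_eq_le by blast
  ultimately obtain Q1 where "bad Q1" and max: "\<And>U. bad U \<Longrightarrow> level U \<le> level Q1"
    using ex_has_greatest_nat[of bad Q0 level "Suc (level (carrier S))"] by blast
  then obtain \<phi>1 where f1: "(Q1, \<phi>1) \<in> F" "z \<in> Q1" "\<phi>1 z \<noteq> z" by (auto simp: bad_def)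
  have good: "\<psi> z = z" if "(U, \<psi>) \<in> F" "z \<in> U" "level Q1 < level U" for U \<psi>
    using max[of U] that by (auto simp: bad_def)
  define Q where "Q = thompson Q1"
  define \<phi> where "\<phi> = restrict \<phi>1 Q"
  have s1: "subgroup Q1 S" by (rule F_sub[OF f1(1)])
  have Q: "subgroup Q S" unfolding Q_def by (rule thompson_subgroup)
  have JQ: "thompson Q = Q" unfolding Q_def by (rule thompson_idem(2)[OF s1])
  have lQ: "level Q = level Q1" unfolding Q_def by (rule level_thompson[OF s1])
  have zQ: "z \<in> Q" unfolding Q_def by (rule central_in_thompson[OF z f1(2) s1])
  have f: "(Q, \<phi>) \<in> F" unfolding \<phi>_def
    by (rule F_restrict[OF f1(1) Q]) (simp add: Q_def thompson_subset[OF s1])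
  have phz: "\<phi> z \<noteq> z" using zQ f1(3) by (simp add: \<phi>_def)
  \<comment> \<open>An image of J(S) is again generated by abelian subgroups of the maximal order in
    \<open>S\<close>, hence lies in J(S), and it has the same order.\<close>
  have conj_le_J: "\<psi> ` U = J" if U: "(U, \<psi>) \<in> F" "U = J" for U \<psi>
  proof -
    have "thompson (\<psi> ` U) = \<psi> ` U" "ab_rank (\<psi> ` U) = ab_rank (carrier S)"
      using thompson_image[OF U(1)] ab_rank_image[OF U(1)] U(2) 
        thompson_idem[OF subgroup_carrier] by (simp_all add: J_def)
    then have "\<psi> ` U \<subseteq> J"
      using thompson_mono[OF subgroup.subset[OF F_image[OF U(1)]]] unfolding J_def by simp
    moreover have "card (\<psi> ` U) = card J" using F_card[OF U(1)] U(2) by simp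
    ultimately show ?thesis using finite_subgroup[OF thompson_subgroup] unfolding J_def by (simp add: card_subset_eq)
  qed
  have QJ: "Q \<noteq> J"
  proof
    assume "Q = J"
    then have "\<phi> \<in> AutF F J" using f conj_le_J[OF f] by (simp add: AutF_def)
    then show False using zJ phz unfolding J_def by blast
  qed
  have img: "\<psi> ` Q \<noteq> J" if p: "(Q, \<psi>) \<in> F" for \<psi>
  proof
    assume eq: "\<psi> ` Q = J"
    obtain \<kappa> where "(\<psi> ` Q, \<kappa>) \<in> F" "\<kappa> ` \<psi> ` Q = Q" using F_back[OF p] by metis
    then show False using conj_le_J[of "\<psi> ` Q" \<kappa>] eq QJ by simp
  qed
  have img_thompson: "thompson (\<psi> ` Q) = \<psi> ` Q" if "(Q, \<psi>) \<in> F" for \<psi>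
    using thompson_image[OF that] JQ by simp
  \<comment> \<open>Every image of \<open>Q\<close> is its own Thompson subgroup and differs from
    J(S), so its normalizer has larger level.\<close>
  have norm_above: "level Q1 < level (normalizer_in S (\<psi> ` Q))" if p: "(Q, \<psi>) \<in> F" for \<psi>
    using level_normalizer[OF F_image[OF p] img_thompson[OF p]] img[OF p] level_image[OF p] lQ
    by (simp add: J_def)
  have norm_fix: "\<kappa> z = z" if "(Q, \<psi>) \<in> F" "(normalizer_in S (\<psi> ` Q), \<kappa>) \<in> F" for \<psi> \<kappa>
    by (rule good[OF that(2) central_in_normalizer[OF z F_image[OF that(1)]] norm_above[OF that(1)]])
  obtain \<chi> where c: "(Q, \<chi>) \<in> F" "fully_normalized S F (\<chi> ` Q)"
    using fully_normalized_conjugate[OF Q] by metis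
  define P where "P = \<chi> ` Q"
  define Q' where "Q' = \<phi> ` Q"
  have P: "subgroup P S" unfolding P_def by (rule F_image[OF c(1)])
  have idQ: "(Q, restrict id Q) \<in> F" using AutF_one[OF Q] AutF_D(1) by blast
  obtain \<psi>1 where p1: "(normalizer_in S Q, \<psi>1) \<in> F" "\<psi>1 ` Q = P"
    using extend_to_normalizer[OF c] unfolding P_def by metis
  have p1z: "\<psi>1 z = z" using norm_fix[OF idQ] p1(1) by simp
  obtain \<phi>i where fi: "(Q', \<phi>i) \<in> F" "\<phi>i ` Q' = Q" using F_back[OF f] unfolding Q'_def by metis
  \<comment> \<open>\<open>P\<close> is also the image of \<open>Q'\<close>, under \<chi> \<phi>^-1,
    so the extension to the normalizer works for \<open>Q'\<close> with the same target.\<close>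
  have c': "(Q', restrict (\<chi> \<circ> \<phi>i) Q') \<in> F" by (rule F_comp[OF fi(1) c(1)]) (simp add: fi(2))
  have c'im: "restrict (\<chi> \<circ> \<phi>i) Q' ` Q' = P" unfolding P_def fi(2)[symmetric] by (simp add: image_comp)
  obtain \<psi>2 where p2: "(normalizer_in S Q', \<psi>2) \<in> F" "\<psi>2 ` Q' = P"
    using extend_to_normalizer[OF c'] c(2) unfolding c'im P_def by metis
  have p2z: "\<psi>2 z = z" using norm_fix[OF f] p2(1) by (simp add: Q'_def)
  have zP: "z \<in> P" using p1(2) p1z zQ by (metis imageI)
  have q1: "(Q, restrict \<psi>1 Q) \<in> F" by (rule F_restrict[OF p1(1) Q subset_normalizer[OF Q]])
  have q1im: "restrict \<psi>1 Q ` Q = P" using p1(2) by simp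
  obtain \<iota> where i: "(P, \<iota>) \<in> F" "\<iota> ` P = Q" "\<And>x. x \<in> Q \<Longrightarrow> \<iota> (restrict \<psi>1 Q x) = x"
    using F_back[OF q1] unfolding q1im by metis
  have iz: "\<iota> z = z" using i(3)[OF zQ] zQ p1z by simp
  have g1: "(P, restrict (\<phi> \<circ> \<iota>) P) \<in> F" by (rule F_comp[OF i(1) f]) (simp add: i(2))
  have g1im: "restrict (\<phi> \<circ> \<iota>) P ` P = Q'" unfolding Q'_def i(2)[symmetric] by (simp add: image_comp)
  have sQ': "subgroup Q' S" unfolding Q'_def by (rule F_image[OF f])
  define \<alpha> where "\<alpha> = restrict (\<psi>2 \<circ> restrict (\<phi> \<circ> \<iota>) P) P"
  have "(P, \<alpha>) \<in> F" unfolding \<alpha>_def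
    by (rule F_comp[OF g1 p2(1)]) (unfold g1im, rule subset_normalizer[OF sQ'])
  moreover have "\<alpha> ` P = \<psi>2 ` (restrict (\<phi> \<circ> \<iota>) P ` P)" by (simp add: \<alpha>_def image_comp)
  then have "\<alpha> ` P = P" unfolding g1im p2(2) .
  ultimately have aut: "\<alpha> \<in> AutF F P" by (simp add: AutF_def)
  have "\<alpha> z = z"
  proof (rule norm_argument[OF \<open>odd p\<close> z P _ zP _ _ _ _ aut])
    show "fully_normalized S F P" using c(2) by (simp add: P_def)
    show "\<beta> (z [^] p) = z [^] p" if "\<beta> \<in> AutF F P" for \<beta> by (rule zp[OF AutF_D(1)[OF that] zP])
    have lP: "level P = level Q1" using level_image[OF c(1)] lQ by (simp add: P_def)
    show "\<psi> z = z" if "(U, \<psi>) \<in> F" "z \<in> U" "level P < level U" for U \<psi>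
      using good that lP by simp
    show "thompson P = P" unfolding P_def by (rule img_thompson[OF c(1)])
    show "level P < level (normalizer_in S P)" using norm_above[OF c(1)] lP by (simp add: P_def)
  qed
  \<comment> \<open>\<psi>2 is injective on the normalizer of \<open>Q'\<close>, which contains both
    z and its image under \<phi>.\<close>
  then have "\<psi>2 (\<phi> z) = \<psi>2 z" using zP iz p2z by (simp add: \<alpha>_def)
  moreover have "\<phi> z \<in> normalizer_in S Q'" using subset_normalizer[OF sQ'] zQ by (auto simp: Q'_def)
  moreover have "z \<in> normalizer_in S Q'" by (rule central_in_normalizer[OF z sQ'])
  ultimately have "\<phi> z = z" using F_inj[OF p2(1)] by (simp add: inj_on_eq_iff)
  with phz show False by simp
qed

text \<open>Induction on n with z^(p^n) = 1: the hypotheses on \<open>z\<close> pass to z^p, and the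
  conclusion for z^p is the invariance that \<open>fixed_central_step\<close> requires.\<close>

lemma fixed_central:
  assumes "odd p" and z: "z \<in> grp_center S"
    and zJ: "\<forall>\<alpha>\<in>AutF F (thompson (carrier S)). \<alpha> z = z"
    and f: "(Q, \<phi>) \<in> F" "z \<in> Q"
  shows "\<phi> z = z"
proof -
  have claim: "\<phi> z = z" if "z [^] (p ^ n) = \<one>" "z \<in> grp_center S"
    "\<forall>\<alpha>\<in>AutF F (thompson (carrier S)). \<alpha> z = z" "(Q, \<phi>) \<in> F" "z \<in> Q" for n z Q \<phi>
    using that
  proof (induction n arbitrary: z Q \<phi>)
    case 0
    then have "z = \<one>" by (simp add: grp_center_def)
    then show ?case using F_one[OF 0(4)] by simp
  next
    case (Suc n)
    have zc: "z \<in> carrier S" using Suc.prems(2) by (simp add: grp_center_def)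
    have powin: "z [^] (k::nat) \<in> H" if "subgroup H S" "z \<in> H" for H k
      by (induction k) (use that subgroup.one_closed subgroup.m_closed in auto)
    have zJin: "z \<in> thompson (carrier S)" by (rule central_in_thompson[OF Suc.prems(2) zc subgroup_carrier])
    show ?case
    proof (rule fixed_central_step[OF \<open>odd p\<close> Suc.prems(2,3) _ Suc.prems(4,5)])
      fix Q' \<phi>' assume f': "(Q', \<phi>') \<in> F" "z \<in> Q'"
      show "\<phi>' (z [^] p) = z [^] p"
      proof (rule Suc.IH[OF _ _ _ f'(1)])
        show "(z [^] p) [^] (p ^ n) = \<one>" using Suc.prems(1) zc by (simp add: nat_pow_pow)
        show "z [^] p \<in> grp_center S" by (rule powin[OF grp_center_subgroup Suc.prems(2)])
        show "z [^] p \<in> Q'" by (rule powin[OF F_sub[OF f'(1)] f'(2)])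
        show "\<forall>\<alpha>\<in>AutF F (thompson (carrier S)). \<alpha> (z [^] p) = z [^] p"
        proof
          fix \<alpha> assume a: "\<alpha> \<in> AutF F (thompson (carrier S))"
          have "\<alpha> z = z" by (rule bspec[OF Suc.prems(3) a])
          then show "\<alpha> (z [^] p) = z [^] p" using F_pow[OF AutF_D(1)[OF a] zJin] by simp
        qed
      qed
    qed
  qed
  obtain n where "order S = p ^ n" using order_p_power by blast
  then have "z [^] (p ^ n) = \<one>" using pow_order_eq_1[of z] z by (simp add: grp_center_def)
  from claim[OF this z zJ f] show ?thesis .
qed

lemma direct_factor_of_odd:
  assumes "odd p" shows "direct_factor S (center_fusion S F) (grp_center S)"
proof -
  define J where "J = thompson (carrier S)"
  have J: "subgroup J S" unfolding J_def by (rule thompson_subgroup)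
  have nJ: "normalizer_in S J = carrier S"
  proof
    show "normalizer_in S J \<subseteq> carrier S" by (auto simp: normalizer_in_def)
    show "carrier S \<subseteq> normalizer_in S J"
      using normalizer_thompson[OF subgroup_carrier] subset_normalizer[OF subgroup_carrier]
      unfolding J_def by blast
  qed
  have ZJ: "grp_center S \<subseteq> J"
    using central_in_thompson[OF _ _ subgroup_carrier] unfolding J_def by (auto simp: grp_center_def)
  have "center_fusion S F = {z \<in> grp_center S. \<forall>\<alpha>\<in>AutF F J. \<alpha> z = z}"
  proof (intro equalityI subsetI)
    fix z assume z: "z \<in> center_fusion S F"
    then have "z \<in> grp_center S" by (simp add: center_fusion_def)
    then show "z \<in> {z \<in> grp_center S. \<forall>\<alpha>\<in>AutF F J. \<alpha> z = z}"
      using center_fusionD[OF z] AutF_D(1) ZJ by blast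
  next
    fix z assume "z \<in> {z \<in> grp_center S. \<forall>\<alpha>\<in>AutF F J. \<alpha> z = z}"
    then have z: "z \<in> grp_center S" and fz: "\<forall>\<alpha>\<in>AutF F J. \<alpha> z = z" by blast+
    show "z \<in> center_fusion S F"
    proof (rule center_fusionI[OF z])
      fix P \<phi> assume "(P, \<phi>) \<in> F" "z \<in> P"
      then show "\<phi> z = z" by (rule fixed_central[OF assms z fz[unfolded J_def]])
    qed
  qed
  then show ?thesis using norm_direct_factor[OF J nJ ZJ] by simp
qed

end

theorem theorem1p2:
  fixes p :: nat and S :: "('a, 'b) monoid_scheme" and F :: "('a set \<times> ('a \<Rightarrow> 'a)) set"
  assumes "Factorial_Ring.prime p"
    and "finite_p_group p S"
    and "saturated_fusion_system p S F"
    and "odd p \<or> grp_center S \<subseteq> Op_fusion S F"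
  shows "direct_factor S (center_fusion S F) (grp_center S)"
proof -
  interpret saturated_fusion S p F
    using assms(1-3) by (simp add: saturated_fusion_def saturated_fusion_axioms_def finite_p_group_def)
  show ?thesis using assms(4) direct_factor_of_odd direct_factor_of_center_le_Op by blast
qed

end
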